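(* Let $(X,G)$ be a minimal topological dynamical system with property $( * )$. Then every $E\in\mathcal X_{eq}^{\mathrm{meas}}$ is an IT-set.
   Context: $G$ is an infinite countable discrete group; a tds $(X,G)$ is a compact metric space $(X,d)$ with a $G$-action by homeomorphisms; minimal means no proper nonempty closed invariant subset; a minimal point is one with minimal orbit closure. $\pi_{eq}:X\to X_{eq}$ is the factor map onto the maximal equicontinuous factor, $\nu_{eq}$ the unique invariant probability measure of $(X_{eq},G)$. Property $( * )$: either (1) $(X,G)$ is incontractible, i.e. for every $n$ the minimal points of $(X^n,G)$ are dense in $X^n$; or (2) $(X,G)$ satisfies the local Bronstein condition and admits an invariant Borel probability measure. Here $RP_2(X,G)$ is the set of $(x_1,x_2)$ such that for every $\epsilon>0$ there are $x_1',x_2'$ and $g\in G$ with $d(x_k,x_k')\le\epsilon$, $d(gx_1',gx_2')\le\epsilon$; local Bronstein means whenever $(x,x')\in RP_2(X,G)$ is a minimal point of $(X\times X,G)$, there are minimal points $(x_n,x_n')\to(x,x')$ of $(X\times X,G)$ and $g_n\in G$ with $d(g_nx_n,g_nx_n')\to0$. $2^X$ is the space of nonempty closed subsets with the Hausdorff metric $d_H$, and $G$ acts on it by $gA=\{ga:a\in A\}$. $\mathcal X=\overline{\{\pi_{eq}^{-1}(y):y\in X_{eq}\}}\subset 2^X$; each $E\in\mathcal X$ lies in a single fiber and $\pi_{\mathcal X}(E)$ denotes the point $\pi_{eq}(E)$. $\mathcal X_{eq}^{\mathrm{meas}}=\{E\in\mathcal X: \nu_{eq}(\pi_{\mathcal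 X}(B^{\mathcal X}_\epsilon(E)))>0\ \forall \epsilon>0\}$, where $B^{\mathcal X}_\epsilon(E)$ is the open $d_H$-ball in $\mathcal X$. A $K$-IT-tuple is $(x_1,\dots,x_K)$ such that for all open neighborhoods $U_k\ni x_k$ there is an infinite $J\subset G$ with $\bigcap_{g\in I}g^{-1}U_{\sigma(g)}\neq\emptyset$ for every nonempty finite $I\subset J$ and $\sigma:I\to\{1,\dots,K\}$; an IT-set is a nonempty set all of whose finite tuples are IT-tuples. *)

theory Defs
  imports "HOL-Probability.Probability"
begin

text \<open>A tds: a compact metric space X (a subset of a metric type) with an action of the
  (discrete) group 'g by homeomorphisms. Since 'g is a group and each act g is continuous
  with act 0 = id and act (g+h) = act g o act h, every act g is a homeomorphism of X.\<close>

definition tds :: "'x::metric_space set \<Rightarrow> ('g::group_add \<Rightarrow> 'x \<Rightarrow> 'x) \<Rightarrow> bool" where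
  "tds X act \<longleftrightarrow> compact X \<and> X \<noteq> {} \<and>
     (\<forall>g. continuous_on X (act g) \<and> act g ` X \<subseteq> X) \<and>
     (\<forall>x\<in>X. act 0 x = x) \<and>
     (\<forall>g h. \<forall>x\<in>X. act (g + h) x = act g (act h x))"

definition minimal_set :: "'a topology \<Rightarrow> ('g \<Rightarrow> 'a \<Rightarrow> 'a) \<Rightarrow> 'a set \<Rightarrow> bool" where
  "minimal_set T act M \<longleftrightarrow> M \<noteq> {} \<and> closedin T M \<and> (\<forall>g. act g ` M \<subseteq> M) \<and>
     (\<forall>A. A \<subseteq> M \<and> A \<noteq> {} \<and> closedin T A \<and> (\<forall>g. act g ` A \<subseteq> A) \<longrightarrow> A = M)"

definition orbit_closure :: "'a topology \<Rightarrow> ('g \<Rightarrow> 'a \<Rightarrow> 'a) \<Rightarrow> 'a \<Rightarrow> 'a set" where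
  "orbit_closure T act p = T closure_of (range (\<lambda>g. act g p))"

definition minimal_point :: "'a topology \<Rightarrow> ('g \<Rightarrow> 'a \<Rightarrow> 'a) \<Rightarrow> 'a \<Rightarrow> bool" where
  "minimal_point T act p \<longleftrightarrow> p \<in> topspace T \<and> minimal_set T act (orbit_closure T act p)"

definition minimal_tds :: "'x::metric_space set \<Rightarrow> ('g::group_add \<Rightarrow> 'x \<Rightarrow> 'x) \<Rightarrow> bool" where
  "minimal_tds X act \<longleftrightarrow> tds X act \<and> minimal_set (top_of_set X) act X"

definition power_top :: "'x::metric_space set \<Rightarrow> nat \<Rightarrow> (nat \<Rightarrow> 'x) topology" where
  "power_top X n = product_topology (\<lambda>_. top_of_set X) {..<n}"

definition diag_act :: "('g \<Rightarrow> 'x \<Rightarrow> 'x) \<Rightarrow> nat \<Rightarrow> 'g \<Rightarrow> (nat \<Rightarrow> 'x) \<Rightarrow> (nat \<Rightarrow> 'x)" where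
  "diag_act act n g p = (\<lambda>i\<in>{..<n}. act g (p i))"

definition pair_act :: "('g \<Rightarrow> 'x \<Rightarrow> 'x) \<Rightarrow> 'g \<Rightarrow> 'x \<times> 'x \<Rightarrow> 'x \<times> 'x" where
  "pair_act act g p = (act g (fst p), act g (snd p))"

definition incontractible :: "'x::metric_space set \<Rightarrow> ('g \<Rightarrow> 'x \<Rightarrow> 'x) \<Rightarrow> bool" where
  "incontractible X act \<longleftrightarrow>
     (\<forall>n. power_top X n closure_of {p \<in> topspace (power_top X n). minimal_point (power_top X n) (diag_act act n) p}
          = topspace (power_top X n))"

definition RP2 :: "'x::metric_space set \<Rightarrow> ('g \<Rightarrow> 'x \<Rightarrow> 'x) \<Rightarrow> ('x \<times> 'x) set" where
  "RP2 X act = {(x1, x2). x1 \<in> X \<and> x2 \<in> X \<and>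
     (\<forall>\<epsilon>>0. \<exists>x1'\<in>X. \<exists>x2'\<in>X. \<exists>g. dist x1 x1' \<le> \<epsilon> \<and> dist x2 x2' \<le> \<epsilon> \<and>
        dist (act g x1') (act g x2') \<le> \<epsilon>)}"

definition local_Bronstein :: "'x::metric_space set \<Rightarrow> ('g \<Rightarrow> 'x \<Rightarrow> 'x) \<Rightarrow> bool" where
  "local_Bronstein X act \<longleftrightarrow>
     (\<forall>x x'. (x, x') \<in> RP2 X act \<and> minimal_point (top_of_set (X \<times> X)) (pair_act act) (x, x') \<longrightarrow>
        (\<exists>xs xs' :: nat \<Rightarrow> 'x. \<exists>gs :: nat \<Rightarrow> 'g.
           (\<forall>n. minimal_point (top_of_set (X \<times> X)) (pair_act act) (xs n, xs' n)) \<and>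
           (\<lambda>n. (xs n, xs' n)) \<longlonglongrightarrow> (x, x') \<and>
           (\<lambda>n. dist (act (gs n) (xs n)) (act (gs n) (xs' n))) \<longlonglongrightarrow> 0))"

definition invariant_prob_measure :: "'x::metric_space set \<Rightarrow> ('g \<Rightarrow> 'x \<Rightarrow> 'x) \<Rightarrow> 'x measure \<Rightarrow> bool" where
  "invariant_prob_measure X act \<mu> \<longleftrightarrow> prob_space \<mu> \<and> sets \<mu> = sets (restrict_space borel X) \<and>
     space \<mu> = X \<and>
     (\<forall>g. act g \<in> measurable \<mu> \<mu> \<and>
        (\<forall>A\<in>sets \<mu>. emeasure \<mu> (act g -` A \<inter> space \<mu>) = emeasure \<mu> A))"

definition property_star :: "'x::metric_space set \<Rightarrow> ('g \<Rightarrow> 'x \<Rightarrow> 'x) \<Rightarrow> bool" where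
  "property_star X act \<longleftrightarrow> incontractible X act \<or>
     (local_Bronstein X act \<and> (\<exists>\<mu>. invariant_prob_measure X act \<mu>))"

definition factor_map :: "'x::metric_space set \<Rightarrow> ('g \<Rightarrow> 'x \<Rightarrow> 'x) \<Rightarrow>
    'y::metric_space set \<Rightarrow> ('g \<Rightarrow> 'y \<Rightarrow> 'y) \<Rightarrow> ('x \<Rightarrow> 'y) \<Rightarrow> bool" where
  "factor_map X act Y actY \<pi> \<longleftrightarrow> continuous_on X \<pi> \<and> \<pi> ` X = Y \<and>
     (\<forall>g. \<forall>x\<in>X. \<pi> (act g x) = actY g (\<pi> x))"

definition equicontinuous :: "'y::metric_space set \<Rightarrow> ('g \<Rightarrow> 'y \<Rightarrow> 'y) \<Rightarrow> bool" where
  "equicontinuous Y actY \<longleftrightarrow>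
     (\<forall>\<epsilon>>0. \<exists>\<delta>>0. \<forall>y\<in>Y. \<forall>y'\<in>Y. dist y y' < \<delta> \<longrightarrow> (\<forall>g. dist (actY g y) (actY g y') < \<epsilon>))"

text \<open>Maximal equicontinuous factor. Every compact metric space embeds in the Hilbert cube,
  hence in the metric space nat \<Rightarrow> real (product topology), so quantifying over equicontinuous
  factors living in nat \<Rightarrow> real covers all equicontinuous factors up to isomorphism.\<close>
definition max_equicontinuous_factor :: "'x::metric_space set \<Rightarrow> ('g::group_add \<Rightarrow> 'x \<Rightarrow> 'x) \<Rightarrow>
    'y::metric_space set \<Rightarrow> ('g \<Rightarrow> 'y \<Rightarrow> 'y) \<Rightarrow> ('x \<Rightarrow> 'y) \<Rightarrow> bool" where
  "max_equicontinuous_factor X act Y actY \<pi> \<longleftrightarrow>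
     tds Y actY \<and> equicontinuous Y actY \<and> factor_map X act Y actY \<pi> \<and>
     (\<forall>(Z :: (nat \<Rightarrow> real) set) actZ \<psi>.
        tds Z actZ \<and> equicontinuous Z actZ \<and> factor_map X act Z actZ \<psi> \<longrightarrow>
        (\<exists>\<phi>. factor_map Y actY Z actZ \<phi> \<and> (\<forall>x\<in>X. \<psi> x = \<phi> (\<pi> x))))"

definition hausdorff_dist :: "'x::metric_space set \<Rightarrow> 'x set \<Rightarrow> real" where
  "hausdorff_dist A B = max (SUP a\<in>A. infdist a B) (SUP b\<in>B. infdist b A)"

definition fiber :: "'x set \<Rightarrow> ('x \<Rightarrow> 'y) \<Rightarrow> 'y \<Rightarrow> 'x set" where
  "fiber X \<pi> y = {x \<in> X. \<pi> x = y}"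

definition calX :: "'x::metric_space set \<Rightarrow> 'y set \<Rightarrow> ('x \<Rightarrow> 'y) \<Rightarrow> 'x set set" where
  "calX X Y \<pi> = {E. E \<noteq> {} \<and> E \<subseteq> X \<and> closed E \<and>
     (\<forall>\<epsilon>>0. \<exists>y\<in>Y. hausdorff_dist (fiber X \<pi> y) E < \<epsilon>)}"

text \<open>\<pi>_\<X>(E): the common \<pi>-image of the points of E (E lies in a single fiber).\<close>
definition piX :: "('x \<Rightarrow> 'y) \<Rightarrow> 'x set \<Rightarrow> 'y" where
  "piX \<pi> E = \<pi> (SOME x. x \<in> E)"

definition calX_ball :: "'x::metric_space set \<Rightarrow> 'y set \<Rightarrow> ('x \<Rightarrow> 'y) \<Rightarrow> 'x set \<Rightarrow> real \<Rightarrow> 'x set set" where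
  "calX_ball X Y \<pi> E \<epsilon> = {F \<in> calX X Y \<pi>. hausdorff_dist E F < \<epsilon>}"

definition calX_meas :: "'x::metric_space set \<Rightarrow> 'y set \<Rightarrow> ('x \<Rightarrow> 'y) \<Rightarrow> 'y measure \<Rightarrow> 'x set set" where
  "calX_meas X Y \<pi> \<nu> = {E \<in> calX X Y \<pi>.
     \<forall>\<epsilon>>0. measure \<nu> (piX \<pi> ` calX_ball X Y \<pi> E \<epsilon>) > 0}"

definition IT_tuple :: "'x::metric_space set \<Rightarrow> ('g \<Rightarrow> 'x \<Rightarrow> 'x) \<Rightarrow> 'x list \<Rightarrow> bool" where
  "IT_tuple X act xs \<longleftrightarrow>
     (\<forall>U :: nat \<Rightarrow> 'x set. (\<forall>k<length xs. openin (top_of_set X) (U k) \<and> xs ! k \<in> U k) \<longrightarrow>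
        (\<exists>J :: 'g set. infinite J \<and>
           (\<forall>I \<sigma>. I \<subseteq> J \<and> finite I \<and> I \<noteq> {} \<and> (\<forall>g\<in>I. \<sigma> g < length xs) \<longrightarrow>
              (\<Inter>g\<in>I. {x \<in> X. act g x \<in> U (\<sigma> g)}) \<noteq> {})))"

definition IT_set :: "'x::metric_space set \<Rightarrow> ('g \<Rightarrow> 'x \<Rightarrow> 'x) \<Rightarrow> 'x set \<Rightarrow> bool" where
  "IT_set X act E \<longleftrightarrow> E \<noteq> {} \<and> (\<forall>xs. set xs \<subseteq> E \<longrightarrow> IT_tuple X act xs)"

end

theory Submission
  imports Defs
begin

text \<open>
  Let \<open>A\<close> be the set of points of \<open>Y\<close> whose fibre meets a small closed ball around each of
  \<open>x\<^sub>1, \<dots>, x\<^sub>K\<close>; the hypothesis on \<open>E\<close> makes its measure positive. The independence set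
  \<open>g\<^sub>1, g\<^sub>2, \<dots>\<close> is built inductively, together with open sets \<open>W\<^sub>\<sigma>\<close> (\<open>\<sigma>\<close> a word of length \<open>n\<close>) with
  \<open>g\<^sub>i W\<^sub>\<sigma> \<subseteq> U\<^bsub>\<sigma>(i)\<^esub>\<close> and points \<open>y\<^sub>\<sigma>\<close> inside \<open>\<pi>(W\<^sub>\<sigma>)\<close>.

  Two facts drive the step. First, if every \<open>y\<^sub>\<sigma>\<close> is close enough to that of its parent word, with
  closeness prescribed in advance by \<open>A\<close> alone, then some translate of the whole finite tree is
  arbitrarily close to points of \<open>A\<close>. This replaces Haar measure on the Ellis group of \<open>Y\<close>: one
  conditions a power of \<open>\<nu>\<close> on a tube around the diagonal orbit of the tree, whose marginals are
  again \<open>\<nu>\<close>. Second, the diagonal action on powers of \<open>X\<close> is topologically transitive relative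
  to \<open>Y\<close>: finitely many open \<open>W\<^sub>j\<close>, \<open>U\<^sub>j\<close> with \<open>\<pi>(U\<^sub>j) \<subseteq> \<pi>(W\<^sub>j)\<close> admit a common \<open>g\<close> with
  \<open>g W\<^sub>j \<inter> U\<^sub>j \<noteq> {}\<close> for all \<open>j\<close>.

  The second fact reduces to finding \<open>g\<close> with \<open>g W \<inter> U \<noteq> {}\<close> and \<open>g A \<inter> A \<noteq> {}\<close> for finitely many
  open \<open>A\<close>. With an invariant measure \<open>\<mu>\<close>, the measure of the set of points of a power of \<open>X\<close>
  reached together with \<open>z\<close> does not depend on \<open>z\<close>, and the measure of the symmetric
  difference of two such sets is a continuous invariant pseudometric, hence vanishes on fibres
  (McMahon's argument). If \<open>X\<close> is incontractible, one works in the enveloping semigroup with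
  the idempotents of one minimal left ideal: the relation \<open>Q\<close> of pairs joined by elements of all
  return time sets is transitive on jointly minimal points, generates a closed
  equivalence relation with equicontinuous quotient, and therefore contains every minimal pair
  in a fibre.
\<close>

section \<open>Minimal systems and factors\<close>

abbreviation oin :: "'a::topological_space set \<Rightarrow> 'a set \<Rightarrow> bool" where
  "oin X W \<equiv> openin (top_of_set X) W"

text \<open>An elementary finite form of the Baire property: either the open set lies inside the
  first member, or removing that closed member leaves a nonempty open set covered by the
  others.\<close>

lemma finite_closed_cover_interior:
  assumes "finite \<F>" and "\<And>C. C \<in> \<F> \<Longrightarrow> closedin T C"
    and "openin T G" and "G \<noteq> {}" and "G \<subseteq> \<Union>\<F>"
  shows "\<exists>C\<in>\<F>. \<exists>W. openin T W \<and> W \<noteq> {} \<and> W \<subseteq> C"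
  using assms
proof (induction \<F> arbitrary: G rule: finite_induct)
  case empty
  then show ?case by simp
next
  case (insert C \<F>)
  show ?case
  proof (cases "G \<subseteq> C")
    case True
    then show ?thesis using insert.prems by blast
  next
    case False
    have "openin T (G - C)"
      using insert.prems by (intro openin_diff) auto
    moreover have "G - C \<noteq> {}" "G - C \<subseteq> \<Union>\<F>"
      using False insert.prems by auto
    ultimately show ?thesis
      using insert.IH[of "G - C"] insert.prems by blast
  qed
qed

text \<open>The class \<open>group_add\<close> writes the group additively without making it
  commutative, so the order of summands matters throughout. The class \<open>countable\<close>
  provides the enumeration behind coordinates in \<open>nat \<Rightarrow> real\<close> and behind
  countable unions of translates.\<close>

locale dynsys =
  fixes X :: "'x::metric_space set" and act :: "'g::{group_add, countable} \<Rightarrow> 'x \<Rightarrow> 'x"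
  assumes tds: "tds X act"
begin

lemma compact_X: "compact X" and X_ne: "X \<noteq> {}"
  using tds by (auto simp: tds_def)

lemma act_in [simp, intro]: "x \<in> X \<Longrightarrow> act g x \<in> X"
  using tds by (auto simp: tds_def)

lemma act_cont: "continuous_on X (act g)"
  using tds by (auto simp: tds_def)

lemma act_zero [simp]: "x \<in> X \<Longrightarrow> act 0 x = x"
  using tds by (auto simp: tds_def)

lemma act_add: "x \<in> X \<Longrightarrow> act (g + h) x = act g (act h x)"
  using tds by (auto simp: tds_def)

lemma act_minus_left [simp]: "x \<in> X \<Longrightarrow> act (- g) (act g x) = x"
  by (metis act_add act_zero left_minus)

lemma act_minus_right [simp]: "x \<in> X \<Longrightarrow> act g (act (- g) x) = x"
  by (metis act_add act_zero right_minus)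

lemma act_image_eq: "W \<subseteq> X \<Longrightarrow> act g ` W = {x \<in> X. act (- g) x \<in> W}"
  by (auto 0 3 simp: subset_iff image_iff) (metis act_minus_right)

lemma open_pre:
  assumes "oin X W"
  shows "oin X {x \<in> X. act g x \<in> W}"
proof -
  have "oin X (X \<inter> act g -` W)"
    by (rule continuous_openin_preimage[OF act_cont _ assms]) auto
  then show ?thesis by (simp add: vimage_def Int_def)
qed

lemma open_image:
  assumes "oin X W"
  shows "oin X (act g ` W)"
  using open_pre[OF assms, of "- g"] act_image_eq[of W g] openin_imp_subset[OF assms] by simp

lemma act_image_image: "W \<subseteq> X \<Longrightarrow> act g ` act h ` W = act (g + h) ` W"
  by (auto simp: act_add image_image subset_iff)

lemma closed_pre:
  assumes "closedin (top_of_set X) W"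
  shows "closedin (top_of_set X) {x \<in> X. act g x \<in> W}"
proof -
  have "closedin (top_of_set X) (X \<inter> act g -` W)"
    by (rule continuous_closedin_preimage_gen[OF act_cont _ assms]) auto
  then show ?thesis by (simp add: vimage_def Int_def)
qed

lemma closed_image:
  assumes "closedin (top_of_set X) W"
  shows "closedin (top_of_set X) (act g ` W)"
  using closed_pre[OF assms, of "- g"] act_image_eq[of W g] closedin_imp_subset[OF assms] by simp

end

lemma compact_closedin: "compact X \<Longrightarrow> closedin (top_of_set X) C \<longleftrightarrow> closed C \<and> C \<subseteq> X" for X :: "'a::metric_space set"
  by (meson closedin_closed_eq compact_imp_closed)

locale minsys = dynsys X act for X :: "'x::metric_space set"
    and act :: "'g::{group_add, countable} \<Rightarrow> 'x \<Rightarrow> 'x" +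
  assumes min: "minimal_set (top_of_set X) act X"
begin

lemma closed_inv:
  assumes "closedin (top_of_set X) C" "C \<noteq> {}" "\<And>g x. x \<in> C \<Longrightarrow> act g x \<in> C"
  shows "C = X"
  using min assms closedin_imp_subset[OF assms(1)] unfolding minimal_set_def
  by (metis image_subset_iff)

text \<open>The points whose orbit avoids \<open>W\<close> form a closed invariant set; by
  minimality it is empty or contains \<open>W\<close>, and the latter is absurd.\<close>

lemma orbit_meets:
  assumes W: "oin X W" "W \<noteq> {}" and x: "x \<in> X"
  shows "\<exists>g. act g x \<in> W"
proof (rule ccontr)
  assume neg: "\<nexists>g. act g x \<in> W"
  define C where "C = X - (\<Union>g. {x \<in> X. act g x \<in> W})"
  have "closedin (top_of_set X) C"
    unfolding C_def by (intro closedin_diff openin_Union) (auto simp: open_pre W)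
  moreover have "C \<noteq> {}" using neg x by (auto simp: C_def)
  moreover have "act g x \<in> C" if "x \<in> C" for g x
    using that by (auto simp: C_def simp flip: act_add)
  ultimately have "C = X" by (rule closed_inv)
  moreover obtain w where "w \<in> W" using W by auto
  moreover have "w \<in> X" using \<open>w \<in> W\<close> W openin_imp_subset by blast
  ultimately show False unfolding C_def
    by (metis (mono_tags, lifting) Diff_iff UN_I UNIV_I act_zero mem_Collect_eq)
qed

text \<open>Syndeticity of visits to \<open>W\<close>: by minimality the preimages of
  \<open>W\<close> under the group cover the compact space.\<close>

lemma finite_translates:
  assumes W: "oin X W" "W \<noteq> {}"
  obtains F where "finite F" "\<And>x. x \<in> X \<Longrightarrow> \<exists>k\<in>F. act k x \<in> W"
proof -
  let ?P = "\<lambda>g. {x \<in> X. act g x \<in> W}"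
  have "\<forall>c\<in>range ?P. oin X c" using open_pre[OF W(1)] by blast
  moreover have "X \<subseteq> \<Union>(range ?P)" using orbit_meets[OF W] by blast
  ultimately obtain \<D> where "\<D> \<subseteq> range ?P" "finite \<D>" "X \<subseteq> \<Union>\<D>"
    using compact_X unfolding compact_eq_openin_cover by meson
  then obtain F where F: "finite F" "\<D> = ?P ` F"
    by (meson finite_subset_image)
  then have "X \<subseteq> (\<Union>g\<in>F. ?P g)" using \<open>X \<subseteq> \<Union>\<D>\<close> by simp
  then show thesis using F(1) by (intro that[of F]) blast+
qed

text \<open>If \<open>f x < f y\<close>, lower semicontinuity keeps \<open>f\<close> above
  \<open>f x\<close> near \<open>y\<close>, yet the orbit of \<open>x\<close>, on which
  \<open>f\<close> is constant, enters that neighbourhood.\<close>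

lemma lsc_invariant_const:
  fixes f :: "'x \<Rightarrow> 'c::linorder"
  assumes inv: "\<And>g x. x \<in> X \<Longrightarrow> f (act g x) = f x"
    and lsc: "\<And>x c. x \<in> X \<Longrightarrow> c < f x \<Longrightarrow> \<exists>W. oin X W \<and> x \<in> W \<and> (\<forall>y\<in>W. c < f y)"
    and "x \<in> X" "y \<in> X"
  shows "f x = f y"
proof -
  have "\<not> f x < f y" if "x \<in> X" "y \<in> X" for x y
  proof
    assume "f x < f y"
    then obtain W where "oin X W" "y \<in> W" "\<forall>z\<in>W. f x < f z"
      using lsc \<open>y \<in> X\<close> by blast
    then show False
      using orbit_meets[of W x] inv[OF \<open>x \<in> X\<close>] \<open>x \<in> X\<close> by force
  qed
  then show ?thesis using assms(3,4) by (metis neqE)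
qed

end

lemma open_contains_cball_in:
  assumes "oin X W" "x \<in> W"
  obtains r where "r > 0" "X \<inter> cball x r \<subseteq> W"
  using assms by (metis inf.commute openin_contains_cball)

section \<open>Factor maps of minimal systems\<close>

locale factor = X: minsys X act for X :: "'x::metric_space set"
    and act :: "'g::{group_add, countable} \<Rightarrow> 'x \<Rightarrow> 'x" +
  fixes Y :: "'y::metric_space set" and actY :: "'g \<Rightarrow> 'y \<Rightarrow> 'y" and \<pi> :: "'x \<Rightarrow> 'y"
  assumes Ytds: "tds Y actY" and fac: "factor_map X act Y actY \<pi>"
begin

sublocale Y: dynsys Y actY by unfold_locales (rule Ytds)

lemma pi_cont: "continuous_on X \<pi>" and pi_image: "\<pi> ` X = Y"
  and pi_in [simp]: "x \<in> X \<Longrightarrow> \<pi> x \<in> Y"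
  and pi_act [simp]: "x \<in> X \<Longrightarrow> \<pi> (act g x) = actY g (\<pi> x)"
  using fac by (auto simp: factor_map_def)

lemma open_pi_pre:
  assumes "oin Y W"
  shows "oin X {x \<in> X. \<pi> x \<in> W}"
proof -
  have "oin X (X \<inter> \<pi> -` W)"
    by (rule continuous_openin_preimage[OF pi_cont _ assms]) auto
  then show ?thesis by (simp add: vimage_def Int_def)
qed

sublocale Y: minsys Y actY
proof
  have "A = Y" if A: "A \<subseteq> Y" "A \<noteq> {}" "closedin (top_of_set Y) A" "\<forall>g. actY g ` A \<subseteq> A" for A
  proof -
    have "closedin (top_of_set X) (X \<inter> \<pi> -` A)"
      by (rule continuous_closedin_preimage_gen[OF pi_cont _ A(3)]) auto
    moreover have "X \<inter> \<pi> -` A \<noteq> {}" using A pi_image by blast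
    ultimately have "X \<inter> \<pi> -` A = X"
      using A by (intro X.closed_inv) auto
    then show "A = Y" using pi_image A by blast
  qed
  then show "minimal_set (top_of_set Y) actY Y"
    by (auto simp: minimal_set_def Y.X_ne)
qed

text \<open>Finitely many translates of a closed ball inside \<open>W\<close> cover
  \<open>X\<close>, so finitely many translates of its compact image cover \<open>Y\<close>. One of
  these has interior, which is then moved back by the group.\<close>

lemma semi_open:
  assumes "oin X W" "W \<noteq> {}"
  obtains G where "oin Y G" "G \<noteq> {}" "G \<subseteq> \<pi> ` W"
proof -
  obtain x where x: "x \<in> W" using assms by auto
  then obtain r where r: "r > 0" "X \<inter> cball x r \<subseteq> W"
    using assms open_contains_cball_in by metis
  have "x \<in> X" using x assms openin_imp_subset by blast
  define C where "C = X \<inter> cball x r"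
  have "oin X (X \<inter> ball x r)" by (simp add: openin_open_Int)
  moreover have "X \<inter> ball x r \<noteq> {}" using \<open>x \<in> X\<close> r by auto
  ultimately obtain F where F: "finite F" "\<And>z. z \<in> X \<Longrightarrow> \<exists>k\<in>F. act k z \<in> X \<inter> ball x r"
    by (rule X.finite_translates) blast
  have "compact C" unfolding C_def
    by (meson X.compact_X compact_Int_closed closed_cball)
  then have "closedin (top_of_set Y) (\<pi> ` C)"
    using compact_continuous_image[of C \<pi>] pi_cont pi_in
    by (simp add: compact_closedin[OF Y.compact_X] C_def compact_imp_closed continuous_on_subset image_subset_iff)
  then have cl: "closedin (top_of_set Y) (actY (- k) ` \<pi> ` C)" for k
    by (rule Y.closed_image)
  have "Y \<subseteq> \<Union> ((\<lambda>k. actY (- k) ` \<pi> ` C) ` F)"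
  proof
    fix y assume "y \<in> Y"
    then obtain z where z: "z \<in> X" "\<pi> z = y" using pi_image by blast
    then obtain k where "k \<in> F" "act k z \<in> C" using F(2)[of z] by (auto simp: C_def)
    moreover from this have "y = actY (- k) (\<pi> (act k z))" using z by auto
    ultimately show "y \<in> \<Union> ((\<lambda>k. actY (- k) ` \<pi> ` C) ` F)" by blast
  qed
  then have "\<exists>D\<in>(\<lambda>k. actY (- k) ` \<pi> ` C) ` F. \<exists>W. oin Y W \<and> W \<noteq> {} \<and> W \<subseteq> D"
    using F(1) cl Y.X_ne by (intro finite_closed_cover_interior[where G = Y]) auto
  then obtain k V where V: "oin Y V" "V \<noteq> {}" "V \<subseteq> actY (- k) ` \<pi> ` C" by auto
  have "actY k ` V \<subseteq> \<pi> ` C"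
    using V(3) by (auto simp: C_def)
  then show thesis
    using that[of "actY k ` V"] Y.open_image[OF V(1)] V(2) image_mono[OF r(2), of \<pi>]
    unfolding C_def by blast
qed

end

section \<open>Invariant pseudometrics\<close>

text \<open>The metric on functions is a series of truncated coordinate distances with weights
  \<open>(1/2)^n\<close>, and these weights add up to 2.\<close>

lemma dist_fun_le:
  fixes x y :: "'i::countable \<Rightarrow> 'c::metric_space"
  assumes "\<And>i. dist (x i) (y i) \<le> c"
  shows "dist x y \<le> 2 * c"
proof -
  have "(\<Sum>n. (1/2)^n * min (dist (x (from_nat n)) (y (from_nat n))) 1) \<le> (\<Sum>n. (1/2::real)^n * c)"
  proof (rule suminf_le)
    show "summable (\<lambda>n. (1/2)^n * min (dist (x (from_nat n)) (y (from_nat n))) 1)"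
      by (rule summable_comparison_test'[of "\<lambda>n. (1/2)^n"]) (auto simp: summable_geometric_iff)
    show "summable (\<lambda>n. (1/2)^n * c)"
      by (intro summable_mult2) (simp add: summable_geometric_iff)
    show "(1/2)^n * min (dist (x (from_nat n)) (y (from_nat n))) 1 \<le> (1/2)^n * c" for n
      using assms[of "from_nat n"] by (intro mult_left_mono) auto
  qed
  also have "\<dots> = 2 * c"
    using suminf_mult2[of "\<lambda>n. (1/2::real)^n" c] by (simp add: summable_geometric_iff suminf_geometric)
  finally show ?thesis by (simp add: dist_fun_def)
qed

locale meq_factor = factor X act Y actY \<pi>
  for X :: "'x::metric_space set" and act :: "'g::{group_add, countable} \<Rightarrow> 'x \<Rightarrow> 'x"
    and Y :: "'y::metric_space set" and actY \<pi> +
  assumes meq: "max_equicontinuous_factor X act Y actY \<pi>"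
begin

text \<open>The quotient of \<open>X\<close> by \<open>d x y = 0\<close> is an equicontinuous
  factor, because the action is isometric for \<open>d\<close>. Realized inside
  \<open>nat \<Rightarrow> real\<close>, it is a factor of \<open>Y\<close> by maximality, so points
  of one fibre are identified.\<close>

lemma invariant_pseudometric_on_fibres:
  fixes d :: "'x \<Rightarrow> 'x \<Rightarrow> real"
  assumes refl: "\<And>x. x \<in> X \<Longrightarrow> d x x = 0"
    and sym: "\<And>x y. x \<in> X \<Longrightarrow> y \<in> X \<Longrightarrow> d x y = d y x"
    and tri: "\<And>x y z. x \<in> X \<Longrightarrow> y \<in> X \<Longrightarrow> z \<in> X \<Longrightarrow> d x z \<le> d x y + d y z"
    and inv: "\<And>g x y. x \<in> X \<Longrightarrow> y \<in> X \<Longrightarrow> d (act g x) (act g y) = d x y"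
    and cont: "\<And>x e. x \<in> X \<Longrightarrow> e > 0 \<Longrightarrow> \<exists>W. oin X W \<and> x \<in> W \<and> (\<forall>y\<in>W. d x y < e)"
    and z: "z \<in> X" "z' \<in> X" "\<pi> z = \<pi> z'"
  shows "d z z' = 0"
proof -
  have nonneg: "0 \<le> d x y" if "x \<in> X" "y \<in> X" for x y
    using tri[of x y x] refl[of x] sym[of x y] that by simp
  have absd: "\<bar>d x q - d y q\<bar> \<le> d x y" if "x \<in> X" "y \<in> X" "q \<in> X" for x y q
    using tri[of x y q] tri[of y x q] sym[of x y] that by auto
  obtain x0 where x0: "x0 \<in> X" using X.X_ne by auto
  define q where "q g = act g x0" for g
  have q: "q g \<in> X" for g using x0 by (simp add: q_def)
  have dense: "\<exists>g. d x (q g) < e" if x: "x \<in> X" and e: "e > 0" for x e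
  proof -
    obtain W where W: "oin X W" "x \<in> W" "\<forall>y\<in>W. d x y < e" using cont[OF x e] by blast
    then obtain g where "act g x0 \<in> W" using X.orbit_meets[OF W(1) _ x0] by blast
    then show ?thesis using W by (auto simp: q_def)
  qed
  \<comment> \<open>Kuratowski-style coordinates: the distances to the points of one dense orbit,
    enumerated through the countable group, determine a point up to \<open>d\<close>-distance
    0.\<close>
  define \<psi> where "\<psi> x n = d x (q (from_nat n))" for x and n :: nat
  have psi_g: "\<psi> x (to_nat g) = d x (q g)" for x g by (simp add: \<psi>_def)
  have psi_le: "dist (\<psi> x) (\<psi> y) \<le> 2 * d x y" if "x \<in> X" "y \<in> X" for x y
    using absd that q by (intro dist_fun_le) (auto simp: \<psi>_def dist_real_def)
  have psi_eq: "d x y = 0" if "x \<in> X" "y \<in> X" "\<psi> x = \<psi> y" for x y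
  proof (rule ccontr)
    assume "d x y \<noteq> 0"
    then have "d x y / 2 > 0" using nonneg[OF that(1,2)] by simp
    then obtain g where "d x (q g) < d x y / 2" using dense \<open>x \<in> X\<close> by blast
    moreover have "d y (q g) = d x (q g)" using that(3) psi_g by metis
    ultimately show False
      using tri[OF that(1) q[of g] that(2)] sym[OF that(2) q[of g]] by simp
  qed
  have psi_cong: "\<psi> x = \<psi> y" if "x \<in> X" "y \<in> X" "d x y = 0" for x y
    using absd[OF that(1,2) q] that(3) by (auto simp: \<psi>_def)
  have psi_cont: "continuous_on X \<psi>"
    unfolding continuous_on_topological
  proof (intro ballI allI impI)
    fix x B assume x: "x \<in> X" and B: "open B" "\<psi> x \<in> B"
    then obtain e where e: "e > 0" "ball (\<psi> x) e \<subseteq> B" by (meson openE)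
    then obtain W where W: "oin X W" "x \<in> W" "\<forall>y\<in>W. d x y < e / 2" using cont[OF x, of "e/2"] by auto
    then obtain A where A: "open A" "W = X \<inter> A" by (auto simp: openin_open)
    have "\<psi> y \<in> B" if "y \<in> X" "y \<in> A" for y
    proof -
      have "d x y < e / 2" using that A W by auto
      then have "dist (\<psi> x) (\<psi> y) < e" using psi_le[OF x \<open>y \<in> X\<close>] by simp
      then show ?thesis using e by auto
    qed
    then show "\<exists>A. open A \<and> x \<in> A \<and> (\<forall>y\<in>X. y \<in> A \<longrightarrow> \<psi> y \<in> B)" using A W by auto
  qed
  define Z where "Z = \<psi> ` X"
  have Z_cpt: "compact Z" unfolding Z_def using compact_continuous_image psi_cont X.compact_X by blast
  \<comment> \<open>\<open>r\<close> picks a representative of each class. The choice does not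
    affect \<open>actZ\<close>, since invariance of \<open>d\<close> preserves distance 0 and
    \<open>psi_cong\<close> then gives equal images.\<close>
  define r where "r = inv_into X \<psi>"
  have r: "r w \<in> X" "\<psi> (r w) = w" if "w \<in> Z" for w
    using that by (auto simp: r_def Z_def inv_into_into f_inv_into_f)
  have dr: "d (r (\<psi> x)) x = 0" if "x \<in> X" for x
    using psi_eq[of "r (\<psi> x)" x] r[of "\<psi> x"] that by (auto simp: Z_def)
  define actZ where "actZ g w = \<psi> (act g (r w))" for g w
  have actZ: "actZ g (\<psi> x) = \<psi> (act g x)" if "x \<in> X" for g x
    unfolding actZ_def using that r[of "\<psi> x"] dr[OF that] inv[of "r (\<psi> x)" x g]
    by (intro psi_cong) (auto simp: Z_def)
  have sep: "\<exists>\<delta>>0. \<forall>x\<in>X. \<forall>y\<in>X. dist (\<psi> x) (\<psi> y) < \<delta> \<longrightarrow> d x y < e" if e: "e > 0" for e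
  proof -
    \<comment> \<open>By compactness finitely many \<open>T g\<close> cover \<open>X\<close>, so
      closeness in the corresponding finitely many coordinates of \<open>\<psi>\<close> already
      bounds \<open>d\<close>.\<close>
    define T where "T g = {x \<in> X. d x (q g) < e / 3}" for g
    have T_open: "oin X (T g)" for g
    proof (subst openin_subopen, intro ballI)
      fix x assume x: "x \<in> T g"
      then obtain W where W: "oin X W" "x \<in> W" "\<forall>y\<in>W. d x y < e / 3 - d x (q g)"
        using cont[of x "e / 3 - d x (q g)"] by (auto simp: T_def)
      have "W \<subseteq> T g"
      proof
        fix y assume y: "y \<in> W"
        then have "y \<in> X" using W openin_imp_subset by blast
        then show "y \<in> T g"
          using absd[of x y "q g"] W(3)[rule_format, OF y] x q[of g] by (simp add: T_def)
      qed
      then show "\<exists>W. oin X W \<and> x \<in> W \<and> W \<subseteq> T g" using W by blast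
    qed
    have "X \<subseteq> \<Union>(range T)"
      using dense[of _ "e/3"] e by (auto simp: T_def)
    moreover have "\<forall>c\<in>range T. oin X c" using T_open by blast
    ultimately obtain \<D> where "\<D> \<subseteq> range T" "finite \<D>" "X \<subseteq> \<Union>\<D>"
      using X.compact_X unfolding compact_eq_openin_cover by meson
    then obtain F where F: "finite F" "X \<subseteq> (\<Union>g\<in>F. T g)"
      by (metis finite_subset_image)
    have "\<exists>\<delta>>0. \<forall>w\<in>Z. \<forall>w'\<in>Z. dist w w' < \<delta> \<longrightarrow> dist (w (to_nat g)) (w' (to_nat g)) < e / 3" for g :: 'g
    proof -
      have "continuous_on Z (\<lambda>w. w (to_nat g))"
        by (rule continuous_on_subset[OF continuous_on_product_coordinates subset_UNIV])
      then have "uniformly_continuous_on Z (\<lambda>w. w (to_nat g))"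
        using Z_cpt compact_uniformly_continuous by blast
      then have "\<forall>e>0. \<exists>\<delta>>0. \<forall>w\<in>Z. \<forall>w'\<in>Z. dist w' w < \<delta> \<longrightarrow> dist (w' (to_nat g)) (w (to_nat g)) < e"
        by (simp add: uniformly_continuous_on_def)
      from this[rule_format, of "e/3"] show ?thesis using e by auto
    qed
    then obtain \<delta> where \<delta>: "\<And>g::'g. \<delta> g > 0"
      "\<And>g w w'. w \<in> Z \<Longrightarrow> w' \<in> Z \<Longrightarrow> dist w w' < \<delta> g \<Longrightarrow> dist (w (to_nat g)) (w' (to_nat g)) < e / 3"
      by metis
    define D where "D = Min (insert 1 (\<delta> ` F))"
    have "D > 0" using F(1) \<delta>(1) by (auto simp: D_def)
    moreover have "d x y < e" if xy: "x \<in> X" "y \<in> X" "dist (\<psi> x) (\<psi> y) < D" for x y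
    proof -
      obtain g where g: "g \<in> F" "d x (q g) < e / 3" using F(2) xy(1) by (auto simp: T_def)
      have "D \<le> \<delta> g" using F(1) g by (auto simp: D_def)
      then have "dist (d x (q g)) (d y (q g)) < e / 3"
        using \<delta>(2)[of "\<psi> x" "\<psi> y" g] xy by (simp add: Z_def psi_g)
      then show ?thesis
        using g(2) tri[OF xy(1) q[of g] xy(2)] sym[OF xy(2) q[of g]] unfolding dist_real_def by arith
    qed
    ultimately show ?thesis by blast
  qed
  have eq: "\<exists>\<delta>>0. \<forall>w\<in>Z. \<forall>w'\<in>Z. dist w w' < \<delta> \<longrightarrow> (\<forall>g. dist (actZ g w) (actZ g w') < e)"
    if e: "e > 0" for e
  proof -
    obtain \<delta> where \<delta>: "\<delta> > 0" "\<forall>x\<in>X. \<forall>y\<in>X. dist (\<psi> x) (\<psi> y) < \<delta> \<longrightarrow> d x y < e / 2"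
      using sep[of "e/2"] e by auto
    have "dist (actZ g w) (actZ g w') < e" if w: "w \<in> Z" "w' \<in> Z" "dist w w' < \<delta>" for g w w'
    proof -
      obtain x y where xy: "x \<in> X" "y \<in> X" "w = \<psi> x" "w' = \<psi> y" using w by (auto simp: Z_def)
      then have "d (act g x) (act g y) < e / 2" using \<delta> w inv by auto
      then show ?thesis using psi_le[of "act g x" "act g y"] xy actZ by auto
    qed
    then show ?thesis using \<delta>(1) by blast
  qed
  then have "equicontinuous Z actZ" by (simp add: equicontinuous_def)
  moreover have "tds Z actZ"
    unfolding tds_def
  proof (intro conjI allI ballI)
    show "continuous_on Z (actZ g)" for g
      unfolding continuous_on_iff
    proof (intro ballI allI impI)
      fix w and e :: real assume "w \<in> Z" "e > 0"
      then show "\<exists>\<delta>>0. \<forall>w'\<in>Z. dist w' w < \<delta> \<longrightarrow> dist (actZ g w') (actZ g w) < e"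
        using eq[OF \<open>e > 0\<close>] by blast
    qed
    show "actZ g ` Z \<subseteq> Z" for g using actZ by (auto simp: Z_def)
    show "actZ 0 w = w" if "w \<in> Z" for w using that actZ by (auto simp: Z_def)
    show "actZ (g + h) w = actZ g (actZ h w)" if "w \<in> Z" for g h w
      using that actZ by (auto simp: Z_def X.act_add)
  qed (use Z_cpt X.X_ne in \<open>auto simp: Z_def\<close>)
  moreover have "factor_map X act Z actZ \<psi>"
    using psi_cont actZ by (auto simp: factor_map_def Z_def)
  ultimately obtain \<phi> where "\<forall>x\<in>X. \<psi> x = \<phi> (\<pi> x)"
    using meq unfolding max_equicontinuous_factor_def by blast
  then show ?thesis using z by (intro psi_eq) auto
qed

end

section \<open>Return times and powers of an invariant measure\<close>

definition hit :: "('g \<Rightarrow> 'x \<Rightarrow> 'x) \<Rightarrow> 'x set \<Rightarrow> 'x set \<Rightarrow> 'g set" where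
  "hit act W U = {g. \<exists>x\<in>W. act g x \<in> U}"

text \<open>These are the return times, under the diagonal action, of the product of the members of
  \<open>L\<close> inside the power of the space indexed by \<open>L\<close>.\<close>

definition ret :: "('g \<Rightarrow> 'x \<Rightarrow> 'x) \<Rightarrow> 'x set set \<Rightarrow> 'g set" where
  "ret act L = {g. \<forall>A\<in>L. g \<in> hit act A A}"

locale inv_measure = minsys X act
  for X :: "'x::metric_space set" and act :: "'g::{group_add, countable} \<Rightarrow> 'x \<Rightarrow> 'x" +
  fixes \<mu> :: "'x measure"
  assumes inv: "invariant_prob_measure X act \<mu>"
begin

sublocale prob_space \<mu> using inv by (simp add: invariant_prob_measure_def)

lemma space_mu [simp]: "space \<mu> = X" and sets_mu: "sets \<mu> = sets (restrict_space borel X)"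
  and act_meas [measurable]: "act g \<in> measurable \<mu> \<mu>"
  using inv by (auto simp: invariant_prob_measure_def)

lemma open_sets: "oin X W \<Longrightarrow> W \<in> sets \<mu>"
  by (auto simp: sets_mu sets_restrict_space openin_open)

lemma closed_sets: "closedin (top_of_set X) W \<Longrightarrow> W \<in> sets \<mu>"
  unfolding sets_mu sets_restrict_space closedin_closed by (blast intro: borel_closed)

lemma distr_act: "distr \<mu> \<mu> (act g) = \<mu>"
proof (rule measure_eqI)
  fix A assume "A \<in> sets (distr \<mu> \<mu> (act g))"
  then have "A \<in> sets \<mu>" by simp
  then show "emeasure (distr \<mu> \<mu> (act g)) A = emeasure \<mu> A"
    using inv by (simp add: emeasure_distr invariant_prob_measure_def)
qed simp

text \<open>If \<open>W\<close> were null, so would be its preimages under the group, finitely many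
  of which cover the whole space.\<close>

lemma full_support:
  assumes "oin X W" "W \<noteq> {}"
  shows "emeasure \<mu> W > 0"
proof (rule ccontr)
  assume "\<not> emeasure \<mu> W > 0"
  then have 0: "emeasure \<mu> W = 0" by simp
  obtain F where F: "finite F" "\<And>x. x \<in> X \<Longrightarrow> \<exists>k\<in>F. act k x \<in> W"
    using finite_translates[OF assms] by blast
  have pre: "act k -` W \<inter> space \<mu> \<in> sets \<mu>" "emeasure \<mu> (act k -` W \<inter> space \<mu>) = 0" for k
    using open_sets[OF assms(1)] inv 0 measurable_sets[OF act_meas]
    by (auto simp: invariant_prob_measure_def)
  have "emeasure \<mu> (space \<mu>) \<le> emeasure \<mu> (\<Union>k\<in>F. act k -` W \<inter> space \<mu>)"
    using F(2) by (intro emeasure_mono sets.finite_UN F(1) pre(1)) auto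
  also have "\<dots> \<le> (\<Sum>k\<in>F. emeasure \<mu> (act k -` W \<inter> space \<mu>))"
    using F pre by (intro emeasure_subadditive_finite) auto
  also have "\<dots> = 0" using pre by simp
  finally show False using emeasure_space_1 by simp
qed

lemma measure_open_pos: "oin X W \<Longrightarrow> W \<noteq> {} \<Longrightarrow> measure \<mu> W > 0"
  using full_support[of W] by (simp add: emeasure_eq_measure)

abbreviation P :: "'i set \<Rightarrow> ('i \<Rightarrow> 'x) measure" where "P I \<equiv> PiM I (\<lambda>_. \<mu>)"

lemma prob_P: "prob_space (P I)"
  by (intro prob_space_PiM) unfold_locales

text \<open>In applications \<open>I\<close> is often a finite family of open sets, indexing itself.\<close>

definition box :: "'i set \<Rightarrow> ('i \<Rightarrow> 'x set) \<Rightarrow> 'g \<Rightarrow> ('i \<Rightarrow> 'x) set" where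
  "box I B g = (\<Pi>\<^sub>E i\<in>I. act g ` B i)"

definition boxes :: "'i set \<Rightarrow> ('i \<Rightarrow> 'x set) \<Rightarrow> 'g set \<Rightarrow> ('i \<Rightarrow> 'x) set" where
  "boxes I B S = (\<Union>g\<in>S. box I B g)"

text \<open>With this, \<open>boxes I B (RS W z)\<close> is the slice over \<open>z\<close> of the
  union of all diagonal translates of the box with factors \<open>B i\<close> and one further factor
  \<open>W\<close>.\<close>

definition RS :: "'x set \<Rightarrow> 'x \<Rightarrow> 'g set" where
  "RS W z = {g. z \<in> act g ` W}"

context
  fixes I :: "'i set" and B :: "'i \<Rightarrow> 'x set"
  assumes I: "finite I" and B: "\<And>i. i \<in> I \<Longrightarrow> oin X (B i)"
begin

lemma box_sets [measurable]: "box I B g \<in> sets (P I)"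
  unfolding box_def by (intro sets_PiM_I_finite I) (auto intro: open_sets open_image B)

lemma boxes_sets [measurable]: "boxes I B S \<in> sets (P I)"
  unfolding boxes_def by (intro sets.countable_UN') auto

lemma compose_meas [measurable]: "compose I (act k) \<in> measurable (P I) (P I)"
  unfolding compose_def by measurable

lemma measure_preserving_compose:
  assumes "C \<in> sets (P I)"
  shows "measure (P I) (compose I (act k) -` C \<inter> space (P I)) = measure (P I) C"
proof -
  have "distr (P I) (P I) (compose I (act k)) = PiM I (\<lambda>i. distr \<mu> \<mu> (act k))"
    by (rule distr_PiM_finite_prob_space') (auto intro: I prob_space_axioms)
  then have "distr (P I) (P I) (compose I (act k)) = P I" by (simp add: distr_act)
  then show ?thesis using measure_distr[OF compose_meas assms, of k] by simp
qed

lemma compose_boxes: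
  "compose I (act k) -` boxes I B ((+) k ` S) \<inter> space (P I) = boxes I B S"
proof -
  have "compose I (act k) \<omega> \<in> box I B (k + g) \<longleftrightarrow> \<omega> \<in> box I B g" if "\<omega> \<in> space (P I)" for \<omega> g
  proof -
    have "act k x \<in> act (k + g) ` B i \<longleftrightarrow> x \<in> act g ` B i" if "i \<in> I" "x \<in> X" for i x
    proof -
      have "B i \<subseteq> X" using B[OF \<open>i \<in> I\<close>] openin_imp_subset by blast
      then have "act (k + g) ` B i = act k ` act g ` B i" by (simp add: act_image_image)
      then show ?thesis
        using \<open>B i \<subseteq> X\<close> \<open>x \<in> X\<close> by (auto simp: image_iff) (metis act_in act_minus_left subsetD)
    qed
    then show ?thesis using that
      by (auto simp: box_def space_PiM PiE_iff compose_def)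
  qed
  moreover have "box I B g \<subseteq> space (P I)" for g
    using box_sets sets.sets_into_space by blast
  ultimately show ?thesis
    unfolding boxes_def by (auto, (metis subsetD)+)
qed

text \<open>The group is countable, so \<open>S\<close> is exhausted by an increasing sequence of
  finite sets, and the measure is continuous from below.\<close>

lemma boxes_finite_approx:
  assumes "c < measure (P I) (boxes I B S)"
  obtains F where "finite F" "F \<subseteq> S" "c < measure (P I) (boxes I B F)"
proof -
  interpret PI: prob_space "P I" by (rule prob_P)
  define T where "T n = {g \<in> S. to_nat g \<le> n}" for n
  have U: "(\<Union>n. boxes I B (T n)) = boxes I B S"
    by (auto simp: boxes_def T_def)
  have "incseq (\<lambda>n. boxes I B (T n))"
    by (rule incseq_SucI) (auto simp: boxes_def T_def)
  then have "(\<lambda>n. measure (P I) (boxes I B (T n))) \<longlonglongrightarrow> measure (P I) (boxes I B S)"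
    using PI.finite_Lim_measure_incseq[of "\<lambda>n. boxes I B (T n)"] U by (simp add: image_subset_iff)
  then have "eventually (\<lambda>n. c < measure (P I) (boxes I B (T n))) sequentially"
    using assms by (rule order_tendstoD)
  then obtain n where "c < measure (P I) (boxes I B (T n))"
    by (auto simp: eventually_sequentially)
  moreover have "finite (T n)"
    by (rule inj_on_finite[where f = to_nat and B = "{..n}"]) (auto simp: T_def)
  ultimately show thesis by (intro that[of "T n"]) (auto simp: T_def)
qed

lemma RS_nbhd:
  assumes W: "oin X W" and z: "z \<in> X" and F: "finite F" "F \<subseteq> RS W z"
  obtains V where "oin X V" "z \<in> V" "\<And>y. y \<in> V \<Longrightarrow> F \<subseteq> RS W y"
proof -
  have "oin X (X \<inter> (\<Inter>g\<in>F. act g ` W))"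
  proof (cases "F = {}")
    case False
    then have "oin X (\<Inter>g\<in>F. act g ` W)"
      using F W by (intro openin_INT2) (auto intro: open_image)
    then show ?thesis by (intro openin_Int) auto
  qed auto
  then show thesis using that[of "X \<inter> (\<Inter>g\<in>F. act g ` W)"] F z by (auto simp: RS_def)
qed

lemma RS_act: 
  assumes "W \<subseteq> X" "z \<in> X"
  shows "RS W (act k z) = (+) k ` RS W z"
proof -
  have "act k z \<in> act h ` W \<longleftrightarrow> z \<in> act (- k + h) ` W" for h
  proof -
    have "act h ` W = act k ` act (- k + h) ` W"
      using assms by (simp add: act_image_image flip: add.assoc)
    then show ?thesis
      using assms by (auto simp: image_iff) (metis act_in act_minus_left subsetD)
  qed
  then show ?thesis
    by (auto simp: RS_def intro!: image_eqI[where x = "- k + _"] simp flip: add.assoc)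
qed

text \<open>As a function of \<open>z\<close> this measure is invariant, because moving
  \<open>z\<close> translates the slice diagonally, and lower semicontinuous, because finitely many
  translates carry almost all of it and stay available near \<open>z\<close>. Minimality makes such
  a function constant.\<close>

lemma boxes_RS_const:
  assumes W: "oin X W" and "z \<in> X" "z' \<in> X"
  shows "measure (P I) (boxes I B (RS W z)) = measure (P I) (boxes I B (RS W z'))"
proof (rule lsc_invariant_const[OF _ _ assms(2,3)])
  interpret PI: prob_space "P I" by (rule prob_P)
  show "measure (P I) (boxes I B (RS W (act g x))) = measure (P I) (boxes I B (RS W x))"
    if "x \<in> X" for g x
    using measure_preserving_compose[of "boxes I B (RS W (act g x))" g]
      RS_act[OF openin_imp_subset[OF W] that, of g] by (simp add: compose_boxes)
  show "\<exists>V. oin X V \<and> x \<in> V \<and> (\<forall>y\<in>V. c < measure (P I) (boxes I B (RS W y)))"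
    if x: "x \<in> X" and c: "c < measure (P I) (boxes I B (RS W x))" for x c
  proof -
    obtain F where F: "finite F" "F \<subseteq> RS W x" "c < measure (P I) (boxes I B F)"
      using boxes_finite_approx[OF c] by blast
    then obtain V where V: "oin X V" "x \<in> V" "\<And>y. y \<in> V \<Longrightarrow> F \<subseteq> RS W y"
      using RS_nbhd[OF W x] by blast
    have "measure (P I) (boxes I B F) \<le> measure (P I) (boxes I B (RS W y))" if "y \<in> V" for y
      using V(3)[OF that] by (intro PI.finite_measure_mono) (auto simp: boxes_def)
    then show ?thesis using V F(3) by (meson less_le_trans)
  qed
qed

end

end

section \<open>Poincare recurrence for boxes\<close>

context inv_measure
begin

lemma measure_act_image:
  assumes "oin X A"
  shows "measure \<mu> (act g ` A) = measure \<mu> A"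
proof -
  have "act g -` (act g ` A) \<inter> space \<mu> = A"
    using openin_imp_subset[OF assms] by (auto) (metis act_minus_left subsetD)
  then show ?thesis
    using measure_distr[OF act_meas open_sets[OF open_image[OF assms, of g]], of g]
    by (simp add: distr_act)
qed

lemma measure_box:
  assumes I: "finite I" and B: "\<And>i. i \<in> I \<Longrightarrow> oin X (B i)"
  shows "measure (P I) (box I B g) = (\<Prod>i\<in>I. measure \<mu> (B i))"
proof -
  interpret finite_product_prob_space "\<lambda>_. \<mu>" I
    by unfold_locales (rule I)
  show ?thesis
    unfolding box_def using B
    by (subst prob_times) (auto intro!: open_sets open_image prod.cong measure_act_image)
qed

text \<open>Were the return times finite, an infinite group would yield arbitrarily many elements
  whose translates of the box are pairwise disjoint. All translates have the same positive measure
  \<open>m\<close>, which is impossible in a probability space.\<close>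

lemma ret_infinite:
  assumes "infinite (UNIV :: 'g set)" and L: "finite L" "\<And>A. A \<in> L \<Longrightarrow> oin X A \<and> A \<noteq> {}"
  shows "infinite (ret act L)"
proof
  assume fin: "finite (ret act L)"
  interpret PI: prob_space "P L" by (rule prob_P)
  have LB: "\<And>A. A \<in> L \<Longrightarrow> oin X ((\<lambda>A. A) A)" using L by auto
  note ms = box_sets[where B = "\<lambda>A. A", OF L(1) LB]
  let ?b = "box L (\<lambda>A. A)"
  have sub: "A \<subseteq> X" if "A \<in> L" for A using L(2)[OF that] openin_imp_subset by blast
  note mb = measure_box[where B = "\<lambda>A. A", OF L(1) LB]
  define m where "m = (\<Prod>A\<in>L. measure \<mu> A)"
  have m: "m > 0" unfolding m_def by (intro prod_pos) (use L measure_open_pos in auto)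
  \<comment> \<open>Two translates of the box that intersect differ by a return time.\<close>
  have disj: "- g + h \<in> ret act L" if ne: "?b g \<inter> ?b h \<noteq> {}" for g h
  proof -
    obtain \<omega> where \<omega>: "\<omega> \<in> ?b g" "\<omega> \<in> ?b h" using ne by auto
    have "- g + h \<in> hit act A A" if A: "A \<in> L" for A
    proof -
      obtain x y where "x \<in> A" "y \<in> A" "\<omega> A = act g x" "\<omega> A = act h y"
        using \<omega> A unfolding box_def by (metis (no_types, lifting) PiE_iff imageE)
      moreover from this have "act (- g + h) y = x"
        using sub[OF A] by (metis act_add act_minus_left subsetD)
      ultimately show ?thesis unfolding hit_def by blast
    qed
    then show ?thesis by (auto simp: ret_def)
  qed
  have Dex: "\<exists>D. finite D \<and> card D = n \<and> (\<forall>g\<in>D. \<forall>h\<in>D. g \<noteq> h \<longrightarrow> ?b g \<inter> ?b h = {})" for n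
  proof (induction n)
    case 0
    then show ?case by (intro exI[of _ "{}"]) auto
  next
    case (Suc n)
    then obtain D where D: "finite D" "card D = n" "\<forall>g\<in>D. \<forall>h\<in>D. g \<noteq> h \<longrightarrow> ?b g \<inter> ?b h = {}"
      by blast
    have "finite (D \<union> (\<Union>g\<in>D. (+) g ` ret act L))" using D(1) fin by auto
    from ex_new_if_finite[OF assms(1) this]
    obtain h where h: "h \<notin> D \<union> (\<Union>g\<in>D. (+) g ` ret act L)" by (rule exE)
    have "?b g \<inter> ?b h = {}" if "g \<in> D" for g
    proof (rule ccontr)
      assume "?b g \<inter> ?b h \<noteq> {}"
      then have "- g + h \<in> ret act L" by (rule disj)
      then have "g + (- g + h) \<in> (+) g ` ret act L" by blast
      then show False using h that by (auto simp flip: add.assoc)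
    qed
    then show ?case using D h by (intro exI[of _ "insert h D"]) (auto simp: Int_commute)
  qed
  obtain n :: nat where n: "1 / m < real n" using reals_Archimedean2 by blast
  from Dex[of n] obtain D where D: "finite D" "card D = n" "\<forall>g\<in>D. \<forall>h\<in>D. g \<noteq> h \<longrightarrow> ?b g \<inter> ?b h = {}"
    by (elim exE conjE)
  have "real n * m = (\<Sum>g\<in>D. measure (P L) (?b g))" using D(2) mb by (simp add: m_def)
  also have "\<dots> = measure (P L) (\<Union>g\<in>D. ?b g)"
    using D ms by (intro PI.finite_measure_finite_Union[symmetric]) (auto simp: disjoint_family_on_def)
  also have "\<dots> \<le> 1" by simp
  finally show False using n m by (simp add: field_simps)
qed

end

section \<open>Hitting along fibres from an invariant measure\<close>

context meq_factor
begin

text \<open>The slices over \<open>z\<close> and \<open>z'\<close> agree up to a null set, by the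
  pseudometric \<open>d\<close> below. The untranslated box has positive measure and lies in the
  slice over \<open>z\<close>, so one of its points lies in the slice over \<open>z'\<close>; the
  element \<open>g\<close> witnessing this carries \<open>W\<close> to \<open>U\<close> and returns
  every member of \<open>L\<close>.\<close>

lemma hit_ret_measure:
  assumes inv: "invariant_prob_measure X act \<mu>"
    and W: "oin X W" "z \<in> W" and U: "z' \<in> U" "z' \<in> X" "\<pi> z = \<pi> z'"
    and L: "finite L" "\<And>A. A \<in> L \<Longrightarrow> oin X A \<and> A \<noteq> {}"
  shows "hit act W U \<inter> ret act L \<noteq> {}"
proof -
  interpret M: inv_measure X act \<mu> by unfold_locales (rule inv)
  interpret PI: prob_space "M.P L" by (rule M.prob_P)
  have LB: "\<And>A. A \<in> L \<Longrightarrow> oin X ((\<lambda>A. A) A)" using L by auto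
  note ms [measurable] = M.boxes_sets[where B = "\<lambda>A. A", OF L(1) LB]
  have sub: "A \<subseteq> X" if "A \<in> L" for A using L(2)[OF that] openin_imp_subset by blast
  have WX: "W \<subseteq> X" using W openin_imp_subset by blast
  then have z: "z \<in> X" using W by auto
  let ?b = "M.boxes L (\<lambda>A. A)"
  let ?O = "\<lambda>z. ?b (M.RS W z)"
  let ?m = "measure (M.P L)"
  \<comment> \<open>By \<open>const\<close> the two slices have equal measure, so this one-sided
    difference is symmetric: it is half the measure of the symmetric difference.\<close>
  define d where "d x y = ?m (?O x - ?O y)" for x y
  have const: "?m (?O x) = ?m (?O y)" if "x \<in> X" "y \<in> X" for x y
    using M.boxes_RS_const[where B = "\<lambda>A. A", OF L(1) LB W(1) that] by simp
  have d0: "d z z' = 0"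
  proof (rule invariant_pseudometric_on_fibres[where d = d])
    show "d x x = 0" for x by (simp add: d_def)
    show "d x y = d y x" if "x \<in> X" "y \<in> X" for x y
      unfolding d_def using const[OF that] by (simp add: PI.finite_measure_Diff' Int_commute)
    show "d x w \<le> d x y + d y w" for x y w
    proof -
      have "?m (?O x - ?O w) \<le> ?m ((?O x - ?O y) \<union> (?O y - ?O w))"
        by (intro PI.finite_measure_mono) auto
      also have "\<dots> \<le> ?m (?O x - ?O y) + ?m (?O y - ?O w)"
        by (intro measure_subadditive) auto
      finally show ?thesis by (simp add: d_def)
    qed
    show "d (act g x) (act g y) = d x y" if "x \<in> X" "y \<in> X" for g x y
      using M.measure_preserving_compose[where B = "\<lambda>A. A" and C = "?O (act g x) - ?O (act g y)" and k = g, OF L(1) LB]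
        M.compose_boxes[where B = "\<lambda>A. A" and k = g, OF L(1) LB] M.RS_act[where B = "\<lambda>A. A", OF L(1) LB WX] that
      by (simp add: d_def vimage_Diff Diff_Int_distrib2)
    show "\<exists>V. oin X V \<and> x \<in> V \<and> (\<forall>y\<in>V. d x y < e)" if x: "x \<in> X" and e: "e > 0" for x e
    proof -
      obtain F where F: "finite F" "F \<subseteq> M.RS W x" "?m (?O x) - e < ?m (?b F)"
        using M.boxes_finite_approx[where B = "\<lambda>A. A" and c = "?m (?O x) - e" and S = "M.RS W x", OF L(1) LB] e by auto
      then obtain V where V: "oin X V" "x \<in> V" "\<And>y. y \<in> V \<Longrightarrow> F \<subseteq> M.RS W y"
        using M.RS_nbhd[where B = "\<lambda>A. A", OF L(1) LB W(1) x] by blast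
      have "d x y < e" if "y \<in> V" for y
      proof -
        have "?m (?O x - ?O y) \<le> ?m (?O x - ?b F)"
        proof (intro PI.finite_measure_mono Diff_mono)
          show "?b F \<subseteq> ?O y" using V(3)[OF that] by (auto simp: M.boxes_def)
        qed auto
        also have "\<dots> = ?m (?O x) - ?m (?b F)"
        proof (intro PI.finite_measure_Diff)
          show "?b F \<subseteq> ?O x" using F(2) by (auto simp: M.boxes_def)
        qed auto
        finally show ?thesis using F(3) by (simp add: d_def)
      qed
      then show ?thesis using V by blast
    qed
  qed (use z U in auto)
  have "?m (M.box L (\<lambda>A. A) 0) = (\<Prod>A\<in>L. measure \<mu> A)"
    by (rule M.measure_box[where B = "\<lambda>A. A", OF L(1) LB])
  also have "\<dots> > 0" by (intro prod_pos) (use L M.measure_open_pos in auto)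
  finally have pos: "?m (M.box L (\<lambda>A. A) 0) > 0" .
  have "0 \<in> M.RS W z" using W z WX by (force simp: M.RS_def image_iff)
  then have "M.box L (\<lambda>A. A) 0 \<subseteq> ?O z" by (auto simp: M.boxes_def)
  moreover have "\<not> M.box L (\<lambda>A. A) 0 \<subseteq> ?O z - ?O z'"
  proof
    assume "M.box L (\<lambda>A. A) 0 \<subseteq> ?O z - ?O z'"
    then have "?m (M.box L (\<lambda>A. A) 0) \<le> d z z'"
      unfolding d_def by (intro PI.finite_measure_mono) auto
    then show False using pos d0 by simp
  qed
  ultimately obtain \<omega> g where \<omega>: "\<omega> \<in> M.box L (\<lambda>A. A) 0" "g \<in> M.RS W z'" "\<omega> \<in> M.box L (\<lambda>A. A) g"
    by (auto simp: M.boxes_def)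
  have "g \<in> hit act W U" using \<omega>(2) U by (auto simp: M.RS_def hit_def)
  moreover have "g \<in> hit act A A" if A: "A \<in> L" for A
  proof -
    obtain x y where "x \<in> A" "y \<in> A" "\<omega> A = act 0 x" "\<omega> A = act g y"
      using \<omega> A unfolding M.box_def by (metis (no_types, lifting) PiE_iff imageE)
    moreover from this have "act g y = x" using sub[OF A] by (metis X.act_zero subsetD)
    ultimately show ?thesis unfolding hit_def by blast
  qed
  ultimately show ?thesis by (auto simp: ret_def)
qed

end

section \<open>Translating finite trees into a set of positive measure\<close>

text \<open>Closeness along whole orbits, hence preserved by the action on points of the space;
  equicontinuity makes it hold on a neighbourhood of each point.\<close>

definition near :: "('g \<Rightarrow> 'y::metric_space \<Rightarrow> 'y) \<Rightarrow> real \<Rightarrow> 'y \<Rightarrow> 'y \<Rightarrow> bool" where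
  "near act \<delta> y y' \<longleftrightarrow> (\<forall>g. dist (act g y) (act g y') < \<delta>)"

context dynsys
begin

lemma near_act: "near act \<delta> x y \<Longrightarrow> x \<in> X \<Longrightarrow> y \<in> X \<Longrightarrow> near act \<delta> (act g x) (act g y)"
  by (simp add: near_def flip: act_add)

lemma near_dist: "near act \<delta> x y \<Longrightarrow> x \<in> X \<Longrightarrow> y \<in> X \<Longrightarrow> dist x y < \<delta>"
  by (metis act_zero near_def)

lemma near_sym: "near act \<delta> x y \<Longrightarrow> near act \<delta> y x"
  by (simp add: near_def dist_commute)

lemma near_trans: "near act \<delta> x y \<Longrightarrow> near act \<epsilon> y z \<Longrightarrow> near act (\<delta> + \<epsilon>) x z"
  unfolding near_def
proof
  fix g assume "\<forall>g. dist (act g x) (act g y) < \<delta>" "\<forall>g. dist (act g y) (act g z) < \<epsilon>"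
  then show "dist (act g x) (act g z) < \<delta> + \<epsilon>"
    using dist_triangle_less_add[of "act g x" "act g y" \<delta> "act g z" \<epsilon>] by (simp add: dist_commute)
qed

lemma near_mono: "near act \<delta> x y \<Longrightarrow> \<delta> \<le> \<epsilon> \<Longrightarrow> near act \<epsilon> x y"
  unfolding near_def using less_le_trans by blast

lemma near_nbhd:
  assumes "equicontinuous X act" "x \<in> X" "\<delta> > 0"
  obtains V where "oin X V" "x \<in> V" "\<And>y. y \<in> V \<Longrightarrow> near act \<delta> y x"
proof -
  obtain r where r: "r > 0" "\<forall>y\<in>X. \<forall>y'\<in>X. dist y y' < r \<longrightarrow> (\<forall>g. dist (act g y) (act g y') < \<delta>)"
    using assms unfolding equicontinuous_def by blast
  have "oin X (X \<inter> ball x r)" by (simp add: openin_open_Int)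
  then show thesis
    using that[of "X \<inter> ball x r"] r assms by (auto simp: near_def dist_commute)
qed

end

section \<open>Tubes around diagonal orbits\<close>

context inv_measure
begin

lemma infdist_le_sets: "{y \<in> X. infdist y A \<le> r} \<in> sets \<mu>"
proof -
  have "{y \<in> X. infdist y A \<le> r} = X \<inter> {y. infdist y A \<le> r}" by auto
  moreover have "closed {y. infdist y A \<le> r}"
    by (intro closed_Collect_le continuous_intros)
  ultimately have "closedin (top_of_set X) {y \<in> X. infdist y A \<le> r}"
    unfolding closedin_closed by blast
  then show ?thesis by (rule closed_sets)
qed

text \<open>A closed set is the decreasing intersection of its closed metric neighbourhoods, and a
  finite measure is continuous from above.\<close>

lemma closed_nbhd_measure:
  assumes A: "closed A" "A \<subseteq> X" "A \<noteq> {}" and c: "c > 0"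
  obtains \<delta> where "\<delta> > 0" "measure \<mu> {y \<in> X. infdist y A \<le> \<delta>} < measure \<mu> A + c"
proof -
  define T where "T n = {y \<in> X. infdist y A \<le> 1 / real (Suc n)}" for n
  have T: "T n \<in> sets \<mu>" for n
    unfolding T_def by (rule infdist_le_sets)
  have "decseq T"
    by (rule decseq_SucI) (auto simp: T_def elim!: order_trans intro!: divide_left_mono)
  moreover have "(\<Inter>n. T n) = A"
  proof
    show "A \<subseteq> (\<Inter>n. T n)" using A by (auto simp: T_def)
    show "(\<Inter>n. T n) \<subseteq> A"
    proof
      fix y assume y: "y \<in> (\<Inter>n. T n)"
      have "infdist y A \<le> 0"
      proof (rule field_le_epsilon)
        fix e :: real assume "e > 0"
        then obtain n where "1 / real (Suc n) < e" using nat_approx_posE by blast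
        then show "infdist y A \<le> 0 + e" using y by (auto simp: T_def dest!: spec[of _ n])
      qed
      then have "infdist y A = 0" using infdist_nonneg[of y A] by simp
      then show "y \<in> A" using A in_closed_iff_infdist_zero by blast
    qed
  qed
  ultimately have "(\<lambda>n. measure \<mu> (T n)) \<longlonglongrightarrow> measure \<mu> A"
    using finite_Lim_measure_decseq[of T] T by auto
  then have "eventually (\<lambda>n. measure \<mu> (T n) < measure \<mu> A + c) sequentially"
    using c by (intro order_tendstoD) auto
  then obtain n where "measure \<mu> (T n) < measure \<mu> A + c"
    by (auto simp: eventually_sequentially)
  then show thesis using that[of "1 / real (Suc n)"] by (simp add: T_def)
qed

text \<open>Conditioning the product measure on a tube around a diagonal orbit yields a measure with
  marginals \<open>\<mu>\<close>: the slices of the tube have constant measure.\<close>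

lemma boxes_marginal:
  assumes I: "finite I" and B: "\<And>i. i \<in> I \<Longrightarrow> oin X (B i)" and i: "i \<in> I" and C: "C \<in> sets \<mu>"
  shows "measure (P I) {\<omega> \<in> boxes I B UNIV. \<omega> i \<in> C} = measure (P I) (boxes I B UNIV) * measure \<mu> C"
proof -
  define J where "J = I - {i}"
  have IJ: "I = insert i J" "finite J" "i \<notin> J" using I i by (auto simp: J_def)
  have BJ: "\<And>j. j \<in> J \<Longrightarrow> oin X (B j)" using B by (auto simp: J_def)
  interpret product_sigma_finite "\<lambda>_::'i. \<mu>" by unfold_locales
  interpret PI: prob_space "P I" by (rule prob_P)
  interpret PJ: prob_space "P J" by (rule prob_P)
  note [measurable] = boxes_sets[where B = B, OF I B] boxes_sets[where B = B, OF IJ(2) BJ]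
  obtain x0 where x0: "x0 \<in> X" using X_ne by auto
  define c where "c = emeasure (P J) (boxes J B (RS (B i) x0))"
  \<comment> \<open>Fixing coordinate \<open>i\<close> at \<open>y\<close> leaves the boxes over
    \<open>J\<close> at the times in \<open>RS (B i) y\<close>. By \<open>boxes_RS_const\<close>
    their measure does not depend on \<open>y\<close>, so integrating over \<open>y\<close> last
    makes the condition on coordinate \<open>i\<close> split off as a factor.\<close>
  have slice: "x(i := y) \<in> boxes I B UNIV \<longleftrightarrow> x \<in> boxes J B (RS (B i) y)" if "x \<in> space (P J)" for x y
    using that IJ by (auto simp: boxes_def box_def RS_def space_PiM PiE_iff extensional_def) 
  have main: "emeasure (P I) {\<omega> \<in> boxes I B UNIV. \<omega> i \<in> C} = c * emeasure \<mu> C"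
    if C[measurable]: "C \<in> sets \<mu>" for C
  proof -
    have eq: "{\<omega> \<in> boxes I B UNIV. \<omega> i \<in> C} = boxes I B UNIV \<inter> ((\<lambda>\<omega>. \<omega> i) -` C \<inter> space (P I))"
      using sets.sets_into_space[OF boxes_sets[where B = B and S = UNIV, OF I B]] by auto
    have mC: "(\<lambda>\<omega>. \<omega> i) -` C \<inter> space (P I) \<in> sets (P I)"
      using i C by (intro measurable_sets[OF measurable_component_singleton]) auto
    have ms: "{\<omega> \<in> boxes I B UNIV. \<omega> i \<in> C} \<in> sets (P I)"
      unfolding eq using boxes_sets[where B = B, OF I B] mC by auto
    have "emeasure (P I) {\<omega> \<in> boxes I B UNIV. \<omega> i \<in> C}
      = (\<integral>\<^sup>+ \<omega>. indicator {\<omega> \<in> boxes I B UNIV. \<omega> i \<in> C} \<omega> \<partial>P (insert i J))"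
      using ms IJ by simp
    also have "\<dots> = (\<integral>\<^sup>+ y. (\<integral>\<^sup>+ x. indicator {\<omega> \<in> boxes I B UNIV. \<omega> i \<in> C} (x(i := y)) \<partial>P J) \<partial>\<mu>)"
      using ms IJ by (intro product_nn_integral_insert_rev) auto
    also have "\<dots> = (\<integral>\<^sup>+ y. c * indicator C y \<partial>\<mu>)"
    proof (rule nn_integral_cong)
      fix y assume y: "y \<in> space \<mu>"
      have "(\<integral>\<^sup>+ x. indicator {\<omega> \<in> boxes I B UNIV. \<omega> i \<in> C} (x(i := y)) \<partial>P J)
        = (\<integral>\<^sup>+ x. indicator C y * indicator (boxes J B (RS (B i) y)) x \<partial>P J)"
        using slice by (intro nn_integral_cong) (auto simp: indicator_def)
      also have "\<dots> = indicator C y * emeasure (P J) (boxes J B (RS (B i) y))"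
        by (simp add: nn_integral_cmult)
      also have "emeasure (P J) (boxes J B (RS (B i) y)) = c"
        using boxes_RS_const[where B = B, OF IJ(2) BJ B[OF i], of y x0] x0 y
        by (simp add: c_def PJ.emeasure_eq_measure)
      finally show "(\<integral>\<^sup>+ x. indicator {\<omega> \<in> boxes I B UNIV. \<omega> i \<in> C} (x(i := y)) \<partial>P J) = c * indicator C y"
        by (simp only: mult.commute)
    qed
    also have "\<dots> = c * emeasure \<mu> C" by (simp add: nn_integral_cmult)
    finally show ?thesis .
  qed
  have "\<omega> i \<in> space \<mu>" if "\<omega> \<in> boxes I B UNIV" for \<omega>
    using sets.sets_into_space[OF boxes_sets[where B = B and S = UNIV, OF I B]] that i
    by (auto simp: space_PiM PiE_iff)
  then have "{\<omega> \<in> boxes I B UNIV. \<omega> i \<in> space \<mu>} = boxes I B UNIV" by blast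
  then have "emeasure (P I) (boxes I B UNIV) = c"
    using main[OF sets.top] emeasure_space_1 by simp
  then have "emeasure (P I) {\<omega> \<in> boxes I B UNIV. \<omega> i \<in> C} = emeasure (P I) (boxes I B UNIV) * emeasure \<mu> C"
    using main[OF C] by simp
  then show ?thesis
    by (simp add: PI.emeasure_eq_measure emeasure_eq_measure ennreal_mult[symmetric])
qed

text \<open>Points of the tube \<open>\<Omega>\<close> are close to translates of the tree
  \<open>t\<close>, and conditioned on \<open>\<Omega>\<close> each coordinate has law
  \<open>\<mu>\<close>. If no point of \<open>\<Omega>\<close> had all its coordinates in
  \<open>A\<close>, each would have a first coordinate outside. At index 0 this happens with
  probability \<open>1 - a\<close>; at \<open>i > 0\<close> the parent coordinate is still in
  \<open>A\<close>, so coordinate \<open>i\<close> lies in a thin shell around \<open>A\<close> of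
  measure below \<open>a / 2 ^ (i + 1)\<close>. These probabilities add up to less than 1.\<close>

lemma approximate_translate_into:
  assumes eq: "equicontinuous X act"
    and A: "closed A" "A \<subseteq> X" "measure \<mu> A > 0"
    and t: "\<And>i. i < N \<Longrightarrow> t i \<in> X"
    and \<delta>: "\<And>i. i < N \<Longrightarrow> \<delta> i > 0"
      "\<And>i. i < N \<Longrightarrow> measure \<mu> {y \<in> X. infdist y A \<le> 2 * \<delta> i} < measure \<mu> A + measure \<mu> A / 2 ^ (i + 1)"
    and p: "\<And>i. 0 < i \<Longrightarrow> i < N \<Longrightarrow> p i < i \<and> near act (\<delta> i) (t i) (t (p i))"
    and \<epsilon>: "\<epsilon> > 0"
  shows "\<exists>g s. \<forall>i<N. s i \<in> A \<and> near act \<epsilon> (s i) (act g (t i))"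
proof (cases "N = 0")
  case True
  then show ?thesis by simp
next
  case False
  have Ane: "A \<noteq> {}" using A(3) by auto
  have As: "A \<in> sets \<mu>"
    using A compact_closedin[OF compact_X] by (intro closed_sets) auto
  define I where "I = {..<N}"
  have I: "finite I" by (simp add: I_def)
  \<comment> \<open>At most half of each \<open>\<delta> i\<close>: passing from the tree to the
    tube costs \<open>\<epsilon>'\<close> at both ends of an edge, so edge \<open>i\<close> keeps
    length below \<open>2 * \<delta> i\<close>.\<close>
  define \<epsilon>' where "\<epsilon>' = Min (insert \<epsilon> ((\<lambda>i. \<delta> i / 2) ` I))"
  have e': "\<epsilon>' > 0" "\<epsilon>' \<le> \<epsilon>"
    using \<epsilon> \<delta>(1) I by (auto simp: \<epsilon>'_def I_def)
  have e'': "\<epsilon>' \<le> \<delta> i / 2" if "i < N" for i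
    unfolding \<epsilon>'_def using I that by (intro Min_le) (auto simp: I_def)
  have "\<exists>V. i < N \<longrightarrow> oin X V \<and> t i \<in> V \<and> (\<forall>y\<in>V. near act \<epsilon>' y (t i))" for i
    using near_nbhd[OF eq t e'(1), of i] by metis
  then obtain B where B: "\<And>i. i < N \<Longrightarrow> oin X (B i) \<and> t i \<in> B i \<and> (\<forall>y\<in>B i. near act \<epsilon>' y (t i))"
    by metis
  have oB: "oin X (B i)" if "i \<in> I" for i using B that by (auto simp: I_def)
  have BX: "B i \<subseteq> X" if "i < N" for i using B[OF that] openin_imp_subset by blast
  interpret PI: prob_space "P I" by (rule prob_P)
  define \<Omega> where "\<Omega> = boxes I B UNIV"
  define m where "m = measure (P I) \<Omega>"
  define a where "a = measure \<mu> A"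
  have Os: "\<Omega> \<in> sets (P I)" unfolding \<Omega>_def using oB by (intro boxes_sets I)
  have marg: "measure (P I) {\<omega> \<in> \<Omega>. \<omega> i \<in> C} = m * measure \<mu> C" if "i < N" "C \<in> sets \<mu>" for i C
    unfolding \<Omega>_def m_def using boxes_marginal[where B = B, OF I oB] that by (simp add: I_def)
  have margs: "{\<omega> \<in> \<Omega>. \<omega> i \<in> C} \<in> sets (P I)" if "i < N" "C \<in> sets \<mu>" for i C
  proof -
    have "(\<lambda>\<omega>. \<omega> i) -` C \<inter> space (P I) \<in> sets (P I)"
      using that by (intro measurable_sets[OF measurable_component_singleton]) (auto simp: I_def)
    moreover have "{\<omega> \<in> \<Omega>. \<omega> i \<in> C} = \<Omega> \<inter> ((\<lambda>\<omega>. \<omega> i) -` C \<inter> space (P I))"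
      using sets.sets_into_space[OF Os] by auto
    ultimately show ?thesis using Os by auto
  qed
  have "measure \<mu> (B i) > 0" if "i \<in> I" for i
    using measure_open_pos[OF oB[OF that]] B[of i] that by (auto simp: I_def)
  then have "0 < measure (P I) (box I B 0)"
    using measure_box[where B = B, OF I oB] by (simp add: prod_pos)
  also have "\<dots> \<le> m"
    unfolding m_def using Os by (intro PI.finite_measure_mono) (auto simp: \<Omega>_def boxes_def)
  finally have m: "m > 0" .
  have O: "\<exists>g. \<forall>i<N. \<omega> i \<in> X \<and> near act \<epsilon>' (\<omega> i) (act g (t i))" if w: "\<omega> \<in> \<Omega>" for \<omega>
  proof -
    obtain g where g: "\<omega> \<in> box I B g" using w by (auto simp: \<Omega>_def boxes_def)
    have "\<omega> i \<in> X \<and> near act \<epsilon>' (\<omega> i) (act g (t i))" if "i < N" for i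
    proof -
      have "\<omega> i \<in> act g ` B i" using g that by (auto simp: box_def PiE_iff I_def)
      then obtain b where "b \<in> B i" "\<omega> i = act g b" by blast
      then show ?thesis using B[OF that] BX[OF that] t[OF that] near_act[of \<epsilon>' b "t i" g] by auto
    qed
    then show ?thesis by blast
  qed
  show ?thesis
  proof (rule ccontr)
    assume neg: "\<not> ?thesis"
    have bad: "\<exists>i<N. \<omega> i \<notin> A" if w: "\<omega> \<in> \<Omega>" for \<omega>
    proof (rule ccontr)
      assume "\<not> (\<exists>i<N. \<omega> i \<notin> A)"
      moreover obtain g where "\<forall>i<N. \<omega> i \<in> X \<and> near act \<epsilon>' (\<omega> i) (act g (t i))"
        using O[OF w] by blast
      ultimately have "\<forall>i<N. \<omega> i \<in> A \<and> near act \<epsilon> (\<omega> i) (act g (t i))"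
        using near_mono[OF _ \<open>\<epsilon>' \<le> \<epsilon>\<close>] by blast
      then show False using neg by blast
    qed
    define T where "T i = {y \<in> X. infdist y A \<le> 2 * \<delta> i}" for i
    have Ts: "T i \<in> sets \<mu>" for i
      unfolding T_def by (rule infdist_le_sets)
    \<comment> \<open>\<open>D i\<close> is where coordinate \<open>i\<close> must lie if it is the
      first one outside \<open>A\<close>.\<close>
    define D where "D i = (if i = 0 then X - A else T i - A)" for i :: nat
    have Ds: "D i \<in> sets \<mu>" for i
      using As Ts sets.top[of \<mu>] by (auto simp: D_def)
    have "\<Omega> \<subseteq> (\<Union>i<N. {\<omega> \<in> \<Omega>. \<omega> i \<in> D i})"
    proof
      fix \<omega> assume w: "\<omega> \<in> \<Omega>"
      define i where "i = (LEAST i. i < N \<and> \<omega> i \<notin> A)"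
      have i: "i < N" "\<omega> i \<notin> A" using LeastI_ex[OF bad[OF w]] by (auto simp: i_def)
      have least: "\<omega> j \<in> A" if "j < i" for j
        using not_less_Least[of j "\<lambda>i. i < N \<and> \<omega> i \<notin> A"] that i by (auto simp: i_def)
      obtain g where g: "\<And>j. j < N \<Longrightarrow> \<omega> j \<in> X \<and> near act \<epsilon>' (\<omega> j) (act g (t j))" using O[OF w] by blast
      have "\<omega> i \<in> D i"
      proof (cases "i = 0")
        case True
        then show ?thesis using i g by (auto simp: D_def)
      next
        case False
        then have pi: "p i < i" "near act (\<delta> i) (t i) (t (p i))" using p[of i] i by auto
        then have pN: "p i < N" using i by simp
        have "near act (\<epsilon>' + \<delta> i + \<epsilon>') (\<omega> i) (\<omega> (p i))"
          using g[OF i(1)] g[OF pN] near_act[OF pi(2) t[OF i(1)] t[OF pN]] near_trans near_sym by metis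
        then have "dist (\<omega> i) (\<omega> (p i)) < \<epsilon>' + \<delta> i + \<epsilon>'"
          using g i pN by (intro near_dist) auto
        moreover have "infdist (\<omega> i) A \<le> dist (\<omega> i) (\<omega> (p i))"
          using least[OF pi(1)] by (rule infdist_le)
        ultimately show ?thesis using e''[OF i(1)] i g False by (auto simp: D_def T_def)
      qed
      then show "\<omega> \<in> (\<Union>i<N. {\<omega> \<in> \<Omega>. \<omega> i \<in> D i})" using i w by auto
    qed
    then have "m \<le> measure (P I) (\<Union>i<N. {\<omega> \<in> \<Omega>. \<omega> i \<in> D i})"
      unfolding m_def using margs Ds by (intro PI.finite_measure_mono sets.finite_UN) auto
    also have "\<dots> \<le> (\<Sum>i<N. measure (P I) {\<omega> \<in> \<Omega>. \<omega> i \<in> D i})"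
      using margs Ds by (intro PI.finite_measure_subadditive_finite) auto
    also have "\<dots> = (\<Sum>i<N. m * measure \<mu> (D i))"
      using marg Ds by (intro sum.cong) auto
    \<comment> \<open>The bound \<open>1 - a\<close> at index 0 is written as
      \<open>1 - a - a / 2\<close> plus \<open>a / 2\<close>, so that the geometric term occurs
      uniformly for all \<open>i\<close>.\<close>
    also have "\<dots> \<le> (\<Sum>i<N. m * ((if i = 0 then 1 - a - a / 2 else 0) + a / 2 ^ (i + 1)))"
    proof (intro sum_mono mult_left_mono)
      fix i assume i: "i \<in> {..<N}"
      show "measure \<mu> (D i) \<le> (if i = 0 then 1 - a - a / 2 else 0) + a / 2 ^ (i + 1)"
      proof (cases "i = 0")
        case True
        then show ?thesis using prob_compl[OF As] by (simp add: D_def a_def)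
      next
        case False
        have "A \<subseteq> T i" using A(2) \<delta>(1)[of i] i by (auto simp: T_def)
        then have "measure \<mu> (T i - A) = measure \<mu> (T i) - a"
          using finite_measure_Diff[OF Ts As] by (simp add: a_def)
        then show ?thesis using \<delta>(2)[of i] i False by (simp add: D_def T_def a_def)
      qed
    qed (use m in auto)
    also have "\<dots> = m * ((1 - a - a / 2) + a * (\<Sum>i<N. (1 / 2) ^ (i + 1)))"
    proof -
      have "(\<Sum>i<N. if i = 0 then 1 - a - a / 2 else 0) = 1 - a - a / 2"
        using False by (simp add: sum.delta)
      moreover have "(\<Sum>i<N. a / 2 ^ (i + 1)) = a * (\<Sum>i<N. (1 / 2) ^ (i + 1))"
        by (simp add: sum_distrib_left power_divide)
      ultimately show ?thesis
        by (simp only: sum_distrib_left[symmetric] sum.distrib)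
    qed
    also have "(\<Sum>i<N. (1 / 2 :: real) ^ (i + 1)) = 1 - (1/2) ^ N"
      by (induction N) (auto simp: field_simps)
    also have "m * ((1 - a - a / 2) + a * (1 - (1/2) ^ N)) < m * 1"
    proof (rule mult_strict_left_mono[OF _ m])
      have "a > 0" using A by (simp add: a_def)
      moreover from this have "a * (1/2) ^ N > 0" by simp
      ultimately have "a / 2 + a * (1/2) ^ N > 0" by linarith
      then show "(1 - a - a / 2) + a * (1 - (1/2) ^ N) < 1" by (simp add: algebra_simps)
    qed
    finally show False by simp
  qed
qed

end

section \<open>The enveloping semigroup\<close>

text \<open>The index type is arbitrary, so no metric on the function space is available here; the
  product topology is still Hausdorff.\<close>

lemma compact_imp_closed_fun:
  fixes C :: "('i \<Rightarrow> 'c::metric_space) set"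
  assumes "compact C"
  shows "closed C"
proof -
  have "Hausdorff_space (product_topology (\<lambda>i::'i. euclidean :: 'c topology) UNIV)"
    by (simp add: Hausdorff_space_product_topology Hausdorff_space_euclidean)
  then have "Hausdorff_space (euclidean :: ('i \<Rightarrow> 'c) topology)"
    by (simp add: euclidean_product_topology)
  then show ?thesis
    using assms compactin_imp_closedin[of euclidean C] by simp
qed

text \<open>Zorn together with the finite intersection property. Leaving \<open>R\<close> abstract
  lets one statement yield both minimal left ideals and minimal closed subsemigroups.\<close>

lemma compact_minimal_closed_subset:
  assumes "compact E" "closed E" "E \<noteq> {}" "R E"
    and inter: "\<And>\<C>. \<C> \<noteq> {} \<Longrightarrow> (\<And>C. C \<in> \<C> \<Longrightarrow> R C) \<Longrightarrow> R (\<Inter>\<C>)"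
  shows "\<exists>M\<subseteq>E. closed M \<and> M \<noteq> {} \<and> R M \<and>
    (\<forall>N\<subseteq>M. closed N \<longrightarrow> N \<noteq> {} \<longrightarrow> R N \<longrightarrow> N = M)"
proof -
  define \<G> where "\<G> = {M. M \<subseteq> E \<and> closed M \<and> M \<noteq> {} \<and> R M}"
  \<comment> \<open>Complements turn minimal sets into maximal ones, and unions of chains into
    intersections.\<close>
  define \<A> where "\<A> = (\<lambda>M. E - M) ` \<G>"
  have "\<exists>U\<in>\<A>. \<forall>V\<in>\<A>. U \<subseteq> V \<longrightarrow> V = U"
  proof (rule subset_Zorn_nonempty)
    show "\<A> \<noteq> {}" using assms by (auto simp: \<A>_def \<G>_def)
    fix \<C> assume C: "\<C> \<noteq> {}" "subset.chain \<A> \<C>"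
    define \<D> where "\<D> = (\<lambda>U. E - U) ` \<C>"
    have CG: "\<exists>M\<in>\<G>. U = E - M" if "U \<in> \<C>" for U
      using C(2) that by (auto simp: subset.chain_def \<A>_def)
    have DG: "D \<in> \<G>" if D: "D \<in> \<D>" for D
    proof -
      obtain U where "U \<in> \<C>" "D = E - U" using D by (auto simp: \<D>_def)
      moreover obtain M where "M \<in> \<G>" "U = E - M" using CG \<open>U \<in> \<C>\<close> by blast
      moreover have "E - (E - M) = M" using \<open>M \<in> \<G>\<close> by (auto simp: \<G>_def)
      ultimately show ?thesis by simp
    qed
    have "\<D> \<noteq> {}" using C by (auto simp: \<D>_def)
    have chain: "D \<subseteq> D' \<or> D' \<subseteq> D" if "D \<in> \<D>" "D' \<in> \<D>" for D D'
      using C(2) that by (auto simp: subset.chain_def \<D>_def)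
    have least: "\<exists>D\<in>\<F>. D = \<Inter>\<F>" if "finite \<F>" "\<F> \<noteq> {}" "\<F> \<subseteq> \<D>" for \<F>
      using that
    proof (induction \<F> rule: finite_ne_induct)
      case (insert D \<F>)
      then obtain D' where D': "D' \<in> \<F>" "D' = \<Inter>\<F>" by auto
      then have "D \<subseteq> D' \<or> D' \<subseteq> D" using insert.prems chain[of D D'] by auto
      then have "D \<inter> D' = D \<or> D \<inter> D' = D'" by blast
      then show ?case using D' by (metis Inter_insert insertCI)
    qed simp
    have "E \<inter> \<Inter>\<D> \<noteq> {}"
    proof (rule compact_imp_fip[OF assms(1)])
      show "closed T" if "T \<in> \<D>" for T using DG[OF that] by (simp add: \<G>_def)
      fix \<F> assume F: "finite \<F>" "\<F> \<subseteq> \<D>"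
      show "E \<inter> \<Inter>\<F> \<noteq> {}"
      proof (cases "\<F> = {}")
        case True
        then show ?thesis using assms by simp
      next
        case False
        then obtain D where "D \<in> \<F>" "D = \<Inter>\<F>" using least F by blast
        moreover have "D \<in> \<G>" using DG F \<open>D \<in> \<F>\<close> by blast
        ultimately show ?thesis by (auto simp: \<G>_def)
      qed
    qed
    moreover have "R (\<Inter>\<D>)" using DG \<open>\<D> \<noteq> {}\<close> by (intro inter) (auto simp: \<G>_def)
    moreover have "closed (\<Inter>\<D>)" using DG by (intro closed_Inter) (auto simp: \<G>_def)
    moreover have "\<Inter>\<D> \<subseteq> E" using DG \<open>\<D> \<noteq> {}\<close> by (auto simp: \<G>_def)
    ultimately have "\<Inter>\<D> \<in> \<G>" by (auto simp: \<G>_def)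
    moreover have "\<Union>\<C> = E - \<Inter>\<D>"
    proof -
      have "U \<subseteq> E" if "U \<in> \<C>" for U using CG[OF that] by auto
      then show ?thesis by (auto simp: \<D>_def)
    qed
    ultimately show "\<Union>\<C> \<in> \<A>" unfolding \<A>_def by blast
  qed
  then obtain M where M: "M \<in> \<G>" "\<And>N. N \<in> \<G> \<Longrightarrow> E - M \<subseteq> E - N \<Longrightarrow> E - N = E - M"
    by (auto simp: \<A>_def)
  have "N = M" if N: "N \<subseteq> M" "closed N" "N \<noteq> {}" "R N" for N
  proof -
    have "N \<in> \<G>" using M N by (auto simp: \<G>_def)
    moreover have "E - M \<subseteq> E - N" using N by auto
    ultimately have "E - N = E - M" using M by blast
    then show "N = M" using \<open>N \<in> \<G>\<close> \<open>M \<in> \<G>\<close> by (auto simp: \<G>_def)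
  qed
  then show ?thesis using M(1) unfolding \<G>_def by blast
qed

context minsys
begin

text \<open>The action is extended by the identity outside \<open>X\<close>, so that the enveloping semigroup lives
  in the compact product of the sets \<open>X\<close> (over \<open>X\<close>) and singletons.\<close>

definition xact :: "'g \<Rightarrow> 'x \<Rightarrow> 'x" where
  "xact g x = (if x \<in> X then act g x else x)"

definition env :: "('x \<Rightarrow> 'x) set" where
  "env = closure (range xact)"

lemma xact_env [simp, intro]: "xact g \<in> env"
  unfolding env_def by (rule subsetD[OF closure_subset rangeI])

lemma xact_eq [simp]: "x \<in> X \<Longrightarrow> xact g x = act g x"
  by (simp add: xact_def)

lemma closed_env [simp]: "closed env" by (simp add: env_def)

lemma eval_cont: "continuous_on S (\<lambda>q. (q :: 'x \<Rightarrow> 'x) x)"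
  by (rule continuous_on_subset[OF continuous_on_product_coordinates]) simp

lemma closed_eval: "closed T \<Longrightarrow> closed {q :: 'x \<Rightarrow> 'x. q x \<in> T}"
  using closed_vimage[OF _ eval_cont[of UNIV x]] by (simp add: vimage_def)

lemma env_subset: "env \<subseteq> {q. \<forall>x. q x \<in> (if x \<in> X then X else {x})}"
  unfolding env_def
proof (rule closure_minimal)
  have "{q. \<forall>x. q x \<in> (if x \<in> X then X else {x})} = (\<Inter>x. {q. q x \<in> (if x \<in> X then X else {x})})"
    by blast
  moreover have "closed {q. q x \<in> (if x \<in> X then X else {x})}" for x
    using compact_imp_closed[OF compact_X] by (intro closed_eval) auto
  ultimately show "closed {q. \<forall>x. q x \<in> (if x \<in> X then X else {x})}" by auto
qed (auto simp: xact_def)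

lemma env_in [simp, intro]: "q \<in> env \<Longrightarrow> x \<in> X \<Longrightarrow> q x \<in> X"
  and env_out: "q \<in> env \<Longrightarrow> x \<notin> X \<Longrightarrow> q x = x"
  using env_subset by (force simp: subset_iff split: if_splits)+

lemma compact_env: "compact env"
proof -
  let ?K = "PiE UNIV (\<lambda>x. if x \<in> X then X else {x})"
  have "compactin (product_topology (\<lambda>_. euclidean) UNIV) ?K"
    unfolding compactin_PiE using compact_X by auto
  then have "compact ?K" by (simp add: euclidean_product_topology)
  moreover have "env = env \<inter> ?K" using env_subset by (auto simp: PiE_iff)
  ultimately show ?thesis by (metis closed_Int_compact closed_env)
qed

text \<open>Conditions at finitely many points cut out an open set of the product topology, which
  must meet the group when it contains a point of its closure.\<close>

lemma env_approx:
  assumes q: "q \<in> env" and S: "finite S" "\<And>x U. (x, U) \<in> S \<Longrightarrow> x \<in> X \<and> oin X U \<and> q x \<in> U"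
  obtains g where "\<And>x U. (x, U) \<in> S \<Longrightarrow> act g x \<in> U"
proof -
  have "\<exists>U'. open U' \<and> snd p = X \<inter> U'" if "p \<in> S" for p
    using S(2)[of "fst p" "snd p"] that by (auto simp: openin_open)
  then obtain V where V: "\<And>p. p \<in> S \<Longrightarrow> open (V p) \<and> snd p = X \<inter> V p" by metis
  define G where "G = (\<Inter>p\<in>S. {f :: 'x \<Rightarrow> 'x. f (fst p) \<in> V p})"
  have "open {f :: 'x \<Rightarrow> 'x. f x \<in> T}" if "open T" for x T
    using open_vimage[OF that continuous_on_product_coordinates] by (simp add: vimage_def)
  then have "open G" unfolding G_def using S(1) V by (intro open_INT) auto
  moreover have "q \<in> G" using S(2) V by (fastforce simp: G_def)
  ultimately have "G \<inter> range xact \<noteq> {}"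
    using q open_Int_closure_eq_empty[of G "range xact"] by (auto simp: env_def)
  then obtain g where g: "xact g \<in> G" by auto
  have "act g x \<in> U" if xU: "(x, U) \<in> S" for x U
  proof -
    have "xact g x \<in> V (x, U)" "x \<in> X" using g S(2)[OF xU] xU by (auto simp: G_def)
    then show ?thesis using V[OF xU] by (metis IntI act_in snd_conv xact_eq)
  qed
  then show thesis by (rule that)
qed

lemma closed_relation_env:
  assumes S: "closed S" "S \<subseteq> X \<times> X" "\<And>g x y. (x, y) \<in> S \<Longrightarrow> (act g x, act g y) \<in> S"
    and q: "q \<in> env" and xy: "(x, y) \<in> S"
  shows "(q x, q y) \<in> S"
proof -
  have "closed ((\<lambda>q. (q x, q y)) -` S)"
    using S(1) by (intro closed_vimage continuous_intros eval_cont)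
  moreover have "range xact \<subseteq> (\<lambda>q. (q x, q y)) -` S"
    using S(2,3) xy by auto
  ultimately have "env \<subseteq> (\<lambda>q. (q x, q y)) -` S"
    unfolding env_def by (rule closure_minimal[rotated])
  then show ?thesis using q by auto
qed

lemma xact_comp: "p \<in> env \<Longrightarrow> xact g \<circ> p \<in> env"
proof -
  have "continuous_on env (\<lambda>f. xact g \<circ> f)"
  proof (rule continuous_on_coordinatewise_then_product)
    fix x
    show "continuous_on env (\<lambda>f. (xact g \<circ> f) x)"
    proof (cases "x \<in> X")
      case True
      have "continuous_on env (\<lambda>f. act g (f x))"
        using True by (intro continuous_on_compose2[OF act_cont eval_cont]) auto
      then show ?thesis
        by (rule continuous_on_eq) (use True in auto)
    next
      case False
      have "continuous_on env (\<lambda>f. x)" by simp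
      then show ?thesis
        by (rule continuous_on_eq) (simp add: env_out False xact_def)
    qed
  qed
  then have "closed (env \<inter> (\<lambda>f. xact g \<circ> f) -` env)"
    by (intro continuous_closed_preimage) auto
  moreover have "range xact \<subseteq> env \<inter> (\<lambda>f. xact g \<circ> f) -` env"
  proof -
    have "xact g \<circ> xact h = xact (g + h)" for h
      by (auto simp: fun_eq_iff xact_def act_add)
    then show ?thesis by auto
  qed
  ultimately have "env \<subseteq> env \<inter> (\<lambda>f. xact g \<circ> f) -` env"
    unfolding env_def by (rule closure_minimal[rotated])
  then show "p \<in> env \<Longrightarrow> xact g \<circ> p \<in> env" by auto
qed

lemma comp_right_cont: "continuous_on S (\<lambda>q :: 'x \<Rightarrow> 'x. q \<circ> p)"
  by (rule continuous_on_coordinatewise_then_product) (simp add: eval_cont)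

text \<open>Two closure arguments in a fixed order. Composing with a group element on the left is
  continuous on \<open>env\<close>, which gives \<open>xact_comp\<close>; composing with a fixed map
  on the right is always continuous, which then allows the left factor to vary over
  \<open>env\<close>.\<close>

lemma env_comp: 
  assumes "q \<in> env" "p \<in> env"
  shows "q \<circ> p \<in> env"
proof -
  have "closed ((\<lambda>q. q \<circ> p) -` env)"
    by (intro closed_vimage comp_right_cont) simp
  moreover have "range xact \<subseteq> (\<lambda>q. q \<circ> p) -` env"
    using xact_comp assms by auto
  ultimately have "env \<subseteq> (\<lambda>q. q \<circ> p) -` env"
    unfolding env_def by (rule closure_minimal[rotated])
  then show ?thesis using assms by auto
qed

definition left_ideal :: "('x \<Rightarrow> 'x) set \<Rightarrow> bool" where
  "left_ideal M \<longleftrightarrow> closed M \<and> M \<noteq> {} \<and> M \<subseteq> env \<and> (\<forall>q\<in>env. \<forall>m\<in>M. q \<circ> m \<in> M)"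

definition min_left_ideal :: "('x \<Rightarrow> 'x) set \<Rightarrow> bool" where
  "min_left_ideal M \<longleftrightarrow> left_ideal M \<and> (\<forall>N\<subseteq>M. left_ideal N \<longrightarrow> N = M)"

lemma min_left_ideal_ex: "\<exists>M. min_left_ideal M"
proof -
  let ?R = "\<lambda>M. \<forall>q\<in>env. \<forall>m\<in>M. q \<circ> m \<in> M"
  have "\<exists>M\<subseteq>env. closed M \<and> M \<noteq> {} \<and> ?R M \<and>
    (\<forall>N\<subseteq>M. closed N \<longrightarrow> N \<noteq> {} \<longrightarrow> ?R N \<longrightarrow> N = M)"
  proof (rule compact_minimal_closed_subset[of env ?R])
    show "compact env" "closed env" "env \<noteq> {}" using compact_env xact_env by auto
    show "?R env" using env_comp by blast
    show "?R (\<Inter>\<C>)" if "\<And>C. C \<in> \<C> \<Longrightarrow> ?R C" for \<C> using that by blast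
  qed
  then obtain M where M: "M \<subseteq> env" "closed M" "M \<noteq> {}" "?R M"
    and min: "\<forall>N\<subseteq>M. closed N \<longrightarrow> N \<noteq> {} \<longrightarrow> ?R N \<longrightarrow> N = M"
    by (elim exE conjE)
  have "left_ideal M" using M by (simp add: left_ideal_def)
  moreover have "N = M" if "N \<subseteq> M" "left_ideal N" for N
    using that min[rule_format, of N] by (simp add: left_ideal_def)
  ultimately show ?thesis unfolding min_left_ideal_def by blast
qed

text \<open>The Ellis-Numakura argument: in a minimal closed subsemigroup \<open>M\<close>, right
  multiplication by \<open>v\<close> maps \<open>M\<close> onto \<open>M\<close>. Hence the closed
  subsemigroup of all \<open>q\<close> with \<open>q \<circ> v = v\<close> is nonempty, equals
  \<open>M\<close>, and contains \<open>v\<close>.\<close>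

lemma idempotent_ex:
  assumes N: "closed N" "N \<noteq> {}" "N \<subseteq> env" "\<And>p q. p \<in> N \<Longrightarrow> q \<in> N \<Longrightarrow> p \<circ> q \<in> N"
  obtains v where "v \<in> N" "v \<circ> v = v"
proof -
  let ?R = "\<lambda>M. \<forall>p\<in>M. \<forall>q\<in>M. p \<circ> q \<in> M"
  have cN: "compact N" using closed_Int_compact[OF N(1) compact_env] N(3) by (simp add: Int_absorb2)
  have "\<exists>M\<subseteq>N. closed M \<and> M \<noteq> {} \<and> ?R M \<and>
    (\<forall>S\<subseteq>M. closed S \<longrightarrow> S \<noteq> {} \<longrightarrow> ?R S \<longrightarrow> S = M)"
  proof (rule compact_minimal_closed_subset[of N ?R])
    show "compact N" "closed N" "N \<noteq> {}" using cN N by auto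
    show "?R N" using N(4) by blast
    show "?R (\<Inter>\<C>)" if "\<And>C. C \<in> \<C> \<Longrightarrow> ?R C" for \<C> using that by blast
  qed
  then obtain M where M: "M \<subseteq> N" "closed M" "M \<noteq> {}" "?R M"
    and min': "\<forall>S\<subseteq>M. closed S \<longrightarrow> S \<noteq> {} \<longrightarrow> ?R S \<longrightarrow> S = M"
    by (elim exE conjE)
  have min: "S = M" if "S \<subseteq> M" "closed S" "S \<noteq> {}" "?R S" for S
    using min' that by simp
  have cM: "compact M" using closed_Int_compact[OF M(2) cN] M(1) by (simp add: Int_absorb2)
  obtain v where v: "v \<in> M" using M by auto
  have "(\<lambda>q. q \<circ> v) ` M = M"
  proof (rule min)
    show "(\<lambda>q. q \<circ> v) ` M \<subseteq> M" using M v by auto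
    show "closed ((\<lambda>q. q \<circ> v) ` M)"
      by (intro compact_imp_closed_fun compact_continuous_image comp_right_cont cM)
    show "(\<lambda>q. q \<circ> v) ` M \<noteq> {}" using M by auto
    show "?R ((\<lambda>q. q \<circ> v) ` M)"
    proof (intro ballI)
      fix p q assume "p \<in> (\<lambda>q. q \<circ> v) ` M" "q \<in> (\<lambda>q. q \<circ> v) ` M"
      then obtain p' q' where "p' \<in> M" "p = p' \<circ> v" "q' \<in> M" "q = q' \<circ> v" by auto
      then have "p \<circ> q = (p' \<circ> (v \<circ> q')) \<circ> v" "p' \<circ> (v \<circ> q') \<in> M" using M(4) v by (auto simp: o_assoc)
      then show "p \<circ> q \<in> (\<lambda>q. q \<circ> v) ` M" by blast
    qed
  qed
  then obtain q0 where q0: "q0 \<in> M" "q0 \<circ> v = v" using v by (metis imageE)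
  have "{q \<in> M. q \<circ> v = v} = M"
  proof (rule min)
    have "{q \<in> M. q \<circ> v = v} = M \<inter> (\<Inter>x. {q. q (v x) \<in> {v x}})" by (auto simp: fun_eq_iff)
    moreover have "closed \<dots>" by (intro closed_Int closed_INT M(2) ballI closed_eval) auto
    ultimately show "closed {q \<in> M. q \<circ> v = v}" by simp
    show "{q \<in> M. q \<circ> v = v} \<noteq> {}" using q0 by auto
    show "?R {q \<in> M. q \<circ> v = v}" using M(4) by (auto simp flip: o_assoc)
  qed auto
  then have "v \<circ> v = v" using v by blast
  then show thesis using that v M by blast
qed

end

section \<open>A minimal left ideal and its action on points\<close>

locale ellis = minsys X act
  for X :: "'x::metric_space set" and act :: "'g::{group_add, countable} \<Rightarrow> 'x \<Rightarrow> 'x" +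
  fixes M assumes M: "min_left_ideal M"
begin

lemma M_closed: "closed M" and M_ne: "M \<noteq> {}" and M_env: "m \<in> M \<Longrightarrow> m \<in> env"
  and M_left: "q \<in> env \<Longrightarrow> m \<in> M \<Longrightarrow> q \<circ> m \<in> M"
  and M_min: "N \<subseteq> M \<Longrightarrow> left_ideal N \<Longrightarrow> N = M"
  using M by (auto simp: min_left_ideal_def left_ideal_def)

lemma M_in [simp, intro]: "m \<in> M \<Longrightarrow> x \<in> X \<Longrightarrow> m x \<in> X"
  by (simp add: M_env)

lemma compact_M: "compact M"
proof -
  have "M \<inter> env = M" using M_env by blast
  then show ?thesis using closed_Int_compact[OF M_closed compact_env] by simp
qed

lemma M_principal:
  assumes m: "m \<in> M"
  shows "(\<lambda>q. q \<circ> m) ` env = M"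
proof (rule M_min)
  show "(\<lambda>q. q \<circ> m) ` env \<subseteq> M" using M_left m by auto
  have "closed ((\<lambda>q. q \<circ> m) ` env)"
    by (intro compact_imp_closed_fun compact_continuous_image comp_right_cont compact_env)
  moreover have "(\<lambda>q. q \<circ> m) ` env \<subseteq> env" using env_comp M_env m by auto
  moreover have "q \<circ> p \<in> (\<lambda>q. q \<circ> m) ` env" if "q \<in> env" "p \<in> (\<lambda>q. q \<circ> m) ` env" for p q
    using that env_comp by (auto simp: o_assoc intro!: image_eqI)
  ultimately show "left_ideal ((\<lambda>q. q \<circ> m) ` env)"
    using xact_env unfolding left_ideal_def by blast
qed

text \<open>Idempotents are right identities on a minimal left ideal, because each of its elements
  factors through \<open>u\<close> on the right.\<close>

lemma M_absorb:
  assumes "v \<in> M" "u \<in> M" "u \<circ> u = u"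
  shows "v \<circ> u = v"
proof -
  obtain q where "q \<in> env" "v = q \<circ> u" using M_principal[OF assms(2)] assms(1) by blast
  then show ?thesis using assms(3) by (metis comp_assoc)
qed

lemma M_orbit:
  assumes x: "x \<in> X"
  shows "(\<lambda>q. q x) ` M = X"
proof (rule closed_inv)
  have "compact ((\<lambda>q. q x) ` M)" by (intro compact_continuous_image eval_cont compact_M)
  then show "closedin (top_of_set X) ((\<lambda>q. q x) ` M)"
    using x compact_closedin[OF compact_X] by (auto dest: compact_imp_closed)
  show "(\<lambda>q. q x) ` M \<noteq> {}" using M_ne by auto
  show "act g y \<in> (\<lambda>q. q x) ` M" if y: "y \<in> (\<lambda>q. q x) ` M" for g y
  proof -
    obtain q where "q \<in> M" "y = q x" using y by auto
    then have "xact g \<circ> q \<in> M" "act g y = (xact g \<circ> q) x" using M_left x by auto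
    then show ?thesis by blast
  qed
qed

text \<open>A uniform recurrence statement for points fixed by one idempotent. Each \<open>q\<close>
  in \<open>M\<close> has some \<open>r\<close> with \<open>r \<circ> q = v\<close>, which brings
  every \<open>q x\<close> back to \<open>x\<close>; a group element approximates \<open>r\<close>
  at these finitely many points, and compactness of \<open>M\<close> bounds the number of group
  elements required.\<close>

lemma M_cover:
  assumes v: "v \<in> M" "v \<circ> v = v"
    and S: "finite S" "\<And>x W. (x, W) \<in> S \<Longrightarrow> v x = x \<and> x \<in> W \<and> oin X W"
  obtains F where "finite F" "\<And>q. q \<in> M \<Longrightarrow> \<exists>k\<in>F. \<forall>(x, W)\<in>S. act k (q x) \<in> W"
proof -
  have SX: "x \<in> X" if "(x, W) \<in> S" for x W
    using S(2)[OF that] openin_imp_subset by blast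
  define N where "N k = M \<inter> (\<Inter>(x, W)\<in>S. {q \<in> M. act k (q x) \<in> W})" for k
  have "oin M (N k)" for k
  proof (cases "S = {}")
    case False
    have "oin M {q \<in> M. act k (q x) \<in> W}" if "(x, W) \<in> S" for x W
    proof -
      have "oin M (M \<inter> (\<lambda>q. act k (q x)) -` W)"
      proof (rule continuous_openin_preimage)
        show "continuous_on M (\<lambda>q. act k (q x))"
          using SX[OF that] by (intro continuous_on_compose2[OF act_cont eval_cont]) auto
        show "(\<lambda>q. act k (q x)) \<in> M \<rightarrow> X" using SX[OF that] by auto
      qed (use S that in blast)
      then show ?thesis by (simp add: vimage_def Int_def)
    qed
    then have "oin M (\<Inter>(x, W)\<in>S. {q \<in> M. act k (q x) \<in> W})"
      using False S(1) by (intro openin_INT2) auto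
    then show ?thesis unfolding N_def by (intro openin_Int) auto
  qed (simp add: N_def)
  then have "\<forall>c\<in>range N. oin M c" by blast
  moreover have "M \<subseteq> \<Union>(range N)"
  proof
    fix q assume q: "q \<in> M"
    then obtain r where r: "r \<in> env" "r \<circ> q = v" using M_principal[OF q] v by blast
    have "r (q x) = x" if "(x, W) \<in> S" for x W
      using r(2) S(2)[OF that] by (metis comp_apply)
    moreover have "q x \<in> X" if "(x, W) \<in> S" for x W using q SX[OF that] by auto
    ultimately have "y \<in> X \<and> oin X U \<and> r y \<in> U" if "(y, U) \<in> (\<lambda>(x, W). (q x, W)) ` S" for y U
      using that S(2) by auto
    then obtain k where "\<And>y U. (y, U) \<in> (\<lambda>(x, W). (q x, W)) ` S \<Longrightarrow> act k y \<in> U"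
      using env_approx[OF r(1), of "(\<lambda>(x, W). (q x, W)) ` S"] S(1) by blast
    then have "act k (q x) \<in> W" if "(x, W) \<in> S" for x W using that by force
    then show "q \<in> \<Union>(range N)" using q by (auto simp: N_def)
  qed
  ultimately obtain \<D> where "\<D> \<subseteq> range N" "finite \<D>" "M \<subseteq> \<Union>\<D>"
    using compact_M unfolding compact_eq_openin_cover by meson
  then obtain F where F: "finite F" "M \<subseteq> \<Union>(N ` F)"
    by (metis finite_subset_image)
  have "\<exists>k\<in>F. \<forall>(x, W)\<in>S. act k (q x) \<in> W" if "q \<in> M" for q
  proof -
    obtain k where k: "k \<in> F" "q \<in> N k" using F(2) \<open>q \<in> M\<close> by blast
    have "act k (q x) \<in> W" if "(x, W) \<in> S" for x W
      using k(2) that unfolding N_def by blast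
    then show ?thesis using k(1) by blast
  qed
  then show thesis by (rule that[OF F(1)])
qed

end

section \<open>Incontractible systems\<close>

text \<open>The composition is a projection of the closed set of composable pairs. It gives
  closedness of the equivalence relation built from several copies of \<open>Q\<close>.\<close>

lemma compact_relcomp:
  fixes R :: "('p::metric_space \<times> 'q::metric_space) set" and S :: "('q \<times> 'r::metric_space) set"
  assumes "compact R" "compact S"
  shows "compact (R O S)"
proof -
  have "R O S = (\<lambda>p. (fst (fst p), snd (snd p))) ` ((R \<times> S) \<inter> {p. snd (fst p) = fst (snd p)})"
    by (auto simp: relcomp_unfold image_iff) force
  moreover have "closed {p :: ('p \<times> 'q) \<times> ('q \<times> 'r). snd (fst p) = fst (snd p)}"
    by (intro closed_Collect_eq continuous_intros)
  ultimately show ?thesis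
    using assms by (auto intro!: compact_continuous_image compact_Int_closed compact_Times continuous_intros)
qed

lemma hitI: "x \<in> W \<Longrightarrow> act g x \<in> U \<Longrightarrow> g \<in> hit act W U"
  by (auto simp: hit_def)

context dynsys
begin

text \<open>A finite family \<open>L\<close> of open sets stands for the box \<open>\<Prod>L\<close> in a power of \<open>X\<close>; the product
  of two boxes is then the union of the families.\<close>

definition good :: "'x set set \<Rightarrow> bool" where
  "good L \<longleftrightarrow> finite L \<and> (\<forall>A\<in>L. oin X A \<and> A \<noteq> {})"

lemma good_sub: "good L \<Longrightarrow> A \<in> L \<Longrightarrow> A \<subseteq> X"
  unfolding good_def using openin_imp_subset by blast

text \<open>Shrinks each \<open>A\<close> to the points of \<open>A\<close> just reached from
  \<open>A\<close> by \<open>g\<close>. A return time \<open>h\<close> of the shrunken family yields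
  two return times of \<open>L\<close>: \<open>h + g\<close>, by starting before the step, and
  \<open>- g + h\<close>, by undoing the step after arrival.\<close>

definition return_step :: "'g \<Rightarrow> 'x set set \<Rightarrow> 'x set set" where
  "return_step g L = (\<lambda>A. A \<inter> act g ` A) ` L"

lemma good_return_step:
  assumes "good L" "g \<in> ret act L"
  shows "good (return_step g L)"
proof -
  have "A \<inter> act g ` A \<noteq> {}" if "A \<in> L" for A
    using assms(2) that by (auto simp: ret_def hit_def)
  then show ?thesis
    using assms(1) by (auto simp: good_def return_step_def intro!: openin_Int open_image)
qed

lemma ret_step_add:
  assumes "good L" "h \<in> ret act (return_step g L)"
  shows "h + g \<in> ret act L"
proof -
  have "h + g \<in> hit act A A" if A: "A \<in> L" for A
  proof -
    have "h \<in> hit act (A \<inter> act g ` A) (A \<inter> act g ` A)"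
      using assms(2) A by (auto simp: ret_def return_step_def)
    then obtain y where "y \<in> A" "act h (act g y) \<in> A" by (auto simp: hit_def)
    moreover from this have "act (h + g) y = act h (act g y)"
      using good_sub[OF assms(1) A] by (intro act_add) auto
    ultimately show ?thesis by (intro hitI[of y]) auto
  qed
  then show ?thesis by (simp add: ret_def)
qed

lemma ret_step_diff:
  assumes "good L" "h \<in> ret act (return_step g L)"
  shows "- g + h \<in> ret act L"
proof -
  have "- g + h \<in> hit act A A" if A: "A \<in> L" for A
  proof -
    have "h \<in> hit act (A \<inter> act g ` A) (A \<inter> act g ` A)"
      using assms(2) A by (auto simp: ret_def return_step_def)
    then obtain x y where "x \<in> A" "y \<in> A" "act h x = act g y" by (auto simp: hit_def)
    moreover from this have "act (- g + h) x = y"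
      using good_sub[OF assms(1) A] by (metis act_add act_minus_left subsetD)
    ultimately show ?thesis by (intro hitI[of x]) auto
  qed
  then show ?thesis by (simp add: ret_def)
qed

lemma hit_minus:
  assumes "W \<subseteq> X" "g \<in> hit act W U"
  shows "- g \<in> hit act U W"
proof -
  obtain x where "x \<in> W" "act g x \<in> U" using assms by (auto simp: hit_def)
  moreover from this have "act (- g) (act g x) = x" using assms by auto
  ultimately show ?thesis by (intro hitI[of "act g x"]) auto
qed

lemma ret_minus: "good L \<Longrightarrow> g \<in> ret act L \<Longrightarrow> - g \<in> ret act L"
  unfolding ret_def using hit_minus good_sub by blast

lemma hit_conj:
  assumes "W \<subseteq> X" "U \<subseteq> X" "g \<in> hit act (act (- k) ` W) (act (- k) ` U)"
  shows "k + g + - k \<in> hit act W U"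
proof -
  obtain x y where xy: "x \<in> W" "y \<in> U" "act g (act (- k) x) = act (- k) y"
    using assms(3) by (auto simp: hit_def)
  then have X: "x \<in> X" "y \<in> X" using assms by auto
  then have "act (k + g + - k) x = act (k + g) (act (- k) x)" by (intro act_add)
  also have "\<dots> = act k (act g (act (- k) x))" using X by (intro act_add) auto
  also have "\<dots> = act k (act (- k) y)" using xy by simp
  finally have "act (k + g + - k) x = act k (act (- k) y)" .
  then have "act (k + g + - k) x \<in> U" using xy X by (simp del: add_uminus_conv_diff)
  then show ?thesis using xy(1) by (intro hitI)
qed

text \<open>\<open>EL L\<close> is the closure of the union of the graphs of the elements of \<open>ret act L\<close>.\<close>

definition EL :: "'x set set \<Rightarrow> ('x \<times> 'x) set" where
  "EL L = {(z, z') \<in> X \<times> X. \<forall>W W'. oin X W \<longrightarrow> oin X W' \<longrightarrow> z \<in> W \<longrightarrow> z' \<in> W'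
     \<longrightarrow> hit act W W' \<inter> ret act L \<noteq> {}}"

lemma ELI:
  assumes "z \<in> X" "z' \<in> X"
    "\<And>W W'. oin X W \<Longrightarrow> oin X W' \<Longrightarrow> z \<in> W \<Longrightarrow> z' \<in> W' \<Longrightarrow> hit act W W' \<inter> ret act L \<noteq> {}"
  shows "(z, z') \<in> EL L"
  using assms by (auto simp: EL_def)

lemma ELD:
  assumes "(z, z') \<in> EL L" "oin X W" "oin X W'" "z \<in> W" "z' \<in> W'"
  obtains g where "g \<in> hit act W W'" "g \<in> ret act L"
  using assms by (auto simp: EL_def)

lemma EL_sub: "EL L \<subseteq> X \<times> X" by (auto simp: EL_def)

lemma EL_closed: "closed (EL L)"
proof -
  have "oin (X \<times> X) (X \<times> X - EL L)"
  proof (subst openin_subopen, intro ballI)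
    fix p assume p: "p \<in> X \<times> X - EL L"
    then obtain z z' where zz: "p = (z, z')" "z \<in> X" "z' \<in> X" by auto
    then obtain W W' where W: "oin X W" "oin X W'" "z \<in> W" "z' \<in> W'" "hit act W W' \<inter> ret act L = {}"
      using p by (auto simp: EL_def)
    have "oin (X \<times> X) (W \<times> W')" using W by (intro openin_Times) auto
    moreover have "W \<times> W' \<subseteq> X \<times> X - EL L"
    proof
      fix r assume r: "r \<in> W \<times> W'"
      then have "r \<notin> EL L" using W by (auto simp: EL_def)
      then show "r \<in> X \<times> X - EL L"
        using r openin_imp_subset[OF W(1)] openin_imp_subset[OF W(2)] by auto
    qed
    ultimately show "\<exists>T. oin (X \<times> X) T \<and> p \<in> T \<and> T \<subseteq> X \<times> X - EL L"
      using W zz by (intro exI[of _ "W \<times> W'"]) auto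
  qed
  then have "closedin (top_of_set (X \<times> X)) (EL L)"
    using EL_sub by (simp add: closedin_def)
  then show ?thesis
    using compact_closedin[OF compact_Times[OF compact_X compact_X]] by blast
qed

lemma EL_antimono:
  assumes "L \<subseteq> L'" "(z, z') \<in> EL L'"
  shows "(z, z') \<in> EL L"
proof (rule ELI)
  show "z \<in> X" "z' \<in> X" using assms(2) EL_sub by auto
  fix W W' assume "oin X W" "oin X W'" "z \<in> W" "z' \<in> W'"
  then obtain g where "g \<in> hit act W W'" "g \<in> ret act L'" using ELD[OF assms(2)] by metis
  moreover from this have "g \<in> ret act L" using assms(1) by (auto simp: ret_def)
  ultimately show "hit act W W' \<inter> ret act L \<noteq> {}" by blast
qed

lemma EL_sym:
  assumes "good L" "(z, z') \<in> EL L"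
  shows "(z', z) \<in> EL L"
proof (rule ELI)
  show "z' \<in> X" "z \<in> X" using assms EL_sub by auto
  fix W W' assume W: "oin X W" "oin X W'" "z' \<in> W" "z \<in> W'"
  then obtain g where "g \<in> hit act W' W" "g \<in> ret act L" using ELD[OF assms(2)] by metis
  then have "- g \<in> hit act W W' \<inter> ret act L"
    using hit_minus[OF openin_imp_subset[OF W(2)]] ret_minus[OF assms(1)] by blast
  then show "hit act W W' \<inter> ret act L \<noteq> {}" by blast
qed

lemma EL_graph:
  assumes "g \<in> ret act L" "x \<in> X"
  shows "(x, act g x) \<in> EL L"
  using assms by (intro ELI) (auto intro: hitI)

text \<open>A directed intersection: \<open>EL L\<close> shrinks as \<open>L\<close> grows, and
  finite unions of good families are good. Compactness arguments therefore pass from the single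
  \<open>EL L\<close> to \<open>Q\<close>.\<close>

definition Q :: "('x \<times> 'x) set" where
  "Q = {(z, z') \<in> X \<times> X. \<forall>L. good L \<longrightarrow> (z, z') \<in> EL L}"

lemma Q_sub: "Q \<subseteq> X \<times> X" by (auto simp: Q_def)

lemma Q_EL: "(z, z') \<in> Q \<Longrightarrow> good L \<Longrightarrow> (z, z') \<in> EL L"
  by (auto simp: Q_def)

lemma Q_compact: "compact Q"
proof -
  have "Q = (X \<times> X) \<inter> (\<Inter>L\<in>Collect good. EL L)" by (auto simp: Q_def)
  moreover have "closed (\<Inter>L\<in>Collect good. EL L)" using EL_closed by auto
  ultimately show ?thesis
    using compact_Times[OF compact_X compact_X] by (simp add: compact_Int_closed)
qed

lemma Q_refl: "x \<in> X \<Longrightarrow> (x, x) \<in> Q"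
proof -
  assume x: "x \<in> X"
  have "(x, x) \<in> EL L" if L: "good L" for L
  proof -
    have "0 \<in> ret act L" unfolding ret_def hit_def
    proof (intro CollectI ballI)
      fix A assume A: "A \<in> L"
      then have "A \<noteq> {}" using L by (simp add: good_def)
      then obtain y where "y \<in> A" "y \<in> X" using good_sub[OF L A] by blast
      then show "\<exists>x\<in>A. act 0 x \<in> A" by (intro bexI[of _ y]) auto
    qed
    then show ?thesis using EL_graph[of 0 L x] x by simp
  qed
  then show ?thesis using x by (auto simp: Q_def)
qed

lemma Q_sym: "(x, y) \<in> Q \<Longrightarrow> (y, x) \<in> Q"
  using EL_sym by (auto simp: Q_def)

text \<open>Conjugation by \<open>k\<close> exchanges return times of \<open>L\<close> with those of
  a translated family. Since \<open>Q\<close> ranges over all good families, and translates of good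
  families are good, it is invariant.\<close>

lemma Q_act: 
  assumes "(x, y) \<in> Q"
  shows "(act k x, act k y) \<in> Q"
proof -
  have xy: "x \<in> X" "y \<in> X" using assms Q_sub by auto
  have "(act k x, act k y) \<in> EL L" if L: "good L" for L
  proof (rule ELI)
    fix W W' assume W: "oin X W" "oin X W'" "act k x \<in> W" "act k y \<in> W'"
    let ?L = "image (act (- k)) ` L"
    have "good ?L" using L by (auto simp: good_def intro: open_image)
    moreover have "x \<in> act (- k) ` W" "y \<in> act (- k) ` W'" 
      using W xy by (metis act_minus_left imageI)+
    ultimately obtain g where g: "g \<in> hit act (act (- k) ` W) (act (- k) ` W')" "g \<in> ret act ?L"
      using ELD[OF Q_EL[OF assms] open_image[OF W(1)] open_image[OF W(2)]] by metis
    have "k + g + - k \<in> hit act W W'"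
      using g(1) W openin_imp_subset by (intro hit_conj) auto
    moreover have "k + g + - k \<in> ret act L"
      using g(2) good_sub[OF L] unfolding ret_def by (auto intro!: hit_conj simp del: add_uminus_conv_diff)
    ultimately show "hit act W W' \<inter> ret act L \<noteq> {}" by blast
  qed (use xy in auto)
  then show ?thesis using xy by (auto simp: Q_def)
qed

end

section \<open>The relation \<open>Q\<close> and the equivalence relation it generates\<close>

locale incontractible_ellis = ellis X act M
  for X :: "'x::metric_space set" and act :: "'g::{group_add, countable} \<Rightarrow> 'x \<Rightarrow> 'x" and M +
  assumes incon: "incontractible X act"
begin

text \<open>Incontractibility puts a minimal point \<open>p\<close> of a power of \<open>X\<close>
  into the box given by \<open>L\<close>. Evaluation at \<open>p\<close> sends \<open>M\<close> onto
  a closed invariant part of the orbit closure of \<open>p\<close>, hence onto all of it, so some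
  element of \<open>M\<close> fixes every coordinate of \<open>p\<close>.\<close>

lemma idempotent_with_fixed_points:
  assumes L: "good L"
  obtains v where "v \<in> M" "v \<circ> v = v" "\<And>A. A \<in> L \<Longrightarrow> \<exists>p\<in>A. v p = p"
proof -
  define n where "n = card L"
  obtain e where e: "bij_betw e {..<n} L"
    using L ex_bij_betw_nat_finite[of L] by (auto simp: good_def n_def atLeast0LessThan)
  have eL: "e i \<in> L" if "i < n" for i using e that by (auto simp: bij_betw_def)
  let ?T = "power_top X n"
  have top: "topspace ?T = PiE {..<n} (\<lambda>_. X)" by (simp add: power_top_def)
  have box: "openin ?T (PiE {..<n} e)"
    unfolding power_top_def using eL L by (subst openin_PiE_gen) (auto simp: good_def)
  have "PiE {..<n} e \<noteq> {}" using eL L by (auto simp: PiE_eq_empty_iff good_def)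
  moreover have "PiE {..<n} e \<subseteq> topspace ?T" using openin_subset[OF box] .
  moreover define mp where "mp = {p \<in> topspace ?T. minimal_point ?T (diag_act act n) p}"
  moreover have "?T closure_of mp = topspace ?T"
    using incon by (simp add: incontractible_def mp_def)
  ultimately have "PiE {..<n} e \<inter> ?T closure_of mp \<noteq> {}" by (simp add: Int_absorb2)
  then have "PiE {..<n} e \<inter> mp \<noteq> {}"
    using openin_Int_closure_of_eq_empty[OF box, of mp] by simp
  then obtain p where p: "p \<in> PiE {..<n} e" "minimal_point ?T (diag_act act n) p"
    by (auto simp: mp_def)
  define OC where "OC = orbit_closure ?T (diag_act act n) p"
  have mOC: "minimal_set ?T (diag_act act n) OC" and pT: "p \<in> topspace ?T"
    using p(2) by (auto simp: minimal_point_def OC_def)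
  have pX: "p i \<in> X" if "i < n" for i using pT that by (auto simp: top PiE_iff)
  define ev where "ev q = (\<lambda>i\<in>{..<n}. q (p i))" for q :: "'x \<Rightarrow> 'x"
  have ev_cont: "continuous_map (top_of_set S) ?T ev" if "S \<subseteq> env" for S
    unfolding power_top_def
  proof (subst continuous_map_componentwise, intro conjI ballI)
    show "ev ` topspace (top_of_set S) \<subseteq> extensional {..<n}" by (auto simp: ev_def)
    show "continuous_map (top_of_set S) (top_of_set X) (\<lambda>x. ev x k)" if k: "k \<in> {..<n}" for k
      using k pX that \<open>S \<subseteq> env\<close> eval_cont[of S "p k"] by (auto simp: ev_def)
  qed
  have ev_xact: "ev (xact g) = diag_act act n g p" for g
    using pX by (auto simp: ev_def diag_act_def)
  have orb: "ev ` range xact \<subseteq> OC"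
  proof -
    have "range (\<lambda>g. diag_act act n g p) \<subseteq> topspace ?T"
      unfolding top diag_act_def using pX by (intro image_subsetI) (simp add: restrict_PiE_iff)
    then have "range (\<lambda>g. diag_act act n g p) \<subseteq> OC"
      unfolding OC_def orbit_closure_def by (rule closure_of_subset)
    then show ?thesis using ev_xact by auto
  qed
  have cl: "closedin ?T OC" by (simp add: OC_def orbit_closure_def)
  have evOC: "ev q \<in> OC" if q: "q \<in> env" for q
  proof -
    have "closedin (top_of_set env) {q \<in> topspace (top_of_set env). ev q \<in> OC}"
      using closedin_continuous_map_preimage[OF ev_cont[of env] cl] by simp
    then have "closed {q \<in> env. ev q \<in> OC}"
      using closedin_closed_trans[OF _ closed_env] by simp
    moreover have "range xact \<subseteq> {q \<in> env. ev q \<in> OC}" using orb by auto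
    ultimately have "env \<subseteq> {q \<in> env. ev q \<in> OC}"
      unfolding env_def by (rule closure_minimal[rotated])
    then show ?thesis using q by auto
  qed
  define D where "D = ev ` M"
  have "D = OC"
  proof -
    have "compactin ?T D" unfolding D_def
      using image_compactin[OF _ ev_cont[of M], of M] compact_M M_env
      by (auto simp: compactin_subtopology)
    moreover have "Hausdorff_space ?T"
      unfolding power_top_def
      by (simp add: Hausdorff_space_product_topology Hausdorff_space_subtopology Hausdorff_space_euclidean)
    ultimately have "closedin ?T D" using compactin_imp_closedin by blast
    moreover have "D \<subseteq> OC" using evOC M_env by (auto simp: D_def)
    moreover have "D \<noteq> {}" using M_ne by (auto simp: D_def)
    moreover have "diag_act act n g ` D \<subseteq> D" for g
    proof -
      have "diag_act act n g (ev q) = ev (xact g \<circ> q)" if "q \<in> M" for q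
        using pX that by (auto simp: ev_def diag_act_def)
      then show ?thesis using M_left unfolding D_def by auto
    qed
    ultimately show ?thesis using mOC unfolding minimal_set_def by blast
  qed
  moreover have "p \<in> OC"
  proof -
    have "diag_act act n 0 p = p"
      using pT pX by (auto simp: diag_act_def top PiE_iff extensional_def fun_eq_iff)
    then show ?thesis using orb ev_xact[of 0] by auto
  qed
  ultimately obtain q0 where q0: "q0 \<in> M" "ev q0 = p" by (auto simp: D_def)
  \<comment> \<open>The elements of \<open>M\<close> fixing all coordinates of \<open>p\<close> form
    a nonempty closed subsemigroup, so the idempotent can be chosen among them.\<close>
  define N where "N = M \<inter> (\<Inter>i\<in>{..<n}. {q. q (p i) \<in> {p i}})"
  have "closed N" unfolding N_def by (intro closed_Int closed_INT M_closed ballI closed_eval) auto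
  moreover have "N \<noteq> {}"
  proof -
    have "q0 (p i) = p i" if "i < n" for i
    proof -
      have "ev q0 i = q0 (p i)" using that by (simp add: ev_def)
      then show ?thesis using q0(2) by simp
    qed
    then show ?thesis using q0 by (auto simp: N_def)
  qed
  moreover have "N \<subseteq> env" using M_env by (auto simp: N_def)
  moreover have "r \<circ> q \<in> N" if "r \<in> N" "q \<in> N" for r q
    using that M_left M_env by (auto simp: N_def)
  ultimately obtain v where v: "v \<in> N" "v \<circ> v = v" by (rule idempotent_ex)
  show thesis
  proof (rule that)
    show "v \<in> M" "v \<circ> v = v" using v by (auto simp: N_def)
    show "\<exists>p\<in>A. v p = p" if "A \<in> L" for A
    proof -
      obtain i where "i < n" "e i = A" using e \<open>A \<in> L\<close> by (auto simp: bij_betw_def)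
      then have "p i \<in> A" "v (p i) = p i" using p v by (auto simp: N_def PiE_iff)
      then show ?thesis by blast
    qed
  qed
qed

end

context incontractible_ellis
begin

text \<open>A substitute for openness of evaluation at \<open>a\<close>: an open set of values
  \<open>q a\<close> is attained while \<open>q\<close> keeps the finitely many fixed points in
  their neighbourhoods. Finitely many closed pieces \<open>C k\<close> cover \<open>M\<close> by
  \<open>M_cover\<close>, so the evaluation of one of them has interior in \<open>X\<close>, and
  \<open>k\<close> moves it to the right place.\<close>

lemma fixed_open_interior:
  assumes v: "v \<in> M" "v \<circ> v = v"
    and S: "finite S" "\<And>x W. (x, W) \<in> S \<Longrightarrow> v x = x \<and> x \<in> W \<and> oin X W"
    and a: "a \<in> X"
  obtains T where "oin X T" "T \<noteq> {}"
    "\<And>t. t \<in> T \<Longrightarrow> \<exists>q\<in>M. q a = t \<and> (\<forall>(x, W)\<in>S. q x \<in> W)"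
proof -
  have "\<exists>r. r > 0 \<and> X \<inter> cball (fst p) r \<subseteq> snd p" if "p \<in> S" for p
    using open_contains_cball_in[of X "snd p" "fst p"] S(2)[of "fst p" "snd p"] that by (metis prod.collapse)
  then obtain r where r: "\<And>p. p \<in> S \<Longrightarrow> r p > 0 \<and> X \<inter> cball (fst p) (r p) \<subseteq> snd p" by metis
  have SX: "x \<in> X" if "(x, W) \<in> S" for x W using S(2)[OF that] openin_imp_subset by blast
  \<comment> \<open>Open balls are used for the covering of \<open>M\<close>; the closed balls of
    the same radius make the sets \<open>C k\<close> closed and still lie inside the given
    neighbourhoods.\<close>
  define S' where "S' = (\<lambda>p. (fst p, X \<inter> ball (fst p) (r p))) ` S"
  have "finite S'" using S by (simp add: S'_def)
  moreover have "v x = x \<and> x \<in> W \<and> oin X W" if xW: "(x, W) \<in> S'" for x W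
  proof -
    obtain p where p: "p \<in> S" "x = fst p" "W = X \<inter> ball (fst p) (r p)" using xW by (auto simp: S'_def)
    then have "(x, snd p) \<in> S" by simp
    then have "v x = x" "x \<in> X" using S(2) SX by blast+
    then show ?thesis using r[OF p(1)] p by (auto simp: openin_open_Int)
  qed
  ultimately obtain F where F: "finite F" "\<And>q. q \<in> M \<Longrightarrow> \<exists>k\<in>F. \<forall>(x, W)\<in>S'. act k (q x) \<in> W"
    using M_cover[OF v, of S'] by blast
  define C where "C k = M \<inter> (\<Inter>p\<in>S. {q \<in> env. q (fst p) \<in> {y \<in> X. act k y \<in> X \<inter> cball (fst p) (r p)}})" for k
  have ccl: "closed {y \<in> X. act k y \<in> X \<inter> cball x e}" for k x e
  proof -
    have "closedin (top_of_set X) (X \<inter> cball x e)" by (intro closedin_closed_Int) simp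
    from closed_pre[OF this, of k] show ?thesis
      unfolding compact_closedin[OF compact_X] by (rule conjunct1)
  qed
  have Ccl: "closed (C k)" for k
  proof -
    have ce: "closed {q \<in> env. q x \<in> T}" if "closed T" for x T
      using closed_Int[OF closed_env closed_eval[OF that]] by (simp add: Int_def)
    show ?thesis unfolding C_def by (intro closed_Int closed_INT ballI M_closed ce[OF ccl])
  qed
  have "compact (C k)" for k
    using closed_Int_compact[OF Ccl[of k] compact_M] by (simp add: C_def Int_absorb2)
  then have Tcl: "closedin (top_of_set X) ((\<lambda>q. q a) ` C k)" for k
    using compact_continuous_image[OF eval_cont, of "C k" a] a
    by (auto simp: compact_closedin[OF compact_X] C_def dest: compact_imp_closed)
  have "X \<subseteq> \<Union> ((\<lambda>k. (\<lambda>q. q a) ` C k) ` F)"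
  proof
    fix x assume "x \<in> X"
    then obtain q where q: "q \<in> M" "x = q a" using M_orbit[OF a] by blast
    then obtain k where k: "k \<in> F" "\<forall>(x, W)\<in>S'. act k (q x) \<in> W" using F by blast
    have "q (fst p) \<in> {y \<in> X. act k y \<in> X \<inter> cball (fst p) (r p)}" if "p \<in> S" for p
    proof -
      have "(fst p, X \<inter> ball (fst p) (r p)) \<in> S'" using that by (auto simp: S'_def)
      from bspec[OF k(2) this] have "act k (q (fst p)) \<in> X \<inter> ball (fst p) (r p)" by simp
      moreover have "fst p \<in> X" using SX[of "fst p" "snd p"] that by simp
      ultimately show ?thesis using q by auto
    qed
    then have "q \<in> C k" using q M_env by (auto simp: C_def)
    then show "x \<in> \<Union> ((\<lambda>k. (\<lambda>q. q a) ` C k) ` F)" using k q by blast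
  qed
  then have "\<exists>D\<in>(\<lambda>k. (\<lambda>q. q a) ` C k) ` F. \<exists>W. oin X W \<and> W \<noteq> {} \<and> W \<subseteq> D"
    using F(1) Tcl X_ne by (intro finite_closed_cover_interior[where G = X]) auto
  then obtain k V where V: "oin X V" "V \<noteq> {}" "V \<subseteq> (\<lambda>q. q a) ` C k" by auto
  show thesis
  proof (rule that)
    show "oin X (act k ` V)" "act k ` V \<noteq> {}" using V open_image by auto
    fix t assume "t \<in> act k ` V"
    then obtain q where q: "q \<in> C k" "t = act k (q a)" using V by blast
    then have qM: "q \<in> M" by (simp add: C_def)
    have "xact k \<circ> q \<in> M" using M_left qM by auto
    moreover have "(xact k \<circ> q) a = t" using q qM a by auto
    moreover have "(xact k \<circ> q) x \<in> W" if xW: "(x, W) \<in> S" for x W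
    proof -
      have "act k (q x) \<in> X \<inter> cball x (r (x, W))" using q(1) xW by (auto simp: C_def)
      then show ?thesis using r[OF xW] SX[OF xW] qM by auto
    qed
    ultimately show "\<exists>q\<in>M. q a = t \<and> (\<forall>(x, W)\<in>S. q x \<in> W)" by blast
  qed
qed

lemma Q_env: "q \<in> env \<Longrightarrow> (x, y) \<in> Q \<Longrightarrow> (q x, q y) \<in> Q"
  using closed_relation_env[OF compact_imp_closed[OF Q_compact] Q_sub Q_act] by blast

text \<open>A common idempotent allows the middle point to be moved through an open set
  \<open>T\<close> with \<open>x\<close> kept in \<open>W\<close> and \<open>z\<close> in
  \<open>W''\<close>. One return time goes from \<open>W\<close> into \<open>T\<close>, a second one
  continues from the part of \<open>T\<close> so reached to \<open>W''\<close>.\<close>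

lemma Q_trans_fixed:
  assumes v: "v \<in> M" "v \<circ> v = v" and fx: "v x = x" "v y = y" "v z = z"
    and xy: "(x, y) \<in> Q" and yz: "(y, z) \<in> Q"
  shows "(x, z) \<in> Q"
proof -
  have X: "x \<in> X" "y \<in> X" "z \<in> X" using xy yz Q_sub by auto
  have "(x, z) \<in> EL L" if L: "good L" for L
  proof (rule ELI)
    fix W W'' assume W: "oin X W" "oin X W''" "x \<in> W" "z \<in> W''"
    have "\<exists>T. oin X T \<and> T \<noteq> {} \<and>
        (\<forall>t\<in>T. \<exists>q\<in>M. q y = t \<and> (\<forall>(x, W)\<in>{(x, W), (z, W'')}. q x \<in> W))"
      by (rule fixed_open_interior[OF v, of "{(x, W), (z, W'')}" y]) (use W fx X in auto)
    then obtain T where T: "oin X T" "T \<noteq> {}" 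
      "\<And>t. t \<in> T \<Longrightarrow> \<exists>q\<in>M. q y = t \<and> q x \<in> W \<and> q z \<in> W''"
      by auto
    obtain t q where q: "t \<in> T" "q \<in> M" "q y = t" "q x \<in> W" using T by blast
    then have "(q x, t) \<in> Q" using Q_env[OF M_env xy] by blast
    then obtain g where g: "g \<in> hit act W T" "g \<in> ret act L"
      using ELD[OF Q_EL[OF _ L] W(1) T(1)] q by metis
    \<comment> \<open>The second step must start from points that come from \<open>W\<close> under
      \<open>g\<close>; asking it to return \<open>return_step g L\<close> makes the sum of both
      times return \<open>L\<close>.\<close>
    define T1 where "T1 = T \<inter> act g ` W"
    have T1: "oin X T1" "T1 \<noteq> {}"
      using g(1) T(1) W(1) by (auto simp: T1_def hit_def intro!: openin_Int open_image)
    obtain t' q' where q': "t' \<in> T1" "q' \<in> M" "q' y = t'" "q' z \<in> W''"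
      using T1 T(3) unfolding T1_def by (metis IntD1 all_not_in_conv)
    then have "(t', q' z) \<in> Q" using Q_env[OF M_env yz] by blast
    then obtain h where h: "h \<in> hit act T1 W''" "h \<in> ret act (return_step g L)"
      using ELD[OF Q_EL[OF _ good_return_step[OF L g(2)]] T1(1) W(2)] q' by metis
    obtain w where w: "w \<in> W" "act h (act g w) \<in> W''" using h(1) by (auto simp: hit_def T1_def)
    moreover have "w \<in> X" using w W openin_imp_subset by blast
    ultimately have "h + g \<in> hit act W W''" by (intro hitI[of w]) (auto simp: act_add)
    then show "hit act W W'' \<inter> ret act L \<noteq> {}" using ret_step_add[OF L h(2)] by blast
  qed (use X in auto)
  then show ?thesis using X by (auto simp: Q_def)
qed

text \<open>A group element approximating \<open>v\<close> both at \<open>x\<close> and at one fixed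
  point in each member of \<open>L\<close> is a return time of \<open>L\<close>.\<close>

lemma EL_idempotent:
  assumes L: "good L" and v: "v \<in> M" "\<And>A. A \<in> L \<Longrightarrow> \<exists>p\<in>A. v p = p" and x: "x \<in> X"
  shows "(x, v x) \<in> EL L"
proof (rule ELI)
  show "x \<in> X" "v x \<in> X" using x v by auto
  fix W W' assume W: "oin X W" "oin X W'" "x \<in> W" "v x \<in> W'"
  obtain p where p: "\<And>A. A \<in> L \<Longrightarrow> p A \<in> A \<and> v (p A) = p A" using v(2) by metis
  let ?S = "insert (x, W') ((\<lambda>A. (p A, A)) ` L)"
  have "finite ?S" using L by (simp add: good_def)
  moreover have "y \<in> X \<and> oin X U \<and> v y \<in> U" if "(y, U) \<in> ?S" for y U
    using that x W L p good_sub[OF L] by (fastforce simp: good_def)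
  ultimately obtain g where g: "\<And>y U. (y, U) \<in> ?S \<Longrightarrow> act g y \<in> U"
    using env_approx[OF M_env[OF v(1)], of ?S] by blast
  have "g \<in> hit act W W'" using g[of x W'] W by (intro hitI[of x]) auto
  moreover have "g \<in> ret act L" unfolding ret_def
  proof (intro CollectI ballI)
    fix A assume A: "A \<in> L"
    then show "g \<in> hit act A A" using g[of "p A" A] p[OF A] by (intro hitI[of "p A"]) auto
  qed
  ultimately show "hit act W W' \<inter> ret act L \<noteq> {}" by blast
qed

text \<open>The witnesses \<open>x\<close> for different \<open>L\<close> have a common limit: the
  sets of witnesses are compact, and a finite union of good families handles finitely many of them
  at once.\<close>

lemma EL_common_point:
  assumes D: "\<And>L. good L \<Longrightarrow> \<exists>x\<in>X. (x, b) \<in> EL L \<and> (x, b') \<in> EL L"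
    and b: "b \<in> X" "b' \<in> X"
  obtains x where "(x, b) \<in> Q" "(x, b') \<in> Q"
proof -
  have "X \<inter> (\<Inter>L\<in>Collect good. {x. (x, b) \<in> EL L} \<inter> {x. (x, b') \<in> EL L}) \<noteq> {}"
  proof (rule compact_imp_fip_image[OF compact_X])
    have "closed {x. (x, c) \<in> EL L}" for c L
      using closed_vimage[OF EL_closed, of "\<lambda>x. (x, c)" L] by (simp add: vimage_def continuous_intros)
    then show "closed ({x. (x, b) \<in> EL L} \<inter> {x. (x, b') \<in> EL L})" for L by auto
    fix \<I> assume I: "finite \<I>" "\<I> \<subseteq> Collect good"
    then have "good (\<Union>\<I>)" unfolding good_def by blast
    from D[OF this] obtain x where x: "x \<in> X" "(x, b) \<in> EL (\<Union>\<I>)" "(x, b') \<in> EL (\<Union>\<I>)" by blast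
    have "x \<in> X \<inter> (\<Inter>L\<in>\<I>. {x. (x, b) \<in> EL L} \<inter> {x. (x, b') \<in> EL L})"
      using x EL_antimono[OF Union_upper] by auto
    then show "X \<inter> (\<Inter>L\<in>\<I>. {x. (x, b) \<in> EL L} \<inter> {x. (x, b') \<in> EL L}) \<noteq> {}" by blast
  qed
  then obtain x where "x \<in> X" "\<And>L. good L \<Longrightarrow> (x, b) \<in> EL L \<and> (x, b') \<in> EL L" by blast
  then show thesis using that[of x] b by (auto simp: Q_def)
qed

text \<open>For each \<open>L\<close> an idempotent \<open>v\<close> fixing points in the members of
  \<open>L\<close> satisfies \<open>v (u z) = v z\<close> by \<open>M_absorb\<close>, so
  \<open>z\<close> and \<open>u z\<close> are both related to \<open>v z\<close>. Only the
  intermediate point depends on \<open>L\<close>, and \<open>EL_common_point\<close> makes it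
  uniform.\<close>

lemma Q_idempotent:
  assumes u: "u \<in> M" "u \<circ> u = u" and z: "z \<in> X"
  obtains q where "(z, q) \<in> Q" "(q, u z) \<in> Q"
proof -
  have "\<exists>x\<in>X. (x, z) \<in> EL L \<and> (x, u z) \<in> EL L" if L: "good L" for L
  proof -
    obtain v where v: "v \<in> M" "v \<circ> v = v" "\<And>A. A \<in> L \<Longrightarrow> \<exists>p\<in>A. v p = p"
      using idempotent_with_fixed_points[OF L] by blast
    have "v (u z) = v z" using M_absorb[OF v(1) u] by (metis comp_apply)
    then have "(z, v z) \<in> EL L" "(u z, v z) \<in> EL L"
      using EL_idempotent[OF L v(1) v(3) z] EL_idempotent[OF L v(1) v(3), of "u z"] u z by auto
    then show ?thesis using EL_sym[OF L] v z by blast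
  qed
  then obtain q where "(q, z) \<in> Q" "(q, u z) \<in> Q" using EL_common_point[of z "u z"] u z by auto
  then show thesis using that Q_sym by blast
qed

text \<open>Five factors are needed: by the previous lemma \<open>z\<close> and \<open>u z\<close> are joined by two steps in \<open>Q\<close>,
  so that for every idempotent \<open>u\<close> of \<open>M\<close> the relation below is \<open>(u z, u z') \<in> Q\<close>. Being a composition
  of compact relations, it is closed.\<close>

definition S :: "('x \<times> 'x) set" where "S = Q O Q O Q O Q O Q"

lemma S_compact: "compact S"
  unfolding S_def by (intro compact_relcomp Q_compact)

lemma S_sub: "S \<subseteq> X \<times> X"
  using Q_sub by (auto simp: S_def)

text \<open>Applying \<open>u\<close> to a chain of five steps gives a chain of
  \<open>u\<close>-fixed points, on which \<open>Q\<close> is transitive. Conversely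
  \<open>Q_idempotent\<close> supplies two steps at each end of the middle step
  \<open>(u z, u z')\<close>.\<close>

lemma S_iff:
  assumes u: "u \<in> M" "u \<circ> u = u"
  shows "(z, z') \<in> S \<longleftrightarrow> z \<in> X \<and> z' \<in> X \<and> (u z, u z') \<in> Q"
proof
  assume S: "(z, z') \<in> S"
  then have X: "z \<in> X" "z' \<in> X" using S_sub by auto
  have fx: "u (u x) = u x" for x using u(2) by (metis comp_apply)
  have tr: "(u x, u z) \<in> Q" if "(u x, u y) \<in> Q" "(y, z) \<in> Q" for x y z
    using Q_trans_fixed[OF u fx fx fx that(1) Q_env[OF M_env[OF u(1)] that(2)]] .
  obtain a b c d where Qs: "(z, a) \<in> Q" "(a, b) \<in> Q" "(b, c) \<in> Q" "(c, d) \<in> Q" "(d, z') \<in> Q"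
    using S unfolding S_def by (elim relcompEpair)
  have "(u z, u z') \<in> Q"
    by (rule tr[OF tr[OF tr[OF tr[OF Q_env[OF M_env[OF u(1)] Qs(1)] Qs(2)] Qs(3)] Qs(4)] Qs(5)])
  then show "z \<in> X \<and> z' \<in> X \<and> (u z, u z') \<in> Q" using X by blast
next
  assume z: "z \<in> X \<and> z' \<in> X \<and> (u z, u z') \<in> Q"
  obtain q where q: "(z, q) \<in> Q" "(q, u z) \<in> Q" using Q_idempotent[OF u, of z] z by blast
  obtain q' where q': "(z', q') \<in> Q" "(q', u z') \<in> Q" using Q_idempotent[OF u, of z'] z by blast
  show "(z, z') \<in> S" unfolding S_def
    using z by (intro relcompI[OF q(1) relcompI[OF q(2) relcompI[OF _ relcompI[OF Q_sym[OF q'(2)] Q_sym[OF q'(1)]]]]]) simp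
qed

lemma idempotent_M: obtains u where "u \<in> M" "u \<circ> u = u"
  using idempotent_with_fixed_points[of "{}"] by (auto simp: good_def)

lemma S_equiv: "equiv X S"
proof -
  obtain u where u: "u \<in> M" "u \<circ> u = u" by (rule idempotent_M)
  have fx: "u (u x) = u x" for x using u(2) by (metis comp_apply)
  show ?thesis
  proof (rule equivI)
    show "S \<subseteq> X \<times> X" by (rule S_sub)
    show "refl_on X S" 
      by (rule refl_onI) (use Q_refl u in \<open>auto simp: S_iff[OF u]\<close>)
    show "sym S" by (rule symI) (use Q_sym in \<open>auto simp: S_iff[OF u]\<close>)
    show "trans S"
      by (rule transI) (use Q_trans_fixed[OF u fx fx fx] in \<open>auto simp: S_iff[OF u]\<close>)
  qed
qed

lemma Q_Q_S:
  assumes "(x, b) \<in> Q" "(x, b') \<in> Q"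
  shows "(b, b') \<in> S"
proof -
  have "b' \<in> X" using assms Q_sub by auto
  then show ?thesis
    unfolding S_def
    by (intro relcompI[OF Q_sym[OF assms(1)] relcompI[OF assms(2) relcompI[OF Q_refl relcompI[OF Q_refl Q_refl]]]])
qed

text \<open>\<open>M_cover\<close> applied to the translate of an idempotent by \<open>- g\<close>
  finds \<open>k\<close> in a fixed finite set such that \<open>k + - g\<close> returns all chosen
  fixed points; its inverse is \<open>g + - k\<close>.\<close>

lemma ret_syndetic:
  assumes L: "good L"
  obtains F where "finite F" "\<And>g. \<exists>k\<in>F. g + - k \<in> ret act L"
proof -
  obtain v where v: "v \<in> M" "v \<circ> v = v" "\<And>A. A \<in> L \<Longrightarrow> \<exists>p\<in>A. v p = p"
    using idempotent_with_fixed_points[OF L] by blast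
  obtain p where p: "\<And>A. A \<in> L \<Longrightarrow> p A \<in> A \<and> v (p A) = p A" using v(3) by metis
  have "finite ((\<lambda>A. (p A, A)) ` L)" using L by (simp add: good_def)
  moreover have "v x = x \<and> x \<in> W \<and> oin X W" if "(x, W) \<in> (\<lambda>A. (p A, A)) ` L" for x W
    using that p L by (auto simp: good_def)
  ultimately obtain F where F: "finite F"
    "\<And>q. q \<in> M \<Longrightarrow> \<exists>k\<in>F. \<forall>(x, W)\<in>(\<lambda>A. (p A, A)) ` L. act k (q x) \<in> W"
    using M_cover[OF v(1,2), of "(\<lambda>A. (p A, A)) ` L"] by blast
  have "\<exists>k\<in>F. g + - k \<in> ret act L" for g
  proof -
    have "xact (- g) \<circ> v \<in> M" using M_left v by auto
    then obtain k where k: "k \<in> F" "\<And>A. A \<in> L \<Longrightarrow> act k ((xact (- g) \<circ> v) (p A)) \<in> A"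
      using F(2) by force
    have "k + - g \<in> ret act L" unfolding ret_def
    proof (intro CollectI ballI)
      fix A assume A: "A \<in> L"
      have "p A \<in> X" using p[OF A] good_sub[OF L A] by auto
      then have "act (k + - g) (p A) \<in> A"
        using k(2)[OF A] p[OF A] act_add[of "p A" k "- g"] by simp
      then show "k + - g \<in> hit act A A" using p[OF A] by (intro hitI) auto
    qed
    then have "- (k + - g) \<in> ret act L" by (rule ret_minus[OF L])
    then show ?thesis using k(1) by (auto simp: minus_add)
  qed
  then show thesis using that F(1) by blast
qed

end

section \<open>Continuous functions separating the classes of a closed equivalence relation\<close>

lemma closed_equivalence_separation:
  fixes X :: "'a::metric_space set"
  assumes X: "compact X" and S: "equiv X S" "compact S" and b: "b \<in> X" "b' \<in> X" "(b, b') \<notin> S"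
  obtains f :: "'a \<Rightarrow> real" where "continuous_on X f" "\<And>x. x \<in> X \<Longrightarrow> f x \<in> {0..1}" "f b = 0" "f b' = 1"
    "\<And>x y. (x, y) \<in> S \<Longrightarrow> f x = f y"
proof -
  have S_sub: "S \<subseteq> X \<times> X" and S_refl: "\<And>x. x \<in> X \<Longrightarrow> (x, x) \<in> S"
    and S_sym: "\<And>x y. (x, y) \<in> S \<Longrightarrow> (y, x) \<in> S"
    and S_trans: "\<And>x y z. (x, y) \<in> S \<Longrightarrow> (y, z) \<in> S \<Longrightarrow> (x, z) \<in> S"
    using S(1) by (auto elim: equivE dest: refl_onD symD transD)
  define sat where "sat U \<longleftrightarrow> oin X U \<and> (\<forall>x y. (x, y) \<in> S \<longrightarrow> x \<in> U \<longrightarrow> y \<in> U)" for U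
  have "istopology sat"
    unfolding istopology_def sat_def by (auto intro: openin_Int openin_Union)
  then have sat: "openin (topology sat) = sat" by (rule topology_inverse')
  let ?T = "topology sat"
  have top: "topspace ?T = X"
  proof -
    have "sat X" using S_sub by (auto simp: sat_def)
    moreover have "U \<subseteq> X" if "sat U" for U using that openin_imp_subset by (auto simp: sat_def)
    ultimately show ?thesis unfolding topspace_def sat by auto
  qed
  have img_closed: "closed (S `` C)" if C: "closed C" "C \<subseteq> X" for C
  proof -
    have "compact (C \<times> X)" using C X compact_Int_closed[OF X C(1)] by (simp add: compact_Times Int_absorb1)
    then have "compact (S \<inter> C \<times> X)" using S(2) by (simp add: compact_Int)
    moreover have "S `` C = snd ` (S \<inter> C \<times> X)"
      using S_sub by (force simp: image_iff)
    ultimately show ?thesis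
      using compact_continuous_image[OF continuous_on_snd[OF continuous_on_id]] compact_imp_closed
      by metis
  qed
  have closed_iff: "closedin ?T C \<longleftrightarrow> closed C \<and> C \<subseteq> X \<and> S `` C \<subseteq> C" for C
  proof -
    have "closedin ?T C \<longleftrightarrow> C \<subseteq> X \<and> sat (X - C)" by (simp add: closedin_def top sat)
    also have "\<dots> \<longleftrightarrow> closed C \<and> C \<subseteq> X \<and> S `` C \<subseteq> C"
    proof -
      have "C \<subseteq> X \<and> oin X (X - C) \<longleftrightarrow> closed C \<and> C \<subseteq> X"
        using compact_closedin[OF X, of C] by (auto simp: closedin_def)
      moreover have "(\<forall>x y. (x, y) \<in> S \<longrightarrow> x \<in> X - C \<longrightarrow> y \<in> X - C) \<longleftrightarrow> S `` C \<subseteq> C"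
      proof (intro iffI allI impI)
        assume l: "\<forall>x y. (x, y) \<in> S \<longrightarrow> x \<in> X - C \<longrightarrow> y \<in> X - C"
        show "S `` C \<subseteq> C"
        proof
          fix y assume "y \<in> S `` C"
          then obtain x where "x \<in> C" "(x, y) \<in> S" by blast
          then show "y \<in> C" using l[rule_format, OF S_sym[of x y]] S_sub by blast
        qed
      next
        fix x y assume "S `` C \<subseteq> C" "(x, y) \<in> S" "x \<in> X - C"
        then show "y \<in> X - C" using S_sym[of x y] S_sub by blast
      qed
      ultimately show ?thesis by (auto simp: sat_def)
    qed
    finally show ?thesis .
  qed
  have "normal_space ?T"
    unfolding normal_space_def
  proof (intro allI impI)
    fix A B assume AB: "closedin ?T A \<and> closedin ?T B \<and> disjnt A B"
    then have A: "closed A" "A \<subseteq> X" "S `` A \<subseteq> A" and B: "closed B" "B \<subseteq> X" "S `` B \<subseteq> B"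
      using closed_iff by auto
    obtain U V where UV: "open U" "open V" "A \<subseteq> U" "B \<subseteq> V" "U \<inter> V = {}"
      using t4_space[OF A(1) B(1)] AB by (auto simp: disjnt_def)
    \<comment> \<open>The union of the classes contained in \<open>U\<close>; it is open when
      \<open>U\<close> is, since saturations of closed sets are closed.\<close>
    define sU where "sU U = X - S `` (X - U)" for U
    have o: "openin ?T (sU U)" if "open U" for U
    proof -
      have "closed (X - U)" using that X by (simp add: closed_Diff compact_imp_closed)
      then have "closed (S `` (X - U))" by (intro img_closed) auto
      moreover have "S `` (X - U) \<subseteq> X" using S_sub by auto
      moreover have "S `` (S `` (X - U)) \<subseteq> S `` (X - U)" using S_trans by blast
      ultimately have "closedin ?T (S `` (X - U))" using closed_iff by blast
      then show ?thesis unfolding sU_def using top by (metis openin_closedin_eq closedin_def)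
    qed
    have sub: "sU U \<subseteq> U" for U using S_refl by (auto simp: sU_def)
    have in_s: "C \<subseteq> sU U" if "C \<subseteq> U" "C \<subseteq> X" "S `` C \<subseteq> C" for C U
      unfolding sU_def
    proof
      fix x assume x: "x \<in> C"
      have "y \<in> U" if "(y, x) \<in> S" for y
        using S_sym[OF that] x \<open>S `` C \<subseteq> C\<close> \<open>C \<subseteq> U\<close> by blast
      then show "x \<in> X - S `` (X - U)" using x \<open>C \<subseteq> X\<close> by blast
    qed
    show "\<exists>U V. openin ?T U \<and> openin ?T V \<and> A \<subseteq> U \<and> B \<subseteq> V \<and> disjnt U V"
      using o[OF UV(1)] o[OF UV(2)] in_s[OF UV(3) A(2,3)] in_s[OF UV(4) B(2,3)] sub[of U] sub[of V] UV(5)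
      by (intro exI[of _ "sU U"] exI[of _ "sU V"]) (auto simp: disjnt_def)
  qed
  moreover have "closedin ?T (S `` {x})" if "x \<in> X" for x
    using that S_sub S_trans img_closed[of "{x}"] by (auto simp: closed_iff)
  moreover have "disjnt (S `` {b}) (S `` {b'})"
  proof -
    have False if "(b, y) \<in> S" "(b', y) \<in> S" for y
      using S_trans[OF that(1) S_sym[OF that(2)]] b(3) by simp
    then show ?thesis by (auto simp: disjnt_def)
  qed
  ultimately obtain f where f: "continuous_map ?T (top_of_set {0..1::real}) f"
    "f ` (S `` {b}) \<subseteq> {0}" "f ` (S `` {b'}) \<subseteq> {1}"
    using Urysohn_lemma[of ?T "S `` {b}" "S `` {b'}" 0 1] b(1,2) by auto
  have pre: "sat {x \<in> X. f x \<in> U}" if "open U" for U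
  proof -
    have "openin (top_of_set {0..1::real}) ({0..1} \<inter> U)" using that by (simp add: openin_open_Int)
    then have "openin ?T {x \<in> topspace ?T. f x \<in> {0..1} \<inter> U}"
      using f(1) openin_continuous_map_preimage by blast
    moreover have "{x \<in> topspace ?T. f x \<in> {0..1} \<inter> U} = {x \<in> X. f x \<in> U}"
      using continuous_map_image_subset_topspace[OF f(1)] by (auto simp: top)
    ultimately show ?thesis by (simp add: sat)
  qed
  show thesis
  proof (rule that)
    show "continuous_on X f"
      unfolding continuous_openin_preimage_eq
      using pre by (simp add: sat_def vimage_def Int_def)
  next
    show "f x \<in> {0..1}" if "x \<in> X" for x
      using continuous_map_image_subset_topspace[OF f(1)] that by (auto simp: top)
    show "f b = 0" "f b' = 1" using f(2,3) S_refl[OF b(1)] S_refl[OF b(2)] by blast+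
    show "f x = f y" if xy: "(x, y) \<in> S" for x y
    proof (rule ccontr)
      assume "f x \<noteq> f y"
      moreover have "sat {z \<in> X. f z \<in> - {f y}}" by (rule pre) auto
      moreover have "x \<in> X" using xy S_sub by auto
      ultimately have "y \<in> {z \<in> X. f z \<in> - {f y}}" using xy by (auto simp: sat_def)
      then show False by simp
    qed
  qed
qed

section \<open>Equicontinuity modulo \<open>S\<close>\<close>

context incontractible_ellis
begin

text \<open>Otherwise some \<open>y n\<close> tend to \<open>z\<close> while \<open>g n\<close>
  keeps the \<open>f\<close>-values apart, the images converging to \<open>b\<close> and
  \<open>b'\<close>. For each \<open>L\<close> both limits are reached through \<open>EL L\<close>
  from one point \<open>act k z\<close>, so \<open>b\<close> and \<open>b'\<close> are equivalent
  under \<open>S\<close> and \<open>f\<close> cannot distinguish them.\<close>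

lemma S_equicontinuous:
  fixes f :: "'x \<Rightarrow> real"
  assumes f: "continuous_on X f" "\<And>x y. (x, y) \<in> S \<Longrightarrow> f x = f y" and z: "z \<in> X" and e: "e > 0"
  obtains W where "oin X W" "z \<in> W" "\<And>y g. y \<in> W \<Longrightarrow> \<bar>f (act g z) - f (act g y)\<bar> < e"
proof (rule ccontr)
  assume neg: "\<not> thesis"
  have "\<exists>y g. y \<in> X \<and> dist z y < 1 / real (Suc n) \<and> e \<le> \<bar>f (act g z) - f (act g y)\<bar>" for n
  proof (rule ccontr)
    assume *: "\<not> ?thesis"
    have "oin X (X \<inter> ball z (1 / real (Suc n)))" by (simp add: openin_open_Int)
    moreover have "z \<in> X \<inter> ball z (1 / real (Suc n))" using z by simp
    moreover have "\<bar>f (act g z) - f (act g y)\<bar> < e" if "y \<in> X \<inter> ball z (1 / real (Suc n))" for y g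
      using * that by (force simp: not_le)
    ultimately show False using neg that by blast
  qed
  then obtain y g where yg: "\<And>n. y n \<in> X" "\<And>n. dist z (y n) < 1 / real (Suc n)"
    "\<And>n. e \<le> \<bar>f (act (g n) z) - f (act (g n) (y n))\<bar>" by metis
  define w where "w n = (act (g n) z, act (g n) (y n))" for n
  have "w n \<in> X \<times> X" for n using z yg by (auto simp: w_def)
  then obtain p r where p: "p \<in> X \<times> X" "strict_mono r" "(w \<circ> r) \<longlonglongrightarrow> p"
    using compact_Times[OF compact_X compact_X] unfolding compact_def by metis
  obtain b b' where bb: "p = (b, b')" "b \<in> X" "b' \<in> X" using p by auto
  have ylim: "y \<longlonglongrightarrow> z"
  proof (rule metric_LIMSEQ_I)
    fix \<epsilon> :: real assume "\<epsilon> > 0"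
    then obtain N where N: "1 / real (Suc N) < \<epsilon>" using nat_approx_posE by blast
    have "dist (y n) z < \<epsilon>" if "n \<ge> N" for n
    proof -
      have "1 / real (Suc n) \<le> 1 / real (Suc N)" using that by (intro divide_left_mono) auto
      then show ?thesis using yg(2)[of n] N by (simp add: dist_commute)
    qed
    then show "\<exists>no. \<forall>n\<ge>no. dist (y n) z < \<epsilon>" by blast
  qed
  have "\<exists>x\<in>X. (x, b) \<in> EL L \<and> (x, b') \<in> EL L" if L: "good L" for L
  proof -
    obtain F where F: "finite F" "\<And>g. \<exists>k\<in>F. g + - k \<in> ret act L" using ret_syndetic[OF L] by blast
    \<comment> \<open>A single \<open>k\<close> works for infinitely many \<open>n\<close>, so that
      along a subsequence all \<open>g (r n)\<close> factor through the same
      \<open>k\<close>.\<close>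
    have "\<exists>k\<in>F. \<not> finite {n \<in> (UNIV :: nat set). g (r n) + - k \<in> ret act L}"
      using F by (intro pigeonhole_infinite_rel) auto
    then obtain k where k: "infinite {n. g (r n) + - k \<in> ret act L}" by auto
    define s where "s = enumerate {n. g (r n) + - k \<in> ret act L}"
    have s: "strict_mono s" "\<And>n. g (r (s n)) + - k \<in> ret act L"
      using strict_mono_enumerate[OF k] enumerate_in_set[OF k] by (auto simp: s_def)
    have wlim: "(\<lambda>n. w (r (s n))) \<longlonglongrightarrow> p"
      using LIMSEQ_subseq_LIMSEQ[OF p(3) s(1)] by (simp add: o_def)
    have yl: "(\<lambda>n. y (r (s n))) \<longlonglongrightarrow> z"
      using LIMSEQ_subseq_LIMSEQ[OF LIMSEQ_subseq_LIMSEQ[OF ylim p(2)] s(1)] by (simp add: o_def)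
    have E: "(act k x, act (g (r (s n))) x) \<in> EL L" if "x \<in> X" for x n
      using EL_graph[OF s(2)[of n], of "act k x"] that by (simp add: act_add[symmetric] add.assoc)
    have l1: "(\<lambda>n. (act k z, act (g (r (s n))) z)) \<longlonglongrightarrow> (act k z, b)"
      using tendsto_fst[OF wlim] by (intro tendsto_Pair tendsto_const) (simp add: w_def bb)
    have "(\<lambda>n. act k (y (r (s n)))) \<longlonglongrightarrow> act k z"
      using yl yg(1) z act_cont[of k] by (auto intro: continuous_on_tendsto_compose)
    then have l2: "(\<lambda>n. (act k (y (r (s n))), act (g (r (s n))) (y (r (s n))))) \<longlonglongrightarrow> (act k z, b')"
      using tendsto_snd[OF wlim] by (intro tendsto_Pair) (simp_all add: w_def bb)
    have "(act k z, b) \<in> EL L"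
      by (rule closed_sequentially[OF EL_closed _ l1]) (use E z in auto)
    moreover have "(act k z, b') \<in> EL L"
      by (rule closed_sequentially[OF EL_closed _ l2]) (use E yg in auto)
    ultimately show ?thesis using z by blast
  qed
  then obtain x where "(x, b) \<in> Q" "(x, b') \<in> Q" using EL_common_point[of b b'] bb by blast
  then have "f b = f b'" by (intro f(2) Q_Q_S)
  moreover have "(\<lambda>n. \<bar>f (act (g (r n)) z) - f (act (g (r n)) (y (r n)))\<bar>) \<longlonglongrightarrow> \<bar>f b - f b'\<bar>"
  proof -
    have wl: "(\<lambda>n. w (r n)) \<longlonglongrightarrow> p" using p(3) by (simp add: o_def)
    have "(\<lambda>n. f (act (g (r n)) z)) \<longlonglongrightarrow> f b"
      using tendsto_fst[OF wl] z bb by (intro continuous_on_tendsto_compose[OF f(1)]) (auto simp: w_def)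
    moreover have "(\<lambda>n. f (act (g (r n)) (y (r n)))) \<longlonglongrightarrow> f b'"
      using tendsto_snd[OF wl] yg bb by (intro continuous_on_tendsto_compose[OF f(1)]) (auto simp: w_def)
    ultimately show ?thesis by (intro tendsto_intros)
  qed
  then have "e \<le> \<bar>f b - f b'\<bar>" by (rule LIMSEQ_le_const) (use yg(3) in auto)
  ultimately show False using e by simp
qed

lemma ret_infinite_incontractible:
  assumes "infinite (UNIV :: 'g set)" "good L"
  shows "infinite (ret act L)"
proof
  assume fin: "finite (ret act L)"
  obtain F where F: "finite F" "\<And>g. \<exists>k\<in>F. g + - k \<in> ret act L" using ret_syndetic[OF assms(2)] by blast
  have "g \<in> (\<lambda>(r, k). r + k) ` (ret act L \<times> F)" for g
  proof -
    obtain k where "k \<in> F" "g + - k \<in> ret act L" using F by blast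
    moreover have "g = (g + - k) + k" by (simp add: add.assoc)
    ultimately show ?thesis by (metis (no_types, lifting) SigmaI case_prod_conv image_eqI)
  qed
  then have "UNIV \<subseteq> (\<lambda>(r, k). r + k) ` (ret act L \<times> F)" by blast
  then show False using fin F(1) assms(1) by (meson finite_SigmaI finite_imageI finite_subset)
qed

end

section \<open>Relative transitivity of powers\<close>

context meq_factor
begin

text \<open>A function separating two classes of \<open>S\<close> gives the invariant pseudometric
  of maximal \<open>f\<close>-distance along orbits. By \<open>S_equicontinuous\<close> it is
  continuous, so it vanishes on fibres; but it is at least 1 on a separated pair.\<close>

lemma fibres_in_S:
  assumes "incontractible_ellis X act M" and b: "b \<in> X" "b' \<in> X" "\<pi> b = \<pi> b'"
  shows "(b, b') \<in> incontractible_ellis.S X act"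
proof (rule ccontr)
  interpret incontractible_ellis X act M by fact
  assume "(b, b') \<notin> S"
  then obtain f :: "'x \<Rightarrow> real" where f: "continuous_on X f" "\<And>x. x \<in> X \<Longrightarrow> f x \<in> {0..1}" "f b = 0" "f b' = 1"
    "\<And>x y. (x, y) \<in> S \<Longrightarrow> f x = f y"
    using closed_equivalence_separation[OF X.compact_X S_equiv S_compact b(1,2)] by blast
  define D where "D x y g = \<bar>f (act g x) - f (act g y)\<bar>" for x y g
  define d where "d x y = (SUP g. D x y g)" for x y
  have le1: "D x y g \<le> 1" if "x \<in> X" "y \<in> X" for x y g
    using f(2)[of "act g x"] f(2)[of "act g y"] that by (auto simp: D_def abs_le_iff)
  then have bdd: "bdd_above (range (D x y))" if "x \<in> X" "y \<in> X" for x y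
    using that by (intro bdd_aboveI[of _ 1]) auto
  have Dd: "D x y g \<le> d x y" if "x \<in> X" "y \<in> X" for x y g
    unfolding d_def using bdd[OF that] by (intro cSUP_upper) auto
  have dD: "d x y \<le> c" if "\<And>g. D x y g \<le> c" for x y c
    unfolding d_def using that by (intro cSUP_least) auto
  have "d b b' = 0"
  proof (rule invariant_pseudometric_on_fibres[OF _ _ _ _ _ b])
    show "d x x = 0" for x by (simp add: d_def D_def)
    show "d x y = d y x" for x y by (simp add: d_def D_def abs_minus_commute)
    show "d x z \<le> d x y + d y z" if "x \<in> X" "y \<in> X" "z \<in> X" for x y z
    proof (rule dD)
      fix g
      have "D x z g \<le> D x y g + D y z g" by (simp add: D_def)
      then show "D x z g \<le> d x y + d y z" using Dd[of x y g] Dd[of y z g] that by linarith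
    qed
    show "d (act g x) (act g y) = d x y" if "x \<in> X" "y \<in> X" for g x y
    proof -
      have "range (D (act g x) (act g y)) = range (D x y)"
      proof -
        have e: "D (act g x) (act g y) h = D x y (h + g)" for h
          using that by (simp add: D_def X.act_add)
        have "D x y h \<in> range (D (act g x) (act g y))" for h
          using e[of "h - g"] by (intro image_eqI[of _ _ "h - g"]) auto
        then show ?thesis using e by (intro equalityI image_subsetI) auto
      qed
      then show ?thesis by (simp add: d_def)
    qed
    show "\<exists>W. oin X W \<and> x \<in> W \<and> (\<forall>y\<in>W. d x y < e)" if x: "x \<in> X" and e: "e > 0" for x e
    proof -
      obtain W where W: "oin X W" "x \<in> W" "\<And>y g. y \<in> W \<Longrightarrow> \<bar>f (act g x) - f (act g y)\<bar> < e / 2"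
        using S_equicontinuous[OF f(1,5) x, of "e / 2"] e by auto
      have "d x y \<le> e / 2" if "y \<in> W" for y
        using W(3)[OF that] by (intro dD) (auto simp: D_def intro: less_imp_le)
      then show ?thesis using W(1,2) e by (intro exI[of _ W]) force
    qed
  qed
  moreover have "1 \<le> d b b'" using Dd[of b b' 0] b f by (simp add: D_def)
  ultimately show False by simp
qed

text \<open>An idempotent \<open>v\<close> fixes some \<open>w\<close> in \<open>W\<close> over
  \<open>G\<close> and a point in each member of \<open>L\<close>. A point \<open>u0\<close> of
  \<open>U\<close> over \<open>\<pi> w\<close> satisfies \<open>(w, v u0) \<in> Q\<close>, but
  \<open>v u0\<close> may be far from \<open>U\<close>. Hence both \<open>W\<close> and
  \<open>U\<close> are sent into a common open set \<open>T\<close>, and one passage is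
  reversed.\<close>

lemma hit_ret_incontractible:
  assumes inc: "incontractible X act"
    and W: "oin X W" "w0 \<in> W" and G: "oin Y G" "\<pi> w0 \<in> G" and U: "oin X U" "G \<subseteq> \<pi> ` U"
    and L: "X.good L"
  shows "hit act W U \<inter> ret act L \<noteq> {}"
proof -
  obtain M where M: "X.min_left_ideal M" using X.min_left_ideal_ex by blast
  have "incontractible_ellis X act M"
    using M inc by unfold_locales
  then interpret E: incontractible_ellis X act M .
  define W1 where "W1 = W \<inter> {x \<in> X. \<pi> x \<in> G}"
  have W1: "oin X W1" unfolding W1_def using W G by (intro openin_Int open_pi_pre)
  have "w0 \<in> W1" using W G openin_imp_subset by (auto simp: W1_def)
  then have "X.good (insert W1 L)" using L W1 by (auto simp: X.good_def)
  then obtain v where v: "v \<in> M" "v \<circ> v = v" "\<And>A. A \<in> insert W1 L \<Longrightarrow> \<exists>p\<in>A. v p = p"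
    using E.idempotent_with_fixed_points by blast
  obtain w where w: "w \<in> W1" "v w = w" using v(3)[of W1] by auto
  have "\<forall>A\<in>L. \<exists>p\<in>A. v p = p" using v(3) by blast
  then obtain p where p: "\<And>A. A \<in> L \<Longrightarrow> p A \<in> A \<and> v (p A) = p A" by metis
  have wX: "w \<in> X" using w by (simp add: W1_def)
  obtain u0 where u0: "u0 \<in> U" "\<pi> u0 = \<pi> w" using w U by (force simp: W1_def)
  have u0X: "u0 \<in> X" using u0 U openin_imp_subset by blast
  define a where "a = v u0"
  have a: "a \<in> X" using u0X v by (auto simp: a_def)
  have "(w, u0) \<in> E.S"
    using fibres_in_S[OF E.incontractible_ellis_axioms wX u0X] u0 by simp
  then have wa: "(w, a) \<in> X.Q" using E.S_iff[OF v(1,2)] w by (simp add: a_def)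
  define S where "S = insert (w, W) ((\<lambda>A. (p A, A)) ` L)"
  have fS: "finite S" using L by (simp add: S_def X.good_def)
  have SS: "v x = x \<and> x \<in> A \<and> oin X A" if "(x, A) \<in> S" for x A
    using that w W p L by (auto simp: S_def X.good_def W1_def)
  have "\<exists>T. oin X T \<and> T \<noteq> {} \<and> (\<forall>t\<in>T. \<exists>q\<in>M. q a = t \<and> (\<forall>(x, A)\<in>S. q x \<in> A))"
    by (rule E.fixed_open_interior[OF v(1,2) fS SS a]) blast+
  then obtain T where T: "oin X T" "T \<noteq> {}" "\<And>t. t \<in> T \<Longrightarrow> \<exists>q\<in>M. q a = t \<and> (\<forall>(x, A)\<in>S. q x \<in> A)"
    by (elim exE conjE) simp
  obtain t0 where "t0 \<in> T" using T(2) by blast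
  with T(3) obtain q where q0: "q \<in> M" "q a = t0" "\<forall>(x, A)\<in>S. q x \<in> A" by meson
  then have q: "q \<in> M" "q a \<in> T" "\<And>A. A \<in> L \<Longrightarrow> q (p A) \<in> A"
    using \<open>t0 \<in> T\<close> by (auto simp: S_def)
  \<comment> \<open>\<open>q \<circ> v\<close> sends \<open>u0\<close> to \<open>q a\<close>, a
    point of \<open>T\<close>, and each \<open>p A\<close> back into \<open>A\<close>. A group
    element \<open>g\<close> approximating it carries part of \<open>U\<close> into \<open>T\<close>
    and returns \<open>L\<close>.\<close>
  have "q \<circ> v \<in> X.env" using X.env_comp E.M_env q v by blast
  moreover have "finite (insert (u0, T) ((\<lambda>A. (p A, A)) ` L))" using L by (simp add: X.good_def)
  moreover have "x \<in> X \<and> oin X A \<and> (q \<circ> v) x \<in> A" if "(x, A) \<in> insert (u0, T) ((\<lambda>A. (p A, A)) ` L)" for x A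
    using that u0X T(1) q p L X.good_sub[OF L] by (fastforce simp: a_def X.good_def)
  ultimately obtain g where g: "\<And>x A. (x, A) \<in> insert (u0, T) ((\<lambda>A. (p A, A)) ` L) \<Longrightarrow> act g x \<in> A"
    using X.env_approx[of "q \<circ> v" "insert (u0, T) ((\<lambda>A. (p A, A)) ` L)"] by blast
  have gL: "g \<in> ret act L" unfolding ret_def
  proof (intro CollectI ballI)
    fix A assume "A \<in> L"
    then show "g \<in> hit act A A" using g[of "p A" A] p by (intro hitI[of "p A"]) auto
  qed
  define T1 where "T1 = T \<inter> act g ` U"
  have T1: "oin X T1" "T1 \<noteq> {}"
    using T(1) U(1) X.open_image g[of u0 T] u0 by (auto simp: T1_def)
  then obtain t where t: "t \<in> T1" by auto
  then obtain q1 where q1: "q1 \<in> M" "q1 a = t" "q1 w \<in> W" using T(3)[of t] by (auto simp: T1_def S_def)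
  have "(q1 w, t) \<in> X.Q" using E.Q_env[OF E.M_env[OF q1(1)] wa] q1 by simp
  then obtain h where h: "h \<in> hit act W T1" "h \<in> ret act (X.return_step g L)"
    using X.ELD[OF X.Q_EL[OF _ X.good_return_step[OF L gL]] W(1) T1(1) q1(3) t] by metis
  obtain x u where x: "x \<in> W" "u \<in> U" "act h x = act g u"
    using h(1) by (auto simp: hit_def T1_def)
  have "x \<in> X" "u \<in> X" using x W(1) U(1) openin_imp_subset by blast+
  then have "act (- g + h) x = u" using x(3) by (simp add: X.act_add)
  then have "- g + h \<in> hit act W U" using x by (intro hitI[of x]) auto
  then show ?thesis using X.ret_step_diff[OF L h(2)] by blast
qed

lemma hit_ret:
  assumes star: "property_star X act"
    and W: "oin X W" "w0 \<in> W" and G: "oin Y G" "\<pi> w0 \<in> G" and U: "oin X U" "G \<subseteq> \<pi> ` U"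
    and L: "X.good L"
  shows "hit act W U \<inter> ret act L \<noteq> {}"
  using star unfolding property_star_def
proof (elim disjE conjE exE)
  assume "incontractible X act"
  then show ?thesis by (rule hit_ret_incontractible) fact+
next
  fix \<mu> assume inv: "invariant_prob_measure X act \<mu>"
  obtain z' where z': "z' \<in> U" "\<pi> w0 = \<pi> z'" using G U by auto
  have "z' \<in> X" using z' U openin_imp_subset by blast
  then show ?thesis
    using hit_ret_measure[OF inv W z'(1) _ z'(2), of L] L by (auto simp: X.good_def)
qed

lemma ret_infinite:
  assumes star: "property_star X act" and inf: "infinite (UNIV :: 'g set)" and L: "X.good L"
  shows "infinite (ret act L)"
  using star unfolding property_star_def
proof (elim disjE conjE exE)
  assume inc: "incontractible X act"
  obtain M where M: "X.min_left_ideal M" using X.min_left_ideal_ex by blast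
  then interpret E: incontractible_ellis X act M using inc by unfold_locales
  show ?thesis by (rule E.ret_infinite_incontractible[OF inf L])
next
  fix \<mu> assume inv: "invariant_prob_measure X act \<mu>"
  interpret M: inv_measure X act \<mu> by unfold_locales (rule inv)
  show ?thesis using L by (intro M.ret_infinite inf) (auto simp: X.good_def)
qed

text \<open>Induction over the pairs. First \<open>g\<close> handles the pair \<open>j0\<close> and
  returns \<open>L\<close> and all remaining \<open>U j\<close>; then \<open>h\<close> handles the
  remaining pairs with targets shrunk to the points that \<open>g\<close> keeps in
  \<open>U j\<close>. The sum \<open>g + h\<close> does everything, and shrinking the
  \<open>U j\<close> preserves the inclusion of images in \<open>Y\<close>.\<close>

lemma hit_family:
  assumes star: "property_star X act"
    and "finite J" "\<And>j. j \<in> J \<Longrightarrow> oin X (W j) \<and> oin X (U j) \<and> U j \<noteq> {} \<and> \<pi> ` U j \<subseteq> \<pi> ` W j"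
    and "X.good L"
  shows "\<exists>g\<in>ret act L. \<forall>j\<in>J. g \<in> hit act (W j) (U j)"
  using assms(2-)
proof (induction J arbitrary: U L rule: finite_induct)
  case empty
  obtain w0 where w0: "w0 \<in> X" using X.X_ne by auto
  then have "hit act X X \<inter> ret act L \<noteq> {}"
    using pi_image by (intro hit_ret[OF star _ w0, where G = Y]) (auto simp: empty)
  then show ?case by blast
next
  case (insert j0 J)
  note P = insert.prems(1)
  have UX: "U j \<subseteq> X" "W j \<subseteq> X" if "j \<in> insert j0 J" for j using P[OF that] openin_imp_subset by blast+
  obtain G where G: "oin Y G" "G \<noteq> {}" "G \<subseteq> \<pi> ` U j0" using semi_open[of "U j0"] P[of j0] by auto
  then obtain y where "y \<in> G" by blast
  moreover have "\<pi> ` U j0 \<subseteq> \<pi> ` W j0" using P[of j0] by simp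
  ultimately have "y \<in> \<pi> ` W j0" using G(3) by blast
  then obtain w0 where w0: "w0 \<in> W j0" "\<pi> w0 \<in> G" using \<open>y \<in> G\<close> by auto
  define L' where "L' = L \<union> U ` J"
  have "X.good L'" using insert.prems insert.hyps by (auto simp: L'_def X.good_def)
  then have "hit act (W j0) (U j0) \<inter> ret act L' \<noteq> {}"
    using P[of j0] w0 G by (intro hit_ret[OF star _ w0(1) G(1) w0(2)]) auto
  then obtain g where g: "g \<in> hit act (W j0) (U j0)" "g \<in> ret act L'" by blast
  define pre where "pre A B = A \<inter> {x \<in> X. act g x \<in> B}" for A B
  have pre: "oin X (pre A B)" if "oin X A" "oin X B" for A B
    unfolding pre_def using that by (intro openin_Int X.open_pre)
  have pre_ne: "pre A B \<noteq> {}" if "g \<in> hit act A B" "A \<subseteq> X" for A B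
    using that by (auto simp: hit_def pre_def)
  \<comment> \<open>The pair \<open>j0\<close> has become a return condition: if \<open>h\<close>
    returns the points of \<open>W j0\<close> that \<open>g\<close> sends to \<open>U j0\<close>,
    then \<open>g + h\<close> goes from \<open>W j0\<close> to \<open>U j0\<close>.\<close>
  define L'' where "L'' = insert (pre (W j0) (U j0)) ((\<lambda>A. pre A A) ` L)"
  have LL: "oin X A" "A \<subseteq> X" "g \<in> hit act A A" if "A \<in> L" for A
    using that insert.prems(2) X.good_sub[OF insert.prems(2) that] g(2)
    by (auto simp: X.good_def L'_def ret_def)
  have "X.good L''"
    unfolding X.good_def
  proof (intro conjI ballI)
    show "finite L''" using insert.prems(2) by (simp add: L''_def X.good_def)
    fix A assume "A \<in> L''"
    then consider "A = pre (W j0) (U j0)" | B where "B \<in> L" "A = pre B B" by (auto simp: L''_def)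
    then show "oin X A" "A \<noteq> {}"
      using pre pre_ne P[of j0] UX[of j0] g(1) LL by (cases; simp)+
  qed
  moreover have "oin X (W j) \<and> oin X (pre (U j) (U j)) \<and> pre (U j) (U j) \<noteq> {} \<and> \<pi> ` pre (U j) (U j) \<subseteq> \<pi> ` W j"
    if j: "j \<in> J" for j
  proof -
    have "g \<in> hit act (U j) (U j)" using g(2) j by (auto simp: ret_def L'_def)
    moreover have "pre (U j) (U j) \<subseteq> U j" by (auto simp: pre_def)
    ultimately show ?thesis using P[of j] j pre pre_ne UX[of j] by blast
  qed
  ultimately obtain h where h: "h \<in> ret act L''" "\<forall>j\<in>J. h \<in> hit act (W j) (pre (U j) (U j))"
    using insert.IH[of "\<lambda>j. pre (U j) (U j)" L''] by blast
  have lift: "g + h \<in> hit act A B" if A: "h \<in> hit act A (pre C B)" "A \<subseteq> X" for A B C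
  proof -
    obtain x where x: "x \<in> A" "act g (act h x) \<in> B" using A(1) by (auto simp: hit_def pre_def)
    then have "act (g + h) x = act g (act h x)" using A(2) by (intro X.act_add) auto
    then show ?thesis using x by (intro hitI[of x]) auto
  qed
  have sub: "h \<in> hit act A C" if "h \<in> hit act (pre A B) C" for A B C
    using that by (auto simp: hit_def pre_def)
  have "g + h \<in> hit act (W j) (U j)" if "j \<in> insert j0 J" for j
  proof (cases "j = j0")
    case True
    have "h \<in> hit act (pre (W j0) (U j0)) (pre (W j0) (U j0))"
      using h(1) by (auto simp: ret_def L''_def)
    then show ?thesis using lift[OF sub] UX(2)[of j0] True by blast
  next
    case False
    then show ?thesis using h(2) lift UX(2) that by blast
  qed
  moreover have "g + h \<in> hit act A A" if A: "A \<in> L" for A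
  proof -
    have "h \<in> hit act (pre A A) (pre A A)" using h(1) A by (auto simp: ret_def L''_def)
    then show ?thesis using lift[OF sub] LL(2)[OF A] by blast
  qed
  ultimately show ?case by (auto simp: ret_def)
qed

text \<open>From one simultaneous time \<open>g\<close>, every return time \<open>k\<close> of the
  family of sets \<open>U j\<close> cut down to points reached by \<open>g\<close> gives a further
  time \<open>k + g\<close>.\<close>

lemma hit_family_infinite:
  assumes star: "property_star X act" and inf: "infinite (UNIV :: 'g set)"
    and J: "finite J" "\<And>j. j \<in> J \<Longrightarrow> oin X (W j) \<and> oin X (U j) \<and> U j \<noteq> {} \<and> \<pi> ` U j \<subseteq> \<pi> ` W j"
  shows "infinite {g. \<forall>j\<in>J. g \<in> hit act (W j) (U j)}"
proof
  assume fin: "finite {g. \<forall>j\<in>J. g \<in> hit act (W j) (U j)}"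
  have "\<exists>g\<in>ret act {}. \<forall>j\<in>J. g \<in> hit act (W j) (U j)"
    by (rule hit_family[OF star J(1)]) (simp_all add: J(2) X.good_def)
  then obtain g where g: "\<forall>j\<in>J. g \<in> hit act (W j) (U j)" by (elim bexE)
  define L where "L = (\<lambda>j. U j \<inter> act g ` W j) ` J"
  have "U j \<inter> act g ` W j \<noteq> {}" if "j \<in> J" for j using g that by (auto simp: hit_def)
  then have "X.good L"
    using J by (auto simp: L_def X.good_def intro!: openin_Int X.open_image)
  then have "infinite (ret act L)" by (rule ret_infinite[OF star inf])
  moreover have "(\<lambda>k. k + g) ` ret act L \<subseteq> {g. \<forall>j\<in>J. g \<in> hit act (W j) (U j)}"
  proof (intro image_subsetI CollectI ballI)
    fix k j assume k: "k \<in> ret act L" and j: "j \<in> J"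
    then have "k \<in> hit act (U j \<inter> act g ` W j) (U j \<inter> act g ` W j)" by (auto simp: ret_def L_def)
    then obtain x where x: "x \<in> W j" "act k (act g x) \<in> U j" by (auto simp: hit_def)
    have "W j \<subseteq> X" using J(2)[OF j] openin_imp_subset by blast
    then have "act (k + g) x = act k (act g x)" using x by (intro X.act_add) auto
    then show "k + g \<in> hit act (W j) (U j)" using x by (intro hitI[of x]) auto
  qed
  ultimately show False using fin by (metis (no_types, lifting) add_right_imp_eq finite_imageD finite_subset inj_onI)
qed

end

section \<open>Independence\<close>

text \<open>The suprema in \<open>hausdorff_dist\<close> are real-valued, so boundedness of
  \<open>X\<close> is what makes them upper bounds.\<close>

lemma infdist_le_hausdorff_dist:
  fixes X :: "'x::metric_space set"
  assumes X: "bounded X" and AB: "A \<subseteq> X" "B \<subseteq> X" "A \<noteq> {}" "B \<noteq> {}"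
  shows "a \<in> A \<Longrightarrow> infdist a B \<le> hausdorff_dist A B"
    and "b \<in> B \<Longrightarrow> infdist b A \<le> hausdorff_dist A B"
proof -
  have bdd: "bdd_above ((\<lambda>a. infdist a B) ` A)" if sub: "A \<subseteq> X" "B \<subseteq> X" "B \<noteq> {}" for A B
  proof -
    obtain b where b: "b \<in> B" using sub(3) by blast
    have "infdist a B \<le> diameter X" if a: "a \<in> A" for a
    proof -
      have "a \<in> X" "b \<in> X" using a b sub by auto
      then show ?thesis using infdist_le[OF b, of a] diameter_bounded_bound[OF X, of a b] by linarith
    qed
    then show ?thesis by (intro bdd_aboveI2)
  qed
  show "a \<in> A \<Longrightarrow> infdist a B \<le> hausdorff_dist A B"
    unfolding hausdorff_dist_def using bdd[OF AB(1,2,4)]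
    by (intro max.coboundedI1 cSUP_upper)
  show "b \<in> B \<Longrightarrow> infdist b A \<le> hausdorff_dist A B"
    unfolding hausdorff_dist_def using bdd[OF AB(2,1,3)]
    by (intro max.coboundedI2 cSUP_upper)
qed

lemma infdist_lessE:
  assumes "infdist x A < e" "A \<noteq> {}"
  obtains a where "a \<in> A" "dist x a < e"
  using assms by (auto simp: infdist_notempty cINF_less_iff)

section \<open>Limits of fibres\<close>

context factor
begin

text \<open>A fibre close to \<open>F\<close> forces all of the image of \<open>F\<close> near one
  point of \<open>Y\<close>, by uniform continuity. Thus the choice of a point in \<open>piX\<close>
  is immaterial on \<open>calX\<close>.\<close>

lemma calX_single_fibre:
  assumes F: "F \<in> calX X Y \<pi>" and ab: "a \<in> F" "b \<in> F"
  shows "\<pi> a = \<pi> b"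
proof (rule ccontr)
  assume "\<pi> a \<noteq> \<pi> b"
  define e where "e = dist (\<pi> a) (\<pi> b) / 2"
  have "e > 0" using \<open>\<pi> a \<noteq> \<pi> b\<close> by (simp add: e_def)
  have "uniformly_continuous_on X \<pi>"
    using compact_uniformly_continuous[OF pi_cont X.compact_X] .
  then obtain \<delta> where \<delta>: "\<delta> > 0" "\<forall>x\<in>X. \<forall>x'\<in>X. dist x' x < \<delta> \<longrightarrow> dist (\<pi> x') (\<pi> x) < e"
    using \<open>e > 0\<close> unfolding uniformly_continuous_on_def by meson
  obtain y where y: "y \<in> Y" "hausdorff_dist (fiber X \<pi> y) F < \<delta>"
    using F \<delta>(1) by (auto simp: calX_def)
  have ne: "fiber X \<pi> y \<noteq> {}" and sub: "fiber X \<pi> y \<subseteq> X" 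
    using y pi_image by (auto simp: fiber_def)
  have FX: "F \<subseteq> X" "F \<noteq> {}" using F by (auto simp: calX_def)
  have "dist (\<pi> c) y < e" if c: "c \<in> F" for c
  proof -
    have "infdist c (fiber X \<pi> y) < \<delta>"
      using infdist_le_hausdorff_dist(2)[OF compact_imp_bounded[OF X.compact_X] sub FX(1) ne FX(2) c] y by simp
    then obtain x where "x \<in> fiber X \<pi> y" "dist c x < \<delta>" using infdist_lessE ne by blast
    then show ?thesis using \<delta>(2) FX(1) c by (auto simp: fiber_def)
  qed
  from this[OF ab(1)] this[OF ab(2)] have "dist (\<pi> a) (\<pi> b) < 2 * e"
    using dist_triangle2[of "\<pi> a" "\<pi> b" y] by linarith
  then show False by (simp add: e_def)
qed

end

section \<open>Construction of an independence set\<close>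

locale star_system = meq_factor X act Y actY \<pi> + N: inv_measure Y actY \<nu>
  for X :: "'x::metric_space set" and act :: "'g::{group_add, countable} \<Rightarrow> 'x \<Rightarrow> 'x"
    and Y :: "'y::metric_space set" and actY \<pi> \<nu> +
  assumes star: "property_star X act" and inf_G: "infinite (UNIV :: 'g set)"
begin

lemma equicont_Y: "equicontinuous Y actY"
  using meq by (simp add: max_equicontinuous_factor_def)

text \<open>Dependent choice adds one new time per stage. The tolerances \<open>\<delta>\<close> are
  fixed at the start from \<open>A\<close> alone, so at every stage the whole finite tree can again
  be translated towards \<open>A\<close>, where every \<open>U k\<close> has a point over each base
  point.\<close>

lemma independence:
  fixes U :: "nat \<Rightarrow> 'x set"
  assumes K: "K > 0" and U: "\<And>k. k < K \<Longrightarrow> oin X (U k)"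
    and A: "closed A" "A \<subseteq> Y" "measure \<nu> A > 0" "\<And>k. k < K \<Longrightarrow> A \<subseteq> \<pi> ` U k"
  shows "\<exists>J. infinite J \<and> (\<forall>I \<sigma>. I \<subseteq> J \<and> finite I \<and> (\<forall>g\<in>I. \<sigma> g < K)
    \<longrightarrow> (\<exists>x\<in>X. \<forall>g\<in>I. act g x \<in> U (\<sigma> g)))"
proof -
  have "\<exists>d>0. measure \<nu> {y \<in> Y. infdist y A \<le> 2 * d} < measure \<nu> A + measure \<nu> A / 2 ^ (i + 1)" for i
  proof -
    have "A \<noteq> {}" "0 < measure \<nu> A / 2 ^ (i + 1)" using A(3) by auto
    then obtain d where "d > 0" "measure \<nu> {y \<in> Y. infdist y A \<le> d} < measure \<nu> A + measure \<nu> A / 2 ^ (i + 1)"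
      using N.closed_nbhd_measure[OF A(1,2)] by metis
    then show ?thesis by (intro exI[of _ "d / 2"]) auto
  qed
  then obtain \<delta> :: "nat \<Rightarrow> real" where \<delta>: "\<And>i. \<delta> i > 0"
    "\<And>i. measure \<nu> {y \<in> Y. infdist y A \<le> 2 * \<delta> i} < measure \<nu> A + measure \<nu> A / 2 ^ (i + 1)"
    by metis
  \<comment> \<open>The invariant \<open>P G\<close> has three components: open sets realizing every
    word on \<open>G\<close>, a chained sequence of base points, and for each open set a base point
    in the interior of its image.\<close>
  define realizes where "realizes G \<W> \<longleftrightarrow>
    (\<forall>\<sigma>. (\<forall>g\<in>G. \<sigma> g < K) \<longrightarrow> (\<exists>W\<in>\<W>. \<forall>g\<in>G. act g ` W \<subseteq> U (\<sigma> g)))" for G \<W>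
  \<comment> \<open>The tree is listed with parents before children and index 0 as root. Closeness
    to the parent is measured by the position in the list.\<close>
  define chained where "chained t n \<longleftrightarrow> (\<forall>i<n. t i \<in> Y) \<and>
    (\<forall>i. 0 < i \<longrightarrow> i < n \<longrightarrow> (\<exists>j<i. near actY (\<delta> i) (t i) (t j)))" for t and n :: nat
  define marked where "marked t n W \<longleftrightarrow> oin X W \<and> W \<noteq> {} \<and>
    (\<exists>i<n. \<exists>V. oin Y V \<and> t i \<in> V \<and> V \<subseteq> \<pi> ` W)" for t and n :: nat and W
  define P where "P G \<longleftrightarrow> finite G \<and> (\<exists>\<W> t n. finite \<W> \<and> realizes G \<W> \<and> chained t n \<and> (\<forall>W\<in>\<W>. marked t n W))" for G
  have P0: "P {}"
  proof -
    obtain y where y: "y \<in> Y" using Y.X_ne by auto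
    have "chained (\<lambda>_. y) 1" using y by (simp add: chained_def)
    moreover have "marked (\<lambda>_. y) 1 X" using y pi_image X.X_ne by (auto simp: marked_def intro!: exI[of _ Y])
    moreover have "realizes {} {X}" by (simp add: realizes_def)
    ultimately show ?thesis unfolding P_def by (metis finite.emptyI finite.insertI singletonD)
  qed
  have step: "\<exists>G'. P G' \<and> (\<exists>g. g \<notin> G \<and> G' = insert g G)" if PG: "P G" for G
  proof -
    obtain \<W> t n where G: "finite G" and \<W>: "finite \<W>" "realizes G \<W>" and t: "chained t n"
      and mk: "\<And>W. W \<in> \<W> \<Longrightarrow> marked t n W"
      using PG unfolding P_def by blast
    have tY: "t i \<in> Y" if "i < n" for i using t that by (simp add: chained_def)
    have "\<exists>i V. i < n \<and> oin Y V \<and> t i \<in> V \<and> V \<subseteq> \<pi> ` W" if "W \<in> \<W>" for W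
      using mk[OF that] by (auto simp: marked_def)
    then obtain idx V where iV: "\<And>W. W \<in> \<W> \<Longrightarrow> idx W < n \<and> oin Y (V W) \<and> t (idx W) \<in> V W \<and> V W \<subseteq> \<pi> ` W"
      by metis
    have oW: "oin X W" if "W \<in> \<W>" for W using mk[OF that] by (simp add: marked_def)
    define m where "m = card (\<W> \<times> {..<K})"
    obtain e where e: "bij_betw e {..<m} (\<W> \<times> {..<K})"
      using ex_bij_betw_nat_finite[of "\<W> \<times> {..<K}"] \<W>(1) by (auto simp: m_def atLeast0LessThan)
    \<comment> \<open>New points receive the indices from \<open>n\<close> to
      \<open>n + m - 1\<close>, one for each pair of an old open set and a symbol, so they must
      respect the tolerances at all these indices.\<close>
    define \<epsilon> where "\<epsilon> = Min (insert 1 (\<delta> ` {..<n + m}))"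
    have eps: "\<epsilon> > 0" "\<And>i. i < n + m \<Longrightarrow> \<epsilon> \<le> \<delta> i" using \<delta>(1) by (auto simp: \<epsilon>_def)
    have "\<exists>V'. oin Y V' \<and> t (idx W) \<in> V' \<and> V' \<subseteq> V W \<and> (\<forall>y\<in>V'. near actY \<epsilon> y (t (idx W)))" if W: "W \<in> \<W>" for W
    proof -
      obtain V0 where V0: "oin Y V0" "t (idx W) \<in> V0" "\<And>y. y \<in> V0 \<Longrightarrow> near actY \<epsilon> y (t (idx W))"
        using Y.near_nbhd[OF equicont_Y tY eps(1), of "idx W"] iV[OF W] by blast
      then show ?thesis using iV[OF W] by (intro exI[of _ "V0 \<inter> V W"]) auto
    qed
    then obtain V' where V': "\<And>W. W \<in> \<W> \<Longrightarrow> oin Y (V' W) \<and> t (idx W) \<in> V' W \<and> V' W \<subseteq> V W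
        \<and> (\<forall>y\<in>V' W. near actY \<epsilon> y (t (idx W)))" by metis
    have "\<exists>r>0. Y \<inter> ball (t (idx W)) r \<subseteq> V' W" if W: "W \<in> \<W>" for W
      using V'[OF W] by (metis open_contains_cball_in ball_subset_cball inf_mono order_refl order_trans)
    then obtain r where r: "\<And>W. W \<in> \<W> \<Longrightarrow> r W > 0 \<and> Y \<inter> ball (t (idx W)) (r W) \<subseteq> V' W" by metis
    \<comment> \<open>Below every radius \<open>r W\<close>, so that a point this close to the
      translated tree lies in the translate of \<open>V' W\<close>.\<close>
    define \<epsilon>' where "\<epsilon>' = Min (insert 1 (r ` \<W>))"
    have eps': "\<epsilon>' > 0" "\<And>W. W \<in> \<W> \<Longrightarrow> \<epsilon>' \<le> r W" using r \<W>(1) by (auto simp: \<epsilon>'_def)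
    have "\<exists>j. 0 < i \<longrightarrow> i < n \<longrightarrow> j < i \<and> near actY (\<delta> i) (t i) (t j)" for i
      using t unfolding chained_def by blast
    then obtain p where p: "\<And>i. 0 < i \<Longrightarrow> i < n \<Longrightarrow> p i < i \<and> near actY (\<delta> i) (t i) (t (p i))" by metis
    obtain g0 s where gs: "\<And>i. i < n \<Longrightarrow> s i \<in> A \<and> near actY \<epsilon>' (s i) (actY g0 (t i))"
      using N.approximate_translate_into[OF equicont_Y A(1-3), of n t \<delta> p, OF tY \<delta>(1) \<delta>(2) p eps'(1)] by blast
    have sV: "s (idx W) \<in> actY g0 ` V' W" if W: "W \<in> \<W>" for W
    proof -
      define y where "y = actY (- g0) (s (idx W))"
      have i: "idx W < n" using iV[OF W] by simp
      have sY: "s (idx W) \<in> Y" using gs[OF i] A(2) by auto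
      have "near actY \<epsilon>' y (actY (- g0) (actY g0 (t (idx W))))"
        unfolding y_def using gs[OF i] sY tY[OF i] by (intro Y.near_act) auto
      then have "dist y (t (idx W)) < \<epsilon>'"
        using Y.near_dist[of \<epsilon>' y "t (idx W)"] tY[OF i] sY by (auto simp: y_def)
      then have "y \<in> Y \<inter> ball (t (idx W)) (r W)" using eps'(2)[OF W] sY by (auto simp: y_def dist_commute)
      then have "y \<in> V' W" using r[OF W] by blast
      moreover have "s (idx W) = actY g0 y" using sY by (simp add: y_def)
      ultimately show ?thesis by blast
    qed
    have V'Y: "V' W \<subseteq> Y" if "W \<in> \<W>" for W using V'[OF that] openin_imp_subset by blast
    define B where "B W = W \<inter> {x \<in> X. \<pi> x \<in> V' W}" for W
    have B: "oin X (B W)" "\<pi> ` B W = V' W" if W: "W \<in> \<W>" for W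
    proof -
      show "oin X (B W)" unfolding B_def using oW[OF W] V'[OF W] by (intro openin_Int open_pi_pre) auto
      show "\<pi> ` B W = V' W"
      proof
        show "V' W \<subseteq> \<pi> ` B W"
        proof
          fix y assume y: "y \<in> V' W"
          then obtain x where "x \<in> W" "\<pi> x = y" using V'[OF W] iV[OF W] by blast
          moreover have "x \<in> X" using \<open>x \<in> W\<close> oW[OF W] openin_imp_subset by blast
          ultimately show "y \<in> \<pi> ` B W" using y by (auto simp: B_def)
        qed
      qed (auto simp: B_def)
    qed
    have BX: "B W \<subseteq> X" for W by (auto simp: B_def)
    \<comment> \<open>The sources and targets are compared after translation by \<open>g0\<close>:
      the point \<open>s (idx W)\<close> of \<open>A\<close> has preimages in every
      \<open>U k\<close>, and each target lies over \<open>V' W\<close> translated, which is exactly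
      the image of the source.\<close>
    define H where "H = {h. \<forall>j\<in>\<W> \<times> {..<K}. h \<in> hit act (act g0 ` B (fst j))
        (U (snd j) \<inter> {x \<in> X. \<pi> x \<in> actY g0 ` V' (fst j)})}"
    have "infinite H" unfolding H_def
    proof (rule hit_family_infinite[OF star inf_G])
      show "finite (\<W> \<times> {..<K})" using \<W>(1) by simp
      fix j assume j: "j \<in> \<W> \<times> {..<K}"
      then obtain W k where Wk: "j = (W, k)" "W \<in> \<W>" "k < K" by auto
      have "oin X (act g0 ` B W)" using B(1)[OF Wk(2)] by (rule X.open_image)
      moreover have "oin X (U k \<inter> {x \<in> X. \<pi> x \<in> actY g0 ` V' W})"
        using U[OF Wk(3)] V'[OF Wk(2)] by (intro openin_Int open_pi_pre Y.open_image) auto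
      moreover have "U k \<inter> {x \<in> X. \<pi> x \<in> actY g0 ` V' W} \<noteq> {}"
      proof -
        have "s (idx W) \<in> \<pi> ` U k" using gs iV[OF Wk(2)] A(4)[OF Wk(3)] by blast
        then obtain x where "x \<in> U k" "\<pi> x = s (idx W)" by auto
        moreover have "x \<in> X" using \<open>x \<in> U k\<close> U[OF Wk(3)] openin_imp_subset by blast
        ultimately show ?thesis using sV[OF Wk(2)] by auto
      qed
      moreover have "\<pi> ` (U k \<inter> {x \<in> X. \<pi> x \<in> actY g0 ` V' W}) \<subseteq> \<pi> ` act g0 ` B W"
      proof -
        have "\<pi> ` act g0 ` B W = actY g0 ` \<pi> ` B W"
          using BX by (force simp: image_image intro!: image_cong)
        then show ?thesis using B(2)[OF Wk(2)] by auto
      qed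
      ultimately show "oin X (act g0 ` B (fst j)) \<and> oin X (U (snd j) \<inter> {x \<in> X. \<pi> x \<in> actY g0 ` V' (fst j)})
          \<and> U (snd j) \<inter> {x \<in> X. \<pi> x \<in> actY g0 ` V' (fst j)} \<noteq> {}
          \<and> \<pi> ` (U (snd j) \<inter> {x \<in> X. \<pi> x \<in> actY g0 ` V' (fst j)}) \<subseteq> \<pi> ` act g0 ` B (fst j)"
        using Wk(1) by simp
    qed
    moreover have "finite ((\<lambda>g. g - g0) ` G)" using G by simp
    ultimately have "\<not> H \<subseteq> (\<lambda>g. g - g0) ` G" using finite_subset by blast
    then obtain h where h: "h \<in> H" "h \<notin> (\<lambda>g. g - g0) ` G" by blast
    \<comment> \<open>\<open>g\<close> first translates the tree to \<open>A\<close> by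
      \<open>g0\<close>, then applies the simultaneous time \<open>h\<close>. Avoiding finitely many
      \<open>h\<close> makes \<open>g\<close> new.\<close>
    define g where "g = h + g0"
    have gG: "g \<notin> G"
    proof
      assume "g \<in> G"
      then have "g - g0 \<in> (\<lambda>g. g - g0) ` G" by blast
      then show False using h(2) by (simp add: g_def)
    qed
    define C where "C W k = B W \<inter> {x \<in> X. act g x \<in> U k}" for W k
    have C: "oin X (C W k)" "C W k \<noteq> {}" if W: "W \<in> \<W>" "k < K" for W k
    proof -
      show "oin X (C W k)" unfolding C_def using B(1)[OF W(1)] U[OF W(2)] by (intro openin_Int X.open_pre)
      have "(W, k) \<in> \<W> \<times> {..<K}" using W by simp
      then have "h \<in> hit act (act g0 ` B W) (U k)"
        using h(1) by (force simp: H_def hit_def)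
      then obtain x where x: "x \<in> B W" "act h (act g0 x) \<in> U k" by (auto simp: hit_def)
      have "x \<in> X" using x BX by blast
      then have "act g x = act h (act g0 x)" unfolding g_def by (rule X.act_add)
      then show "C W k \<noteq> {}" using x \<open>x \<in> X\<close> by (auto simp: C_def)
    qed
    have "\<exists>V. oin Y V \<and> V \<noteq> {} \<and> V \<subseteq> \<pi> ` C W k" if "W \<in> \<W>" "k < K" for W k
      using semi_open[OF C[OF that]] by metis
    then obtain V2 where V2: "\<And>W k. W \<in> \<W> \<Longrightarrow> k < K \<Longrightarrow> oin Y (V2 W k) \<and> V2 W k \<noteq> {} \<and> V2 W k \<subseteq> \<pi> ` C W k"
      by metis
    then have "\<exists>y. y \<in> V2 W k" if "W \<in> \<W>" "k < K" for W k using that by blast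
    then obtain y2 where y2: "\<And>W k. W \<in> \<W> \<Longrightarrow> k < K \<Longrightarrow> y2 W k \<in> V2 W k" by metis
    \<comment> \<open>The old list is kept and the new base points are appended; the parent of the
      point for \<open>(W, k)\<close> is the old base point of \<open>W\<close>.\<close>
    define t' where "t' i = (if i < n then t i else y2 (fst (e (i - n))) (snd (e (i - n))))" for i
    define \<W>' where "\<W>' = (\<lambda>(W, k). C W k) ` (\<W> \<times> {..<K})"
    have y2_near: "near actY \<epsilon> (y2 W k) (t (idx W))" if W: "W \<in> \<W>" "k < K" for W k
    proof -
      have "y2 W k \<in> \<pi> ` C W k" using y2[OF W] V2[OF W] by blast
      then have "y2 W k \<in> \<pi> ` B W" by (auto simp: C_def)
      then have "y2 W k \<in> V' W" using B(2)[OF W(1)] by simp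
      then show ?thesis using V'[OF W(1)] by blast
    qed
    have eW: "fst (e l) \<in> \<W>" "snd (e l) < K" if "l < m" for l
      using bij_betwE[OF e] that by (auto simp: mem_Times_iff)
    have "finite \<W>'" using \<W>(1) by (simp add: \<W>'_def)
    moreover have "realizes (insert g G) \<W>'"
      unfolding realizes_def
    proof (intro allI impI)
      fix \<sigma> assume \<sigma>: "\<forall>h\<in>insert g G. \<sigma> h < K"
      then obtain W where W: "W \<in> \<W>" "\<forall>h\<in>G. act h ` W \<subseteq> U (\<sigma> h)"
        using \<W>(2) unfolding realizes_def by blast
      have "C W (\<sigma> g) \<in> \<W>'" using W(1) \<sigma> by (auto simp: \<W>'_def)
      moreover have "act h ` C W (\<sigma> g) \<subseteq> U (\<sigma> h)" if "h \<in> insert g G" for h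
        using that W(2) by (auto simp: C_def B_def)
      ultimately show "\<exists>W\<in>\<W>'. \<forall>h\<in>insert g G. act h ` W \<subseteq> U (\<sigma> h)" by blast
    qed
    moreover have "chained t' (n + m)"
      unfolding chained_def
    proof (intro conjI allI impI)
      fix i assume i: "i < n + m"
      show "t' i \<in> Y"
      proof (cases "i < n")
        case False
        then have l: "i - n < m" using i by simp
        have "y2 (fst (e (i - n))) (snd (e (i - n))) \<in> Y"
          using y2[OF eW[OF l]] V2[OF eW[OF l]] openin_imp_subset by blast
        then show ?thesis using False by (simp add: t'_def)
      qed (simp add: t'_def tY)
      assume "0 < i"
      show "\<exists>j<i. near actY (\<delta> i) (t' i) (t' j)"
      proof (cases "i < n")
        case True
        then show ?thesis using p[OF \<open>0 < i\<close> True] by (intro exI[of _ "p i"]) (auto simp: t'_def)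
      next
        case False
        then have l: "i - n < m" using i by simp
        let ?W = "fst (e (i - n))"
        have "idx ?W < n" using iV[OF eW(1)[OF l]] by simp
        moreover have "near actY (\<delta> i) (t' i) (t (idx ?W))"
          using y2_near[OF eW[OF l]] eps(2)[OF i] False by (auto simp: t'_def intro: Y.near_mono)
        ultimately show ?thesis using False by (intro exI[of _ "idx ?W"]) (auto simp: t'_def)
      qed
    qed
    moreover have "marked t' (n + m) W'" if "W' \<in> \<W>'" for W'
    proof -
      obtain W k where Wk: "W' = C W k" "W \<in> \<W>" "k < K" using \<open>W' \<in> \<W>'\<close> by (auto simp: \<W>'_def)
      then have "(W, k) \<in> e ` {..<m}" using e by (simp add: bij_betw_def)
      then obtain l where l: "l < m" "e l = (W, k)" by auto
      have "t' (n + l) = y2 W k" using l by (simp add: t'_def)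
      then have "t' (n + l) \<in> V2 W k" using y2[OF Wk(2,3)] by simp
      then show ?thesis unfolding marked_def Wk(1)
        using C[OF Wk(2,3)] V2[OF Wk(2,3)] l(1) by (intro conjI exI[of _ "n + l"] exI[of _ "V2 W k"]) auto
    qed
    ultimately have "P (insert g G)" unfolding P_def using G by blast
    then show ?thesis using gG by blast
  qed
  obtain Gs where Gs: "\<And>n. P (Gs n)" "\<And>n. \<exists>g. g \<notin> Gs n \<and> Gs (Suc n) = insert g (Gs n)"
    using dependent_nat_choice[of "\<lambda>_. P" "\<lambda>_ G G'. \<exists>g. g \<notin> G \<and> G' = insert g G"] P0 step by blast
  define J where "J = (\<Union>n. Gs n)"
  have mono: "incseq Gs" using Gs(2) by (intro incseq_SucI) blast
  have fin: "finite (Gs n)" for n using Gs(1)[of n] by (simp add: P_def)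
  have card: "n \<le> card (Gs n)" for n
  proof (induction n)
    case (Suc n)
    obtain g where "g \<notin> Gs n" "Gs (Suc n) = insert g (Gs n)" using Gs(2) by blast
    then show ?case using Suc fin[of n] by simp
  qed simp
  show ?thesis
  proof (intro exI[of _ J] conjI allI impI)
    show "infinite J"
    proof
      assume J: "finite J"
      have "card (Gs (Suc (card J))) \<le> card J" using J by (intro card_mono) (auto simp: J_def)
      then show False using card[of "Suc (card J)"] by simp
    qed
    fix I \<sigma> assume "I \<subseteq> J \<and> finite I \<and> (\<forall>g\<in>I. \<sigma> g < K)"
    then have I: "I \<subseteq> J" "finite I" and \<sigma>: "\<And>g. g \<in> I \<Longrightarrow> \<sigma> g < K" by auto
    have "\<exists>n. I \<subseteq> Gs n" using I(2,1)
    proof (induction I rule: finite_induct)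
      case (insert g I)
      then obtain n n' where "I \<subseteq> Gs n" "g \<in> Gs n'" by (auto simp: J_def)
      then show ?case using incseqD[OF mono, of n "max n n'"] incseqD[OF mono, of n' "max n n'"]
        by (intro exI[of _ "max n n'"]) auto
    qed simp
    then obtain n where n: "I \<subseteq> Gs n" by blast
    \<comment> \<open>The word is prescribed only on \<open>I\<close>; symbol 0 fills the other
      times and is admissible because \<open>K > 0\<close>.\<close>
    define \<sigma>' where "\<sigma>' g = (if g \<in> I then \<sigma> g else 0)" for g
    have "\<forall>g\<in>Gs n. \<sigma>' g < K" using \<sigma> K by (simp add: \<sigma>'_def)
    moreover obtain \<W> t m where W: "realizes (Gs n) \<W>" "\<forall>W\<in>\<W>. marked t m W"
      using Gs(1)[of n] unfolding P_def by blast
    ultimately obtain W where W': "W \<in> \<W>" "\<forall>g\<in>Gs n. act g ` W \<subseteq> U (\<sigma>' g)"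
      unfolding realizes_def by blast
    have "oin X W" "W \<noteq> {}" using W(2) W'(1) by (auto simp: marked_def)
    then obtain x where "x \<in> W" "x \<in> X" using openin_imp_subset by blast
    moreover have "act g x \<in> U (\<sigma> g)" if "g \<in> I" for g
    proof -
      have "g \<in> Gs n" using n that by blast
      then have "act g ` W \<subseteq> U (\<sigma>' g)" using W'(2) by blast
      then have "act g ` W \<subseteq> U (\<sigma> g)" using that by (simp add: \<sigma>'_def)
      then show ?thesis using \<open>x \<in> W\<close> by blast
    qed
    ultimately show "\<exists>x\<in>X. \<forall>g\<in>I. act g x \<in> U (\<sigma> g)" by blast
  qed
qed

end

theorem theorem4p1:
  fixes X :: "'x::metric_space set" and act :: "'g::{group_add, countable} \<Rightarrow> 'x \<Rightarrow> 'x"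
    and Y :: "'y::metric_space set" and actY :: "'g \<Rightarrow> 'y \<Rightarrow> 'y" and \<pi> :: "'x \<Rightarrow> 'y"
    and \<nu> :: "'y measure"
  assumes "infinite (UNIV :: 'g set)"
    and "minimal_tds X act"
    and "property_star X act"
    and "max_equicontinuous_factor X act Y actY \<pi>"
    and "invariant_prob_measure Y actY \<nu>"
    and "E \<in> calX_meas X Y \<pi> \<nu>"
  shows "IT_set X act E"
proof -
  interpret X: minsys X act
    using assms(2) by unfold_locales (auto simp: minimal_tds_def)
  interpret factor X act Y actY \<pi>
    using assms(4) by unfold_locales (auto simp: max_equicontinuous_factor_def)
  interpret star_system X act Y actY \<pi> \<nu>
    using assms by unfold_locales
  have E: "E \<in> calX X Y \<pi>" and pos: "\<And>\<epsilon>. \<epsilon> > 0 \<Longrightarrow> measure \<nu> (piX \<pi> ` calX_ball X Y \<pi> E \<epsilon>) > 0"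
    using assms(6) by (auto simp: calX_meas_def)
  have EX: "E \<noteq> {}" "E \<subseteq> X" using E by (auto simp: calX_def)
  have "IT_tuple X act xs" if xs: "set xs \<subseteq> E" for xs
  proof (cases "xs = []")
    \<comment> \<open>With no symbols there is no admissible \<open>\<sigma>\<close> on a nonempty
      \<open>I\<close>, so any infinite set serves.\<close>
    case True
    then show ?thesis unfolding IT_tuple_def
      using assms(1) by (intro allI impI exI[of _ UNIV]) auto
  next
    case False
    show ?thesis unfolding IT_tuple_def
    proof (intro allI impI)
      fix U assume U: "\<forall>k<length xs. oin X (U k) \<and> xs ! k \<in> U k"
      define K where "K = length xs"
      have K: "K > 0" using False by (simp add: K_def)
      have "\<exists>r>0. X \<inter> cball (xs ! k) r \<subseteq> U k" if "k < K" for k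
        using U that open_contains_cball_in unfolding K_def by metis
      then obtain r where r: "\<And>k. k < K \<Longrightarrow> r k > 0 \<and> X \<inter> cball (xs ! k) (r k) \<subseteq> U k" by metis
      define \<epsilon> where "\<epsilon> = Min (r ` {..<K})"
      have "r ` {..<K} \<noteq> {}" using K by (simp add: lessThan_empty_iff)
      then have "\<epsilon> > 0" unfolding \<epsilon>_def using r by (subst Min_gr_iff) auto
      moreover have "\<epsilon> \<le> r k" if "k < K" for k
        unfolding \<epsilon>_def using that by (intro Min_le) auto
      ultimately have eps: "\<epsilon> > 0" "\<And>k. k < K \<Longrightarrow> \<epsilon> \<le> r k" by blast+
      \<comment> \<open>The base points whose fibre meets each closed ball. It is closed, being an
        intersection of images of compact sets, and it contains the image of the Hausdorff ball
        around \<open>E\<close>, hence has positive measure.\<close>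
      define A where "A = (\<Inter>k\<in>{..<K}. \<pi> ` (X \<inter> cball (xs ! k) \<epsilon>))"
      have cpt: "compact (\<pi> ` (X \<inter> cball x \<epsilon>))" for x
        using pi_cont X.compact_X
        by (intro compact_continuous_image compact_Int_closed) (auto intro: continuous_on_subset)
      have A: "closed A" unfolding A_def using cpt compact_imp_closed by (intro closed_INT) blast
      have AY: "A \<subseteq> Y" using K pi_image by (auto simp: A_def)
      have "piX \<pi> ` calX_ball X Y \<pi> E \<epsilon> \<subseteq> A"
      proof
        fix y assume "y \<in> piX \<pi> ` calX_ball X Y \<pi> E \<epsilon>"
        then obtain F where F: "F \<in> calX X Y \<pi>" "hausdorff_dist E F < \<epsilon>" "y = piX \<pi> F"
          by (auto simp: calX_ball_def)
        have FX: "F \<noteq> {}" "F \<subseteq> X" using F by (auto simp: calX_def)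
        have y: "y = \<pi> f" if "f \<in> F" for f
          unfolding F(3) piX_def by (rule calX_single_fibre[OF F(1) someI[of "\<lambda>x. x \<in> F", OF that] that])
        show "y \<in> A" unfolding A_def
        proof
          fix k assume "k \<in> {..<K}"
          then have "xs ! k \<in> E" using xs by (auto simp: K_def)
          then have "infdist (xs ! k) F < \<epsilon>"
            using infdist_le_hausdorff_dist(1)[OF compact_imp_bounded[OF X.compact_X] EX(2) FX(2) EX(1) FX(1)] F(2)
            by (meson le_less_trans)
          then obtain f where "f \<in> F" "dist (xs ! k) f < \<epsilon>" using infdist_lessE FX(1) by blast
          then show "y \<in> \<pi> ` (X \<inter> cball (xs ! k) \<epsilon>)" using y[of f] FX(2) by auto
        qed
      qed
      moreover have "A \<in> sets \<nu>"
        using A AY compact_closedin[OF Y.compact_X] by (intro N.closed_sets) auto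
      ultimately have "measure \<nu> (piX \<pi> ` calX_ball X Y \<pi> E \<epsilon>) \<le> measure \<nu> A"
        by (rule N.finite_measure_mono)
      then have Apos: "measure \<nu> A > 0" using pos[OF eps(1)] by linarith
      have AU: "A \<subseteq> \<pi> ` U k" if "k < K" for k
      proof -
        have "X \<inter> cball (xs ! k) \<epsilon> \<subseteq> U k" using r[OF that] eps(2)[OF that] by auto
        then show ?thesis using that unfolding A_def by blast
      qed
      have oU: "oin X (U k)" if "k < K" for k using U that by (simp add: K_def)
      have "\<exists>J. infinite J \<and> (\<forall>I \<sigma>. I \<subseteq> J \<and> finite I \<and> (\<forall>g\<in>I. \<sigma> g < K)
          \<longrightarrow> (\<exists>x\<in>X. \<forall>g\<in>I. act g x \<in> U (\<sigma> g)))"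
        by (rule independence[OF K _ A AY Apos]) (simp_all add: oU AU)
      then obtain J where J: "infinite J"
        "\<forall>I \<sigma>. I \<subseteq> J \<and> finite I \<and> (\<forall>g\<in>I. \<sigma> g < K) \<longrightarrow> (\<exists>x\<in>X. \<forall>g\<in>I. act g x \<in> U (\<sigma> g))"
        by (elim exE conjE)
      show "\<exists>J. infinite J \<and> (\<forall>I \<sigma>. I \<subseteq> J \<and> finite I \<and> I \<noteq> {} \<and> (\<forall>g\<in>I. \<sigma> g < length xs) \<longrightarrow>
          (\<Inter>g\<in>I. {x \<in> X. act g x \<in> U (\<sigma> g)}) \<noteq> {})"
      proof (intro exI[of _ J] conjI allI impI J(1))
        fix I \<sigma> assume I: "I \<subseteq> J \<and> finite I \<and> I \<noteq> {} \<and> (\<forall>g\<in>I. \<sigma> g < length xs)"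
        then obtain x where "x \<in> X" "\<forall>g\<in>I. act g x \<in> U (\<sigma> g)"
          using J(2)[rule_format, of I \<sigma>] by (auto simp: K_def)
        then have "x \<in> (\<Inter>g\<in>I. {x \<in> X. act g x \<in> U (\<sigma> g)})" by blast
        then show "(\<Inter>g\<in>I. {x \<in> X. act g x \<in> U (\<sigma> g)}) \<noteq> {}" by blast
      qed
    qed
  qed
  then show ?thesis using EX(1) by (simp add: IT_set_def)
qed

end
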